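(* Let $I=\mathbb R$ and let $h$ satisfy conditions (i), (ii) and (iii) stated in the context. Put $\alpha=\frac{2}{m+2}$. Then $$\lim_{\varepsilon\to0}\left\|(\varepsilon^{2\alpha}\mathbf Q_\varepsilon)^{-1}-(\varepsilon^{2\alpha}\mathbf H_\varepsilon)^{-1}\right\|=0 .$$
   Context: Let $h:\mathbb R\to(0,\infty)$ be a continuous function. Conditions: (i) $x=0$ is the only point of global maximum of $h$ on $\mathbb R$. (ii) $h$ is $C^1$ on $\mathbb R\setminus\{0\}$, and in a neighborhood of $x=0$ it admits the expansion $h(x)=M-c_+x^m+O(x^{m+1})$ for $x>0$ and $h(x)=M-c_-|x|^m+O(|x|^{m+1})$ for $x<0$, where $M,c_+,c_->0$ and $m\ge1$ (so $M=h(0)$). (iii) $\limsup_{|x|\to\infty}h(x)<M$. For $\varepsilon>0$ let $$W_\varepsilon(x)=\frac{\pi^2}{\varepsilon^2}\Bigl(\frac1{h^2(x)}-\frac1{M^2}\Bigr)+\Bigl(\frac{\pi^2}{3}+\frac14\Bigr)\frac{h'(x)^2}{h^2(x)},\qquad \mathbf q_\varepsilon[\chi]=\int_{\mathbb R}\bigl(\chi'(x)^2+W_\varepsilon(x)\chi^2(x)\bigr)dx .$$ $\mathbf Q_\varepsilon$ is the self-adjoint operator on $L^2(\mathbb R)$ generated by the form $\mathbf q_\varepsilon$, which is positive definite and closed on its natural domain $\{\chi\in H^1(\mathbb R):\mathbf q_\varepsilon[\chi]<\infty\}$; formally $\mathbf Q_\varepsilon\chi=-\chi''+W_\varepsilon\chi$.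 Let $q(x)=2\pi^2M^{-3}c_+x^m$ for $x>0$ and $q(x)=2\pi^2M^{-3}c_-|x|^m$ for $x<0$, and for $\varepsilon>0$ let $\mathbf H_\varepsilon=-\frac{d^2}{dx^2}+\varepsilon^{-2}q(x)$ on $L^2(\mathbb R)$. The norm is the operator norm on $L^2(\mathbb R)$.
   Formalization: Condition (ii) is supplemented by the assumption that h' is bounded near x=0; without it the claim fails, e.g. for m=1 and h(x)=M-|x|+x^2 sin(|x|^{-3}) near 0. *)

theory Defs
  imports "HOL-Analysis.Analysis" "HOL-Library.Landau_Symbols"
begin

section \<open>The real Hilbert space of square-integrable functions on the line\<close>

definition square_integrable :: "(real \<Rightarrow> real) \<Rightarrow> bool" where
  "square_integrable f \<longleftrightarrow>
     f \<in> borel_measurable lborel \<and> integrable lborel (\<lambda>x. (f x)\<^sup>2)"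

lemma square_integrable_mult:
  assumes "square_integrable f" "square_integrable g"
  shows "integrable lborel (\<lambda>x. f x * g x)"
proof (rule Bochner_Integration.integrable_bound)
  show "integrable lborel (\<lambda>x. (f x)\<^sup>2 + (g x)\<^sup>2)"
    using assms unfolding square_integrable_def by simp
  show "(\<lambda>x. f x * g x) \<in> borel_measurable lborel"
    using assms unfolding square_integrable_def by (auto intro: borel_measurable_times)
  have "\<bar>f x * g x\<bar> \<le> (f x)\<^sup>2 + (g x)\<^sup>2" for x
  proof -
    have "2 * (\<bar>f x\<bar> * \<bar>g x\<bar>) \<le> (f x)\<^sup>2 + (g x)\<^sup>2"
      using sum_squares_bound[of "\<bar>f x\<bar>" "\<bar>g x\<bar>"] by simp
    moreover have "0 \<le> \<bar>f x\<bar> * \<bar>g x\<bar>" by simp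
    ultimately show ?thesis unfolding abs_mult by linarith
  qed
  then show "AE x in lborel. norm (f x * g x) \<le> norm ((f x)\<^sup>2 + (g x)\<^sup>2)"
    by simp
qed

lemma square_integrable_zero: "square_integrable (\<lambda>x. 0)"
  by (simp add: square_integrable_def)

lemma square_integrable_scale:
  "square_integrable f \<Longrightarrow> square_integrable (\<lambda>x. c * f x)"
  unfolding square_integrable_def power_mult_distrib
  by (auto intro: borel_measurable_times)

lemma square_integrable_add:
  assumes "square_integrable f" "square_integrable g"
  shows "square_integrable (\<lambda>x. f x + g x)"
  using assms square_integrable_mult[OF assms]
  unfolding square_integrable_def power2_sum mult.assoc
  by (auto intro: borel_measurable_add)

quotient_type L2 = "real \<Rightarrow> real" / partial:
  "\<lambda>f g. square_integrable f \<and> square_integrable g \<and> (AE x in lborel. f x = g x)"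
proof (rule part_equivpI)
  show "\<exists>f. square_integrable f \<and> square_integrable f \<and> (AE x in lborel. f x = f x)"
    by (rule exI[of _ "\<lambda>x. 0"]) (simp add: square_integrable_zero)
  show "symp (\<lambda>f g. square_integrable f \<and> square_integrable g \<and> (AE x in lborel. f x = g x))"
    by (auto intro!: sympI elim: eventually_mono)
  show "transp (\<lambda>f g. square_integrable f \<and> square_integrable g \<and> (AE x in lborel. f x = g x))"
    by (rule transpI) (auto elim: eventually_elim2)
qed

instantiation L2 :: real_inner
begin

lift_definition zero_L2 :: L2 is "\<lambda>x. 0"
  by (simp add: square_integrable_zero)

lift_definition plus_L2 :: "L2 \<Rightarrow> L2 \<Rightarrow> L2" is "\<lambda>f g x. f x + g x"
  by (auto simp: square_integrable_add elim: eventually_elim2)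

lift_definition scaleR_L2 :: "real \<Rightarrow> L2 \<Rightarrow> L2" is "\<lambda>c f x. c * f x"
  by (auto simp: square_integrable_scale elim: eventually_mono)

lift_definition uminus_L2 :: "L2 \<Rightarrow> L2" is "\<lambda>f x. - f x"
  using square_integrable_scale[of _ "-1"] by (auto elim: eventually_mono)

lift_definition inner_L2 :: "L2 \<Rightarrow> L2 \<Rightarrow> real" is "\<lambda>f g. \<integral>x. f x * g x \<partial>lborel"
proof (elim conjE, rule integral_cong_AE)
  fix f f' g g' :: "real \<Rightarrow> real"
  assume "AE x in lborel. f x = f' x" "AE x in lborel. g x = g' x"
  then show "AE x in lborel. f x * g x = f' x * g' x"
    by eventually_elim simp
qed (auto simp: square_integrable_def)

definition minus_L2 :: "L2 \<Rightarrow> L2 \<Rightarrow> L2" where "minus_L2 u v = u + - v"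
definition norm_L2 :: "L2 \<Rightarrow> real" where "norm_L2 u = sqrt (inner u u)"
definition sgn_L2 :: "L2 \<Rightarrow> L2" where "sgn_L2 u = inverse (norm u) *\<^sub>R u"
definition dist_L2 :: "L2 \<Rightarrow> L2 \<Rightarrow> real" where "dist_L2 u v = norm (u - v)"
definition uniformity_L2 :: "(L2 \<times> L2) filter" where
  "uniformity_L2 = (INF e\<in>{0<..}. principal {(u, v). dist u v < e})"
definition open_L2 :: "L2 set \<Rightarrow> bool" where
  "open_L2 U \<longleftrightarrow> (\<forall>u\<in>U. eventually (\<lambda>(v, w). v = u \<longrightarrow> w \<in> U) uniformity)"

instance
proof
  fix u v w :: L2 and a b :: real
  show "u + v + w = u + (v + w)"
    by transfer (simp add: square_integrable_add add.assoc)
  show "u + v = v + u"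
    by transfer (simp add: square_integrable_add add.commute)
  show "0 + u = u" by transfer simp
  show "- u + u = 0" by transfer (simp add: square_integrable_zero)
  show "u - v = u + - v" by (simp add: minus_L2_def)
  show "a *\<^sub>R (u + v) = a *\<^sub>R u + a *\<^sub>R v"
    by transfer (simp add: square_integrable_add square_integrable_scale distrib_left)
  show "(a + b) *\<^sub>R u = a *\<^sub>R u + b *\<^sub>R u"
    by transfer (use square_integrable_scale in
      \<open>simp add: square_integrable_add square_integrable_scale distrib_right\<close>)
  show "a *\<^sub>R b *\<^sub>R u = (a * b) *\<^sub>R u"
    by transfer (use square_integrable_scale in \<open>simp add: mult.assoc[symmetric]\<close>)
  show "1 *\<^sub>R u = u" by transfer simp
  show "inner u v = inner v u" by transfer (simp add: mult.commute)
  show "inner (u + v) w = inner u w + inner v w"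
    by transfer (simp add: distrib_right square_integrable_mult)
  show "inner (a *\<^sub>R u) v = a * inner u v"
    by transfer (simp add: mult.assoc)
  show "0 \<le> inner u u" by transfer simp
  show "inner u u = 0 \<longleftrightarrow> u = 0"
    by transfer (auto simp: square_integrable_zero square_integrable_mult
        integral_nonneg_eq_0_iff_AE)
  show "norm u = sqrt (inner u u)" by (rule norm_L2_def)
  show "sgn u = inverse (norm u) *\<^sub>R u" by (rule sgn_L2_def)
  show "dist u v = norm (u - v)" by (rule dist_L2_def)
qed (simp_all add: uniformity_L2_def open_L2_def)

end


section \<open>The Sobolev space \<open>H\<^sup>1\<close> of the line\<close>

text \<open>Testing against \<open>C\<^sup>1\<close> functions of compact support gives the same weak derivatives as
  testing against smooth ones.\<close>

definition test_function :: "(real \<Rightarrow> real) \<Rightarrow> bool" where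
  "test_function \<phi> \<longleftrightarrow> \<phi> C1_differentiable_on UNIV \<and> compact (closure {x. \<phi> x \<noteq> 0})"

text \<open>The function \<open>rep_L2 u\<close> is some representative of the class \<open>u\<close>; nothing below depends
  on which one.\<close>

definition has_weak_deriv :: "L2 \<Rightarrow> L2 \<Rightarrow> bool" where
  "has_weak_deriv u g \<longleftrightarrow>
     (\<forall>\<phi>. test_function \<phi> \<longrightarrow>
        (\<integral>x. rep_L2 u x * deriv \<phi> x \<partial>lborel) = - (\<integral>x. rep_L2 g x * \<phi> x \<partial>lborel))"

definition H1 :: "L2 set" where
  "H1 = {u. \<exists>g. has_weak_deriv u g}"

definition weak_deriv :: "L2 \<Rightarrow> L2" where
  "weak_deriv u = (THE g. has_weak_deriv u g)"


section \<open>Unbounded operators, as graphs of pairs (argument, value)\<close>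

definition op_scale :: "real \<Rightarrow> (L2 \<times> L2) set \<Rightarrow> (L2 \<times> L2) set" where
  "op_scale c A = {(u, c *\<^sub>R f) | u f. (u, f) \<in> A}"

definition is_op_inverse :: "(L2 \<Rightarrow>\<^sub>L L2) \<Rightarrow> (L2 \<times> L2) set \<Rightarrow> bool" where
  "is_op_inverse T A \<longleftrightarrow> A\<inverse> = {(f, blinfun_apply T f) | f. True}"

definition boundedly_invertible :: "(L2 \<times> L2) set \<Rightarrow> bool" where
  "boundedly_invertible A \<longleftrightarrow> (\<exists>T. is_op_inverse T A)"

text \<open>Only meaningful when \<open>boundedly_invertible A\<close>; the inverse is then unique.\<close>

definition op_inverse :: "(L2 \<times> L2) set \<Rightarrow> L2 \<Rightarrow>\<^sub>L L2" where
  "op_inverse A = (THE T. is_op_inverse T A)"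

text \<open>The operator generated by a symmetric form \<open>a\<close> with domain \<open>D\<close>.\<close>

definition form_operator :: "L2 set \<Rightarrow> (L2 \<Rightarrow> L2 \<Rightarrow> real) \<Rightarrow> (L2 \<times> L2) set" where
  "form_operator D a = {(u, f). u \<in> D \<and> (\<forall>v\<in>D. a u v = inner f v)}"


section \<open>Schroedinger operators\<close>

text \<open>The quadratic form is \<open>u \<mapsto> schroedinger_form V u u\<close>. It is used for measurable
  potentials \<open>V \<ge> 0\<close>, for which integrability of its density says that the form is finite
  at \<open>u\<close>.\<close>

definition schroedinger_form :: "(real \<Rightarrow> real) \<Rightarrow> L2 \<Rightarrow> L2 \<Rightarrow> real" where
  "schroedinger_form V u v =
     (\<integral>x. (rep_L2 (weak_deriv u) x * rep_L2 (weak_deriv v) x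
          + V x * (rep_L2 u x * rep_L2 v x)) \<partial>lborel)"

definition form_domain :: "(real \<Rightarrow> real) \<Rightarrow> L2 set" where
  "form_domain V =
     {u \<in> H1. integrable lborel (\<lambda>x. (rep_L2 (weak_deriv u) x)\<^sup>2 + V x * (rep_L2 u x)\<^sup>2)}"

definition schroedinger_operator :: "(real \<Rightarrow> real) \<Rightarrow> (L2 \<times> L2) set" where
  "schroedinger_operator V = form_operator (form_domain V) (schroedinger_form V)"

definition W_pot :: "(real \<Rightarrow> real) \<Rightarrow> real \<Rightarrow> real \<Rightarrow> real \<Rightarrow> real" where
  "W_pot h M \<epsilon> x =
     pi\<^sup>2 / \<epsilon>\<^sup>2 * (1 / (h x)\<^sup>2 - 1 / M\<^sup>2) + (pi\<^sup>2 / 3 + 1 / 4) * ((deriv h x)\<^sup>2 / (h x)\<^sup>2)"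

definition q_pot :: "real \<Rightarrow> real \<Rightarrow> real \<Rightarrow> real \<Rightarrow> real \<Rightarrow> real" where
  "q_pot M cp cm m x = 2 * pi\<^sup>2 / M ^ 3 * (if x > 0 then cp else cm) * \<bar>x\<bar> powr m"

definition Q_op :: "(real \<Rightarrow> real) \<Rightarrow> real \<Rightarrow> real \<Rightarrow> (L2 \<times> L2) set" where
  "Q_op h M \<epsilon> = schroedinger_operator (W_pot h M \<epsilon>)"

definition H_op :: "real \<Rightarrow> real \<Rightarrow> real \<Rightarrow> real \<Rightarrow> real \<Rightarrow> (L2 \<times> L2) set" where
  "H_op M cp cm m \<epsilon> = schroedinger_operator (\<lambda>x. q_pot M cp cm m x / \<epsilon>\<^sup>2)"


section \<open>The expansion of the profile at its maximum\<close>

text \<open>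
  The last conjunct is what remains of reading the expansion as one that may be differentiated
  term by term (\<open>h'(x) = - m c\<^sub>+ x\<^sup>m\<^sup>-\<^sup>1 + O(x\<^sup>m)\<close> and correspondingly on the left): as \<open>m \<ge> 1\<close>,
  that reading makes \<open>h'\<close> bounded near 0. Expanding the values of \<open>h\<close> alone gives no control
  over \<open>h'\<close>, which enters the potential: if \<open>h(x) = M - \<bar>x\<bar> + x\<^sup>2 sin(\<bar>x\<bar>\<^sup>-\<^sup>3)\<close> near 0, then the
  term \<open>h'\<^sup>2/h\<^sup>2\<close> oscillates at size \<open>x\<^sup>-\<^sup>4\<close>, and the inverses of the
  \<open>\<epsilon>\<^sup>2\<^sup>\<alpha>\<close>-multiples of \<open>Q_op\<close> tend to 0 in norm, while those of \<open>H_op\<close> have a constant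
  positive norm.
\<close>

definition expansion_at_0 ::
  "(real \<Rightarrow> real) \<Rightarrow> real \<Rightarrow> real \<Rightarrow> real \<Rightarrow> real \<Rightarrow> bool" where
  "expansion_at_0 h M cp cm m \<longleftrightarrow>
     (\<lambda>x. h x - (M - cp * x powr m)) \<in> O[at_right 0](\<lambda>x. x powr (m + 1)) \<and>
     (\<lambda>x. h x - (M - cm * \<bar>x\<bar> powr m)) \<in> O[at_left 0](\<lambda>x. \<bar>x\<bar> powr (m + 1)) \<and>
     deriv h \<in> O[at 0](\<lambda>_. 1)"

end

theory Submission
  imports Defs
begin

text \<open>Put \<open>V = q / \<epsilon>\<^sup>2\<close> and let \<open>W\<close> be the potential of \<open>Q_op\<close>. Up to a bounded term both are of order
  \<open>\<bar>x\<bar>\<^sup>m / \<epsilon>\<^sup>2\<close> near 0, and outside a fixed neighbourhood of 0 both exceed a constant multiple of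
  \<open>1 / \<epsilon>\<^sup>2\<close>. A function of norm 1 concentrated on \<open>\<bar>x\<bar> \<le> r\<close> has kinetic energy at least of order
  \<open>1 / r\<^sup>2\<close>, unless a good part of it sits in \<open>\<bar>x\<bar> \<ge> r\<close>, where the potential costs \<open>r\<^sup>m / \<epsilon>\<^sup>2\<close>. The two
  costs agree for \<open>r = \<epsilon>\<^sup>\<alpha>\<close>, so both forms are bounded below by a multiple of \<open>\<epsilon>\<close> to the power
  \<open>- 2 \<alpha>\<close> (\<open>coerciveI\<close>, which rests on the Poincare inequality \<open>norm_interior_le\<close>). The inverses
  \<open>T\<^sub>W\<close> and \<open>T\<^sub>V\<close> of the unscaled operators thus have norm \<open>O(\<epsilon>\<^sup>2\<^sup>\<alpha>)\<close>, and the claim is that their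
  difference is \<open>o(\<epsilon>\<^sup>2\<^sup>\<alpha>)\<close>.

  For \<open>u = T\<^sub>W f\<close> and \<open>v = T\<^sub>V g\<close> one would like to write \<open>\<langle>u, g\<rangle> - \<langle>f, v\<rangle>\<close> as the integral of
  \<open>(V - W) u v\<close>, but \<open>u\<close> and \<open>v\<close> lie in different form domains: far from 0 neither
  potential need dominate the other. With a cutoff \<open>\<psi>\<close>, equal to 1 on \<open>\<bar>x\<bar> \<le> \<delta>/2\<close> and to 0 on \<open>\<bar>x\<bar> \<ge> \<delta>\<close>, the two
  equations may be tested with \<open>\<psi> v\<close> and \<open>\<psi> u\<close>, and then
  \<open>\<langle>\<psi> u, g\<rangle> - \<langle>f, \<psi> v\<rangle> = \<langle>v', \<psi>' u\<rangle> - \<langle>u', \<psi>' v\<rangle> + \<integral> (V - W) \<psi> u v\<close>.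
  Everything outside \<open>\<bar>x\<bar> \<le> \<delta>/2\<close> is negligible: the energy of \<open>u\<close> is \<open>O(\<epsilon>\<^sup>2\<^sup>\<alpha>)\<close>, the potential there
  is at least of order \<open>1 / \<epsilon>\<^sup>2\<close>, so the exterior part of \<open>u\<close> has norm \<open>O(\<epsilon>\<^sup>1\<^sup>+\<^sup>\<alpha>)\<close>, and \<open>\<alpha> < 1\<close>. On the
  support of \<open>\<psi>\<close> the expansion of \<open>h\<close> gives
  \<open>\<bar>V - W\<bar> \<le> C \<bar>x\<bar>\<^sup>m\<^sup>+\<^sup>1 / \<epsilon>\<^sup>2 + C \<le> C' \<delta> (V W)\<^sup>1\<^sup>/\<^sup>2 + C\<close>, so by the Cauchy-Schwarz inequality the
  last integral is at most \<open>C'' \<delta> \<epsilon>\<^sup>2\<^sup>\<alpha> + O(\<epsilon>\<^sup>4\<^sup>\<alpha>)\<close> for unit \<open>f\<close> and \<open>g\<close>. Now \<open>\<epsilon> \<rightarrow> 0\<close> and then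
  \<open>\<delta> \<rightarrow> 0\<close>. The estimate for fixed \<open>\<epsilon>\<close> and \<open>\<delta>\<close> is \<open>schroedinger_inverse_diff_le\<close>, the limit is
  \<open>scaled_inverses_converge\<close>, and both are statements about potentials only; the profile \<open>h\<close> enters
  in the last section.

  The inverses exist because \<open>u \<mapsto> (u', V\<^sup>1\<^sup>/\<^sup>2 u)\<close> is a closed map into \<open>L\<^sup>2 \<times> L\<^sup>2\<close>, so that the
  Dirichlet principle (\<open>closed_form_representation\<close>) applies once \<open>L\<^sup>2\<close> is known to be complete.
  Weak derivatives are handled by duality throughout: their uniqueness and the Poincare
  inequality both come from the density of test functions.\<close>

section \<open>Square-integrable functions and their classes\<close>

lemma rep_L2_square_integrable: "square_integrable (rep_L2 u)"
  using Quotient_rep_reflp[OF Quotient_L2, of u] by simp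

lemma rep_L2_measurable [measurable]: "rep_L2 u \<in> borel_measurable lborel"
  using rep_L2_square_integrable[of u] by (simp add: square_integrable_def)

lemma rep_abs_L2:
  assumes "square_integrable f"
  shows "AE x in lborel. rep_L2 (abs_L2 f) x = f x"
  using rep_abs_rsp_left[OF Quotient3_L2, of f f] assms by simp

lemma L2_eqI:
  assumes "AE x in lborel. rep_L2 u x = rep_L2 v x"
  shows "u = v"
  using Quotient3_rel_rep[OF Quotient3_L2, of u v] assms rep_L2_square_integrable by simp

lemma abs_L2_rep [simp]: "abs_L2 (rep_L2 u) = u"
  by (rule Quotient3_abs_rep[OF Quotient3_L2])

lemma abs_L2_cong:
  assumes "square_integrable f" "square_integrable g" "AE x in lborel. f x = g x"
  shows "abs_L2 f = abs_L2 g"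
  using Quotient3_rel_abs[OF Quotient3_L2, of f g] assms by simp

lemma rep_L2_add: "AE x in lborel. rep_L2 (u + v) x = rep_L2 u x + rep_L2 v x"
proof -
  have "u + v = abs_L2 (\<lambda>x. rep_L2 u x + rep_L2 v x)"
    using plus_L2.abs_eq[of "rep_L2 u" "rep_L2 v"] rep_L2_square_integrable by simp
  then show ?thesis
    using rep_abs_L2[OF square_integrable_add[OF rep_L2_square_integrable rep_L2_square_integrable]]
    by simp
qed

lemma rep_L2_scaleR: "AE x in lborel. rep_L2 (c *\<^sub>R u) x = c * rep_L2 u x"
proof -
  have "c *\<^sub>R u = abs_L2 (\<lambda>x. c * rep_L2 u x)"
    using scaleR_L2.abs_eq[of "rep_L2 u" c] rep_L2_square_integrable by simp
  then show ?thesis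
    using rep_abs_L2[OF square_integrable_scale[OF rep_L2_square_integrable]] by simp
qed

lemma rep_L2_diff: "AE x in lborel. rep_L2 (u - v) x = rep_L2 u x - rep_L2 v x"
proof -
  have "u - v = u + (-1) *\<^sub>R v" by simp
  then show ?thesis
    using rep_L2_add[of u "(-1) *\<^sub>R v"] rep_L2_scaleR[of "-1" v]
    by (auto elim: eventually_elim2)
qed

lemma inner_L2_eq_integral: "inner u v = (\<integral>x. rep_L2 u x * rep_L2 v x \<partial>lborel)"
  using inner_L2.abs_eq[of "rep_L2 u" "rep_L2 v"] rep_L2_square_integrable by simp

lemma inner_abs_L2:
  assumes "square_integrable f" "square_integrable g"
  shows "inner (abs_L2 f) (abs_L2 g) = (\<integral>x. f x * g x \<partial>lborel)"
  using inner_L2.abs_eq[of f g] assms by simp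

lemma norm_L2_eq_integral: "(norm u)\<^sup>2 = (\<integral>x. (rep_L2 u x)\<^sup>2 \<partial>lborel)"
  by (simp only: power2_norm_eq_inner inner_L2_eq_integral) (simp add: power2_eq_square)

lemma norm_abs_L2:
  assumes "square_integrable f"
  shows "(norm (abs_L2 f))\<^sup>2 = (\<integral>x. (f x)\<^sup>2 \<partial>lborel)"
  unfolding power2_norm_eq_inner using inner_abs_L2[OF assms assms] by (simp add: power2_eq_square)

lemma square_integrable_integrable: "square_integrable f \<Longrightarrow> integrable lborel (\<lambda>x. (f x)\<^sup>2)"
  by (simp add: square_integrable_def)

lemma square_integrable_measurable: "square_integrable f \<Longrightarrow> f \<in> borel_measurable lborel"
  by (simp add: square_integrable_def)

lemma square_integrable_diff:
  assumes "square_integrable f" "square_integrable g"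
  shows "square_integrable (\<lambda>x. f x - g x)"
  using square_integrable_add[OF assms(1) square_integrable_scale[OF assms(2), of "-1"]] by simp

lemma abs_L2_diff:
  assumes "square_integrable f" "square_integrable g"
  shows "abs_L2 f - abs_L2 g = abs_L2 (\<lambda>x. f x - g x)"
  by (rule L2_eqI)
    (use rep_L2_diff[of "abs_L2 f" "abs_L2 g"] rep_abs_L2[OF assms(1)] rep_abs_L2[OF assms(2)]
       rep_abs_L2[OF square_integrable_diff[OF assms]] in eventually_elim, simp)

lemma Cauchy_Schwarz_square_integrable:
  assumes "square_integrable f" "square_integrable g"
  shows "\<bar>\<integral>x. f x * g x \<partial>lborel\<bar> \<le> sqrt (\<integral>x. (f x)\<^sup>2 \<partial>lborel) * sqrt (\<integral>x. (g x)\<^sup>2 \<partial>lborel)"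
proof -
  have "norm (abs_L2 f) = sqrt (\<integral>x. (f x)\<^sup>2 \<partial>lborel)" if "square_integrable f" for f
    using norm_abs_L2[OF that] by (metis norm_ge_zero real_sqrt_unique)
  then show ?thesis
    using Cauchy_Schwarz_ineq2[of "abs_L2 f" "abs_L2 g"] inner_abs_L2[OF assms] assms by simp
qed

lemma square_integrable_bounded_mult:
  assumes "b \<in> borel_measurable lborel" "\<And>x. \<bar>b x\<bar> \<le> B" "square_integrable f"
  shows "square_integrable (\<lambda>x. b x * f x)"
  unfolding square_integrable_def
proof
  have f[measurable]: "f \<in> borel_measurable lborel" using assms(3) by (rule square_integrable_measurable)
  show m: "(\<lambda>x. b x * f x) \<in> borel_measurable lborel" using assms(1) by measurable
  show "integrable lborel (\<lambda>x. (b x * f x)\<^sup>2)"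
  proof (rule Bochner_Integration.integrable_bound)
    show "integrable lborel (\<lambda>x. B\<^sup>2 * (f x)\<^sup>2)"
      using square_integrable_integrable[OF assms(3)] by simp
    show "(\<lambda>x. (b x * f x)\<^sup>2) \<in> borel_measurable lborel" using m by measurable
    show "AE x in lborel. norm ((b x * f x)\<^sup>2) \<le> norm (B\<^sup>2 * (f x)\<^sup>2)"
    proof (intro always_eventually allI)
      fix x
      have "(b x)\<^sup>2 \<le> B\<^sup>2" using power_mono[OF assms(2)[of x], of 2] by simp
      then show "norm ((b x * f x)\<^sup>2) \<le> norm (B\<^sup>2 * (f x)\<^sup>2)"
        by (simp add: power_mult_distrib mult_right_mono)
    qed
  qed
qed

lemma square_integrable_cong_AE:
  assumes [measurable]: "f \<in> borel_measurable borel" and g: "square_integrable g" and ae: "AE x in lborel. g x = f x"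
  shows "square_integrable f"
proof -
  have "AE x in lborel. (g x)\<^sup>2 = (f x)\<^sup>2" using ae by eventually_elim simp
  then have "integrable lborel (\<lambda>x. (f x)\<^sup>2)"
    by (rule integrable_cong_AE_imp[OF square_integrable_integrable[OF g], rotated]) measurable
  then show ?thesis by (simp add: square_integrable_def)
qed

lemma square_integrable_mono:
  assumes [measurable]: "f \<in> borel_measurable borel" and "square_integrable g" "\<And>x. (f x)\<^sup>2 \<le> C * (g x)\<^sup>2"
  shows "square_integrable f" "(\<integral>x. (f x)\<^sup>2 \<partial>lborel) \<le> C * (\<integral>x. (g x)\<^sup>2 \<partial>lborel)"
proof -
  have g: "integrable lborel (\<lambda>x. C * (g x)\<^sup>2)"
    using square_integrable_integrable[OF assms(2)] by simp
  have i: "integrable lborel (\<lambda>x. (f x)\<^sup>2)"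
  proof (rule Bochner_Integration.integrable_bound[OF g])
    show "AE x in lborel. norm ((f x)\<^sup>2) \<le> norm (C * (g x)\<^sup>2)"
      using order_trans[OF assms(3) abs_ge_self] by (intro always_eventually allI) simp
  qed measurable
  then show "square_integrable f" by (simp add: square_integrable_def)
  have "(\<integral>x. (f x)\<^sup>2 \<partial>lborel) \<le> (\<integral>x. C * (g x)\<^sup>2 \<partial>lborel)"
    by (rule integral_mono[OF i g assms(3)])
  then show "(\<integral>x. (f x)\<^sup>2 \<partial>lborel) \<le> C * (\<integral>x. (g x)\<^sup>2 \<partial>lborel)" by simp
qed

lemma L2_convergent_AE_subseq:
  fixes u :: "nat \<Rightarrow> L2"
  assumes "u \<longlonglongrightarrow> l"
  shows "\<exists>r. strict_mono (r::nat\<Rightarrow>nat) \<and> (AE x in lborel. (\<lambda>n. rep_L2 (u (r n)) x) \<longlonglongrightarrow> rep_L2 l x)"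
proof -
  have "(\<lambda>n. (norm (u n - l))\<^sup>2) \<longlonglongrightarrow> 0"
    using tendsto_power[OF tendsto_norm[OF LIM_zero[OF assms]], of 2] by simp
  then have "(\<lambda>n. \<integral>x. norm ((rep_L2 (u n - l) x)\<^sup>2) \<partial>lborel) \<longlonglongrightarrow> 0"
    by (simp add: norm_L2_eq_integral)
  then obtain r :: "nat \<Rightarrow> nat" where r: "strict_mono r"
    and lim: "AE x in lborel. (\<lambda>n. (rep_L2 (u (r n) - l) x)\<^sup>2) \<longlonglongrightarrow> 0"
    using tendsto_L1_AE_subseq[of lborel "\<lambda>n x. (rep_L2 (u n - l) x)\<^sup>2"]
      square_integrable_integrable[OF rep_L2_square_integrable] by blast
  have "AE x in lborel. \<forall>n. rep_L2 (u (r n) - l) x = rep_L2 (u (r n)) x - rep_L2 l x"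
    by (simp add: AE_all_countable rep_L2_diff)
  with lim have "AE x in lborel. (\<lambda>n. rep_L2 (u (r n)) x) \<longlonglongrightarrow> rep_L2 l x"
  proof eventually_elim
    case (elim x)
    then have "(\<lambda>n. (rep_L2 (u (r n)) x - rep_L2 l x)\<^sup>2) \<longlonglongrightarrow> 0" by simp
    from tendsto_real_sqrt[OF this] have "(\<lambda>n. rep_L2 (u (r n)) x - rep_L2 l x) \<longlonglongrightarrow> 0"
      by (simp add: tendsto_rabs_zero_iff)
    then show ?case by (rule LIM_zero_cancel)
  qed
  with r show ?thesis by blast
qed

lemma nn_integral_L2: "(\<integral>\<^sup>+ x. ennreal ((rep_L2 u x)\<^sup>2) \<partial>lborel) = ennreal ((norm u)\<^sup>2)"
  by (subst nn_integral_eq_integral)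
    (simp_all add: square_integrable_integrable[OF rep_L2_square_integrable] norm_L2_eq_integral)

text \<open>The functions \<open>2\<^sup>n (u\<^sub>n\<^sub>+\<^sub>1 - u\<^sub>n)\<^sup>2\<close> have summable integrals. Hence at almost every point their sum is
  finite and the increments \<open>u\<^sub>n\<^sub>+\<^sub>1 - u\<^sub>n\<close> decay geometrically, which gives a pointwise limit; Fatou's
  lemma turns the uniform bound on \<open>norm (u k - u n)\<close> into convergence in norm.\<close>

lemma L2_fast_Cauchy_convergent:
  fixes u :: "nat \<Rightarrow> L2"
  assumes fast: "\<And>n k. n \<le> k \<Longrightarrow> norm (u k - u n) \<le> (1/2)^n"
  shows "\<exists>l. u \<longlonglongrightarrow> l"
proof -
  define d where "d n x = (rep_L2 (u (Suc n) - u n) x)\<^sup>2" for n x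
  have dm[measurable]: "d n \<in> borel_measurable lborel" for n unfolding d_def by measurable
  have "(\<integral>\<^sup>+ x. (\<Sum>n. ennreal (2^n * d n x)) \<partial>lborel) = (\<Sum>n. \<integral>\<^sup>+ x. ennreal (2^n * d n x) \<partial>lborel)"
    by (rule nn_integral_suminf) measurable
  also have "\<dots> = (\<Sum>n. ennreal (2^n * (norm (u (Suc n) - u n))\<^sup>2))"
    by (subst ennreal_mult; (subst nn_integral_cmult)?) (simp_all add: d_def nn_integral_L2 ennreal_mult)
  also have "\<dots> \<le> (\<Sum>n. ennreal ((1/2)^n))"
  proof (intro suminf_le summableI ennreal_leI)
    fix n
    have "2^n * (norm (u (Suc n) - u n))\<^sup>2 \<le> 2^n * ((1/2)^n)\<^sup>2"
      by (intro mult_left_mono power_mono fast) auto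
    also have "\<dots> = (1/2)^n" by (simp add: power2_eq_square power_divide)
    finally show "2^n * (norm (u (Suc n) - u n))\<^sup>2 \<le> (1/2)^n" .
  qed
  also have "\<dots> = ennreal (\<Sum>n. (1/2)^n)"
    by (rule suminf_ennreal2) (auto intro: summable_geometric)
  finally have "(\<integral>\<^sup>+ x. (\<Sum>n. ennreal (2^n * d n x)) \<partial>lborel) \<noteq> \<infinity>"
    unfolding infinity_ennreal_def by (rule neq_top_trans[OF ennreal_neq_top])
  then have "AE x in lborel. (\<Sum>n. ennreal (2^n * d n x)) \<noteq> \<infinity>"
    by (intro nn_integral_PInf_AE) auto
  moreover have "AE x in lborel. \<forall>n. rep_L2 (u (Suc n) - u n) x = rep_L2 (u (Suc n)) x - rep_L2 (u n) x"
    by (simp add: AE_all_countable rep_L2_diff)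
  ultimately have conv: "AE x in lborel. convergent (\<lambda>n. rep_L2 (u n) x)"
  proof eventually_elim
    case (elim x)
    then have "(\<Sum>n. ennreal (2^n * d n x)) < top" by (simp add: less_top)
    then have "summable (\<lambda>n. 2^n * d n x)"
      by (intro summable_suminf_not_top) (auto simp: d_def)
    then have "(\<lambda>n. 2^n * d n x) \<longlonglongrightarrow> 0" by (rule summable_LIMSEQ_zero)
    then have "Bseq (\<lambda>n. 2^n * d n x)" by (intro convergent_imp_Bseq convergentI)
    then obtain C where C: "C > 0" "\<And>n. norm (2^n * d n x) \<le> C" by (auto elim: BseqE)
    have "norm (rep_L2 (u (Suc n)) x - rep_L2 (u n) x) \<le> sqrt C * (sqrt (1/2))^n" for n
    proof -
      have "d n x \<le> C * (1/2)^n"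
        using C(2)[of n] by (simp add: d_def field_simps)
      then have "sqrt (d n x) \<le> sqrt C * (sqrt (1/2))^n"
        by (metis real_sqrt_le_mono real_sqrt_mult real_sqrt_power)
      then show ?thesis using elim(2) by (simp add: d_def)
    qed
    moreover have "summable (\<lambda>n. sqrt C * (sqrt (1/2))^n)"
      by (intro summable_mult summable_geometric) (simp add: real_sqrt_lt_1_iff)
    ultimately have "summable (\<lambda>n. rep_L2 (u (Suc n)) x - rep_L2 (u n) x)"
      by (rule summable_comparison_test'[where N = 0, rotated])
    then have "convergent (\<lambda>n. \<Sum>i<n. rep_L2 (u (Suc i)) x - rep_L2 (u i) x)"
      by (simp add: summable_iff_convergent)
    then have "convergent (\<lambda>n. rep_L2 (u n) x - rep_L2 (u 0) x)"
      using sum_lessThan_telescope[of "\<lambda>n. rep_L2 (u n) x"] by simp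
    from convergent_add[OF this convergent_const[of "rep_L2 (u 0) x"]] show ?case by simp
  qed
  define f where "f x = lim (\<lambda>n. rep_L2 (u n) x)" for x
  have fm[measurable]: "f \<in> borel_measurable lborel" unfolding f_def by measurable
  have lim: "AE x in lborel. (\<lambda>n. rep_L2 (u n) x) \<longlonglongrightarrow> f x"
    using conv by eventually_elim (simp add: f_def convergent_LIMSEQ_iff)
  have fatou: "(\<integral>\<^sup>+ x. ennreal ((f x - rep_L2 (u n) x)\<^sup>2) \<partial>lborel) \<le> ennreal (((1/2)^n)\<^sup>2)" for n
  proof -
    have "(\<integral>\<^sup>+ x. ennreal ((f x - rep_L2 (u n) x)\<^sup>2) \<partial>lborel)
        = (\<integral>\<^sup>+ x. liminf (\<lambda>k. ennreal ((rep_L2 (u k) x - rep_L2 (u n) x)\<^sup>2)) \<partial>lborel)"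
    proof (rule nn_integral_cong_AE, use lim in eventually_elim)
      case (elim x)
      have "(\<lambda>k. ennreal ((rep_L2 (u k) x - rep_L2 (u n) x)\<^sup>2)) \<longlonglongrightarrow> ennreal ((f x - rep_L2 (u n) x)\<^sup>2)"
        using elim by (intro tendsto_ennrealI tendsto_intros)
      from lim_imp_Liminf[OF sequentially_bot this] show ?case by simp
    qed
    also have "\<dots> \<le> liminf (\<lambda>k. \<integral>\<^sup>+ x. ennreal ((rep_L2 (u k) x - rep_L2 (u n) x)\<^sup>2) \<partial>lborel)"
      by (rule nn_integral_liminf) measurable
    also have "\<dots> = liminf (\<lambda>k. ennreal ((norm (u k - u n))\<^sup>2))"
    proof -
      have "(\<integral>\<^sup>+ x. ennreal ((rep_L2 (u k) x - rep_L2 (u n) x)\<^sup>2) \<partial>lborel) = ennreal ((norm (u k - u n))\<^sup>2)" for k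
        unfolding nn_integral_L2[symmetric]
        by (rule nn_integral_cong_AE, use rep_L2_diff[of "u k" "u n"] in eventually_elim) simp
      then show ?thesis by simp
    qed
    also have "\<dots> \<le> limsup (\<lambda>k. ennreal ((norm (u k - u n))\<^sup>2))"
      by (rule Liminf_le_Limsup) simp
    also have "\<dots> \<le> ennreal (((1/2)^n)\<^sup>2)"
      by (rule Limsup_bounded) (use eventually_ge_at_top[of n] in eventually_elim,
        auto intro!: ennreal_leI power_mono fast)
    finally show ?thesis .
  qed
  have si: "square_integrable (\<lambda>x. f x - rep_L2 (u n) x)" for n
    unfolding square_integrable_def
  proof
    show "integrable lborel (\<lambda>x. (f x - rep_L2 (u n) x)\<^sup>2)"
      by (rule integrableI_bounded)
        (use order_le_less_trans[OF fatou[of n] ennreal_less_top] in auto)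
  qed measurable
  have sf: "square_integrable f"
    using square_integrable_add[OF si[of 0] rep_L2_square_integrable[of "u 0"]] by simp
  have "norm (u n - abs_L2 f) \<le> (1/2)^n" for n
  proof -
    have "(norm (abs_L2 f - u n))\<^sup>2 = (\<integral>x. (f x - rep_L2 (u n) x)\<^sup>2 \<partial>lborel)"
      using norm_abs_L2[OF si[of n]] abs_L2_diff[OF sf rep_L2_square_integrable[of "u n"]] by simp
    then have "ennreal ((norm (abs_L2 f - u n))\<^sup>2) \<le> ennreal (((1/2)^n)\<^sup>2)"
      using fatou[of n] nn_integral_eq_integral[OF square_integrable_integrable[OF si[of n]]] by simp
    then have "(norm (abs_L2 f - u n))\<^sup>2 \<le> ((1/2)^n)\<^sup>2" by (subst (asm) ennreal_le_iff) auto
    then have "norm (abs_L2 f - u n) \<le> (1/2)^n" by (rule power2_le_imp_le) simp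
    then show ?thesis by (subst norm_minus_commute)
  qed
  then have "(\<lambda>n. u n - abs_L2 f) \<longlonglongrightarrow> 0"
    by (intro Lim_null_comparison[OF _ LIMSEQ_realpow_zero[of "1/2"]] always_eventually) auto
  then show ?thesis using LIM_zero_cancel by blast
qed

instance L2 :: complete_space
proof
  fix X :: "nat \<Rightarrow> L2"
  assume X: "Cauchy X"
  have "\<exists>N. \<forall>i\<ge>N. \<forall>j\<ge>N. dist (X i) (X j) < (1/2)^n" for n :: nat
    using X by (auto simp: Cauchy_def)
  then obtain N where N: "\<And>n i j. i \<ge> N n \<Longrightarrow> j \<ge> N n \<Longrightarrow> dist (X i) (X j) < (1/2)^n" for n :: nat
    by metis
  define r where "r n = (\<Sum>k\<le>n. Suc (N k))" for n
  have r: "strict_mono r" by (auto simp: strict_mono_Suc_iff r_def)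
  have "N n \<le> r n" for n unfolding r_def by (cases n) auto
  then have "norm (X (r k) - X (r n)) \<le> (1/2)^n" if "n \<le> k" for n k
    using N[of n "r k" "r n"] that strict_mono_less_eq[OF r] by (metis dist_norm less_imp_le order_trans)
  then obtain l where "(\<lambda>n. X (r n)) \<longlonglongrightarrow> l" using L2_fast_Cauchy_convergent[of "\<lambda>n. X (r n)"] by auto
  then have "X \<longlonglongrightarrow> l" using Cauchy_converges_subseq[OF X r, of l] unfolding o_def by blast
  then show "convergent X" by (rule convergentI)
qed

section \<open>Test functions and their density\<close>

lemma test_function_deriv:
  assumes "test_function \<phi>"
  shows "(\<phi> has_real_derivative deriv \<phi> x) (at x)" "continuous_on UNIV (deriv \<phi>)"
proof -
  obtain D where D: "\<And>x. (\<phi> has_vector_derivative D x) (at x)" "continuous_on UNIV D"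
    using assms unfolding test_function_def C1_differentiable_on_def by auto
  then have "(\<phi> has_real_derivative D x) (at x)" for x
    by (simp add: has_real_derivative_iff_has_vector_derivative)
  moreover from this have "deriv \<phi> = D" by (auto intro: DERIV_imp_deriv)
  ultimately show "(\<phi> has_real_derivative deriv \<phi> x) (at x)" "continuous_on UNIV (deriv \<phi>)"
    using D by auto
qed

lemma test_function_continuous: "test_function \<phi> \<Longrightarrow> continuous_on UNIV \<phi>"
  using test_function_deriv(1) by (meson DERIV_isCont continuous_at_imp_continuous_on)

lemma test_functionI:
  assumes "\<And>x. (\<phi> has_real_derivative D x) (at x)" "continuous_on UNIV D"
    and "\<And>x. x \<notin> {a..b} \<Longrightarrow> \<phi> x = 0"
  shows "test_function \<phi>" "deriv \<phi> = D"
proof -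
  have "closure {x. \<phi> x \<noteq> 0} \<subseteq> {a..b}"
    using assms(3) by (intro closure_minimal) (blast, simp)
  then have "compact (closure {x. \<phi> x \<noteq> 0})"
    by (meson bounded_closed_interval bounded_subset closed_closure compact_eq_bounded_closed)
  moreover have "\<phi> C1_differentiable_on UNIV"
    using assms(1,2) unfolding C1_differentiable_on_def
    by (auto simp: has_real_derivative_iff_has_vector_derivative)
  ultimately show "test_function \<phi>" by (simp add: test_function_def)
  show "deriv \<phi> = D" using assms(1) by (auto intro: DERIV_imp_deriv)
qed

lemma deriv_eq_0_of_zero_outside:
  fixes \<phi> :: "real \<Rightarrow> real"
  assumes "\<And>x. x \<notin> {a..b} \<Longrightarrow> \<phi> x = 0" "x \<notin> {a..b}"
  shows "deriv \<phi> x = 0"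
proof -
  have "(\<phi> has_real_derivative 0) (at x)"
    by (rule has_field_derivative_transform_within_open[of "\<lambda>x. 0" _ _ "- {a..b}"])
      (use assms in \<open>auto simp: open_Compl\<close>)
  then show ?thesis by (rule DERIV_imp_deriv)
qed

lemma test_function_support:
  assumes "test_function \<phi>"
  shows "\<exists>R>0. \<forall>x. x \<notin> {-R..R} \<longrightarrow> \<phi> x = 0"
proof -
  have "bounded (closure {x. \<phi> x \<noteq> 0})"
    using assms by (simp add: test_function_def compact_imp_bounded)
  then obtain R where "R > 0" and R: "\<And>x. x \<in> closure {x. \<phi> x \<noteq> 0} \<Longrightarrow> norm x \<le> R"
    by (meson bounded_pos)
  have "\<phi> x = 0" if "x \<notin> {-R..R}" for x
  proof (rule ccontr)
    assume "\<phi> x \<noteq> 0"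
    then have "x \<in> closure {x. \<phi> x \<noteq> 0}" by (intro subsetD[OF closure_subset]) simp
    from R[OF this] have "\<bar>x\<bar> \<le> R" by simp
    with that show False by auto
  qed
  then show ?thesis using \<open>R > 0\<close> by blast
qed

lemma continuous_zero_outside_bounded:
  fixes f :: "real \<Rightarrow> real"
  assumes "continuous_on UNIV f" "\<And>x. x \<notin> {a..b} \<Longrightarrow> f x = 0"
  shows "\<exists>B\<ge>0. \<forall>x. \<bar>f x\<bar> \<le> B"
proof -
  have "bounded (f ` {a..b})"
    by (intro compact_imp_bounded compact_continuous_image continuous_on_subset[OF assms(1)]) auto
  then obtain B where "B > 0" "\<And>x. x \<in> {a..b} \<Longrightarrow> norm (f x) \<le> B"
    unfolding bounded_pos by auto
  then show ?thesis using assms(2) by (metis abs_0 less_imp_le real_norm_def)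
qed

lemma square_integrable_bounded_zero_outside:
  assumes [measurable]: "f \<in> borel_measurable lborel"
    and "\<And>x. x \<notin> {a..b} \<Longrightarrow> f x = 0" "\<And>x. \<bar>f x\<bar> \<le> B"
  shows "square_integrable f"
  unfolding square_integrable_def
proof
  show "integrable lborel (\<lambda>x. (f x)\<^sup>2)"
  proof (rule Bochner_Integration.integrable_bound)
    show "integrable lborel (\<lambda>x. B\<^sup>2 * indicator {a..b} x)"
      by (intro integrable_mult_right integrable_real_indicator) (simp_all add: emeasure_lborel_Icc_eq)
    show "AE x in lborel. norm ((f x)\<^sup>2) \<le> norm (B\<^sup>2 * indicator {a..b} x)"
    proof (intro always_eventually allI)
      fix x
      have "(f x)\<^sup>2 \<le> B\<^sup>2" using power_mono[OF assms(3)[of x], of 2] by simp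
      then show "norm ((f x)\<^sup>2) \<le> norm (B\<^sup>2 * indicator {a..b} x)"
        using assms(2)[of x] by (cases "x \<in> {a..b}") auto
    qed
  qed measurable
qed fact

lemma square_integrable_continuous_zero_outside:
  assumes "continuous_on UNIV f" "\<And>x. x \<notin> {a..b} \<Longrightarrow> f x = 0"
  shows "square_integrable f"
proof -
  obtain B where "\<And>x. \<bar>f x\<bar> \<le> B" using continuous_zero_outside_bounded[OF assms] by blast
  then show ?thesis
    using assms by (intro square_integrable_bounded_zero_outside[of f a b B])
      (simp_all add: borel_measurable_continuous_onI)
qed

lemma test_function_regularity:
  assumes "test_function \<phi>"
  shows "square_integrable \<phi>" "square_integrable (deriv \<phi>)"
    "\<exists>B\<ge>0. \<forall>x. \<bar>\<phi> x\<bar> \<le> B" "\<exists>B\<ge>0. \<forall>x. \<bar>deriv \<phi> x\<bar> \<le> B"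
    "\<phi> \<in> borel_measurable borel" "deriv \<phi> \<in> borel_measurable borel"
proof -
  obtain R where R: "\<And>x. x \<notin> {-R..R} \<Longrightarrow> \<phi> x = 0"
    using test_function_support[OF assms] by blast
  note c = test_function_continuous[OF assms] test_function_deriv(2)[OF assms]
  note z = deriv_eq_0_of_zero_outside[OF R]
  show "square_integrable \<phi>" by (rule square_integrable_continuous_zero_outside[OF c(1) R])
  show "square_integrable (deriv \<phi>)" by (rule square_integrable_continuous_zero_outside[OF c(2) z])
  show "\<exists>B\<ge>0. \<forall>x. \<bar>\<phi> x\<bar> \<le> B" by (rule continuous_zero_outside_bounded[OF c(1) R])
  show "\<exists>B\<ge>0. \<forall>x. \<bar>deriv \<phi> x\<bar> \<le> B" by (rule continuous_zero_outside_bounded[OF c(2) z])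
  show "\<phi> \<in> borel_measurable borel" "deriv \<phi> \<in> borel_measurable borel"
    using c by (auto intro: borel_measurable_continuous_onI)
qed

lemma L2_dominated_convergence:
  assumes s: "\<And>n. square_integrable (s n)" and f: "square_integrable f" and w: "square_integrable w"
    and lim: "AE x in lborel. (\<lambda>n. s n x) \<longlonglongrightarrow> f x"
    and bound: "\<And>n. AE x in lborel. \<bar>s n x - f x\<bar> \<le> w x"
  shows "(\<lambda>n. abs_L2 (s n)) \<longlonglongrightarrow> abs_L2 f"
proof -
  have [measurable]: "s n \<in> borel_measurable lborel" "f \<in> borel_measurable lborel" for n
    by (intro square_integrable_measurable s f)+
  have "(\<lambda>n. \<integral>x. (s n x - f x)\<^sup>2 \<partial>lborel) \<longlonglongrightarrow> (\<integral>x. 0 \<partial>(lborel :: real measure))"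
  proof (rule integral_dominated_convergence)
    show "integrable lborel (\<lambda>x. (w x)\<^sup>2)" by (rule square_integrable_integrable[OF w])
    show "AE x in lborel. (\<lambda>n. (s n x - f x)\<^sup>2) \<longlonglongrightarrow> 0"
      using lim
    proof eventually_elim
      case (elim x)
      show ?case using tendsto_power[OF LIM_zero[OF elim], of 2] by simp
    qed
    show "AE x in lborel. norm ((s n x - f x)\<^sup>2) \<le> (w x)\<^sup>2" for n
      using bound[of n]
    proof eventually_elim
      case (elim x)
      then have "\<bar>s n x - f x\<bar> \<le> \<bar>w x\<bar>" by simp
      then show ?case by (simp add: abs_le_square_iff)
    qed
  qed measurable
  then have "(\<lambda>n. (norm (abs_L2 (s n) - abs_L2 f))\<^sup>2) \<longlonglongrightarrow> 0"
    using norm_abs_L2[OF square_integrable_diff[OF s f]] by (simp add: abs_L2_diff[OF s f])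
  from tendsto_real_sqrt[OF this] have "(\<lambda>n. abs_L2 (s n) - abs_L2 f) \<longlonglongrightarrow> 0"
    by (simp add: tendsto_norm_zero_iff)
  then show ?thesis by (rule LIM_zero_cancel)
qed

text \<open>A measurable function is almost everywhere a limit of continuous functions, each of which is
  uniformly close to a polynomial on a large interval. Polynomials are preferred to continuous
  functions because they are continuously differentiable, as test functions have to be.\<close>

lemma borel_measurable_polynomial_approximation:
  fixes f :: "real \<Rightarrow> real"
  assumes [measurable]: "f \<in> borel_measurable borel"
  obtains p where "\<And>n. real_polynomial_function (p n)" "AE x in lborel. (\<lambda>n. p n x) \<longlonglongrightarrow> f x"
proof -
  have "f \<in> borel_measurable lebesgue" by (simp add: measurable_completion)
  then have "f measurable_on UNIV" by (intro lebesgue_measurable_imp_measurable_on_real) auto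
  then obtain N g where N: "negligible N" and g: "\<And>n. continuous_on UNIV (g n)"
    and lim: "\<And>x. x \<notin> N \<Longrightarrow> (\<lambda>n. g n x) \<longlonglongrightarrow> f x"
    unfolding measurable_on_def by auto
  have "\<exists>p. real_polynomial_function p \<and> (\<forall>x\<in>{- real n..real n}. \<bar>g n x - p x\<bar> < inverse (real (Suc n)))" for n
    using Stone_Weierstrass_real_polynomial_function[of "{- real n..real n}" "g n" "inverse (real (Suc n))"]
      continuous_on_subset[OF g] by (metis compact_Icc inverse_positive_iff_positive of_nat_0_less_iff subset_UNIV zero_less_Suc)
  then obtain p where p: "\<And>n. real_polynomial_function (p n)"
    and pg: "\<And>n x. x \<in> {- real n..real n} \<Longrightarrow> \<bar>g n x - p n x\<bar> < inverse (real (Suc n))"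
    by metis
  have "(\<lambda>n. p n x) \<longlonglongrightarrow> f x" if "x \<notin> N" for x
  proof -
    obtain k where k: "\<bar>x\<bar> \<le> real k" using real_arch_simple by blast
    have "(\<lambda>n. g n x - p n x) \<longlonglongrightarrow> 0"
    proof (rule Lim_null_comparison[OF _ LIMSEQ_inverse_real_of_nat])
      show "\<forall>\<^sub>F n in sequentially. norm (g n x - p n x) \<le> inverse (real (Suc n))"
        using eventually_ge_at_top[of k]
      proof eventually_elim
        case (elim n)
        then have "x \<in> {- real n..real n}" using k by auto
        from pg[OF this] show ?case by simp
      qed
    qed
    from tendsto_diff[OF lim[OF that] this] show ?thesis by simp
  qed
  moreover have "AE x in lborel. x \<notin> N"
  proof -
    have "AE x in lebesgue. x \<notin> N"
      using N by (intro AE_not_in) (simp add: negligible_iff_null_sets)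
    then show ?thesis by (simp add: AE_completion_iff)
  qed
  ultimately have "AE x in lborel. (\<lambda>n. p n x) \<longlonglongrightarrow> f x" by (auto elim: eventually_mono)
  with p show ?thesis by (rule that)
qed

lemma has_real_derivative_pos_part_squared:
  "((\<lambda>t::real. (max 0 t)\<^sup>2) has_real_derivative 2 * max 0 x) (at x)"
proof (cases x "0::real" rule: linorder_cases)
  case less
  show ?thesis
    by (rule has_field_derivative_transform_within_open[of "\<lambda>t. 0" _ _ "{..<0}"])
      (use less in \<open>auto simp: max_def\<close>)
next
  case equal
  have "(\<lambda>h::real. (max 0 h)\<^sup>2 / h) \<midarrow>0\<rightarrow> 0"
    by (rule Lim_null_comparison[of _ "\<lambda>h. \<bar>h\<bar>"])
      (auto simp: max_def power2_eq_square tendsto_rabs_zero_iff intro!: always_eventually)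
  then show ?thesis by (simp add: equal DERIV_def)
next
  case greater
  show ?thesis
    by (rule has_field_derivative_transform_within_open[of "\<lambda>t. t\<^sup>2" _ _ "{0<..}"])
      (use greater in \<open>auto simp: max_def intro!: derivative_eq_intros\<close>)
qed

lemma has_real_derivative_pos_part_squared_compose:
  assumes "(g has_real_derivative D) (at x)"
  shows "((\<lambda>t. (max 0 (g t))\<^sup>2) has_real_derivative 2 * max 0 (g x) * D) (at x)"
  by (rule DERIV_chain2[OF has_real_derivative_pos_part_squared assms])

text \<open>The two factors turn a polynomial into a test function: \<open>t \<mapsto> t / (1 + t\<^sup>2 / (N + 1))\<close> is a smooth
  bounded truncation that tends to the identity as \<open>N\<close> grows, and the second factor is a \<open>C\<^sup>1\<close> cutoff
  that increases to the indicator of the open interval.\<close>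

lemma test_function_approximation_step:
  fixes p :: "real \<Rightarrow> real"
  assumes p: "real_polynomial_function p" and "a < b" and N: "N \<ge> (0::real)"
  shows "test_function (\<lambda>x. p x / (1 + (p x)\<^sup>2 / (N + 1)) *
      (N * (max 0 ((x - a) * (b - x)))\<^sup>2 / (1 + N * (max 0 ((x - a) * (b - x)))\<^sup>2)))"
    (is "test_function ?\<phi>")
proof -
  obtain p' where p': "real_polynomial_function p'" "\<And>x. (p has_real_derivative p' x) (at x)"
    using has_real_derivative_polynomial_function[OF p] by blast
  have [continuous_intros]: "continuous_on S p" "continuous_on S p'" for S
    using p p'(1) by (auto intro: continuous_on_polymonial_function simp: real_polynomial_function_eq)
  have n1: "1 + (p x)\<^sup>2 / (N + 1) \<noteq> 0" for x
    using N by (intro add_pos_nonneg[THEN less_imp_neq[THEN not_sym]]) auto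
  have n2: "1 + N * (max 0 t)\<^sup>2 \<noteq> 0" for t
    using N by (intro add_pos_nonneg[THEN less_imp_neq[THEN not_sym]]) auto
  define s where "s x = (max 0 ((x - a) * (b - x)))\<^sup>2" for x
  define s' where "s' x = 2 * max 0 ((x - a) * (b - x)) * (a + b - 2 * x)" for x
  have s: "(s has_real_derivative s' x) (at x)" for x
    unfolding s_def s'_def
    by (rule has_real_derivative_pos_part_squared_compose[where g = "\<lambda>x. (x - a) * (b - x)"])
      (auto intro!: derivative_eq_intros)
  have [continuous_intros]: "continuous_on S s" "continuous_on S s'" for S
    unfolding s_def s'_def by (intro continuous_intros)+
  have n2': "1 + N * s x \<noteq> 0" for x using n2 by (simp add: s_def)
  have d1: "((\<lambda>x. 1 + (p x)\<^sup>2 / (N + 1)) has_real_derivative 2 * p x * p' x / (N + 1)) (at x)" for x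
    using N by (auto intro!: derivative_eq_intros p'(2))
  have d2: "((\<lambda>x. 1 + N * s x) has_real_derivative N * s' x) (at x)"
    "((\<lambda>x. N * s x) has_real_derivative N * s' x) (at x)" for x
    by (auto intro!: derivative_eq_intros s)
  define D where "D x =
      (p' x * (1 + (p x)\<^sup>2 / (N + 1)) - p x * (2 * p x * p' x / (N + 1)))
        / ((1 + (p x)\<^sup>2 / (N + 1)) * (1 + (p x)\<^sup>2 / (N + 1))) * (N * s x / (1 + N * s x))
      + (N * s' x * (1 + N * s x) - N * s x * (N * s' x)) / ((1 + N * s x) * (1 + N * s x))
        * (p x / (1 + (p x)\<^sup>2 / (N + 1)))" for x
  have "((\<lambda>x. p x / (1 + (p x)\<^sup>2 / (N + 1)) * (N * s x / (1 + N * s x))) has_real_derivative D x) (at x)" for x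
    unfolding D_def
    by (rule DERIV_mult[OF DERIV_divide[OF p'(2) d1 n1] DERIV_divide[OF d2(2,1) n2']])
  moreover have "continuous_on UNIV D"
    unfolding D_def using N n1 n2' by (intro continuous_intros ballI) auto
  moreover have "p x / (1 + (p x)\<^sup>2 / (N + 1)) * (N * s x / (1 + N * s x)) = 0" if "x \<notin> {a..b}" for x
  proof -
    have "(x - a) * (b - x) \<le> 0"
      using that \<open>a < b\<close> by (cases "x < a") (auto simp: mult_le_0_iff)
    then show ?thesis by (simp add: s_def)
  qed
  ultimately show ?thesis unfolding s_def by (rule test_functionI(1))
qed

text \<open>Two limits are taken one after the other. For fixed truncation level \<open>n\<close> the truncated
  polynomials converge to the truncated \<open>f\<close>, with a bound that depends on \<open>n\<close>; the truncated
  functions then converge to \<open>f\<close>, dominated by a multiple of \<open>\<bar>f\<bar>\<close>.\<close>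

lemma test_functions_dense_interval:
  assumes f: "square_integrable f" and f0: "\<And>x. x \<notin> {a<..<b} \<Longrightarrow> f x = 0" and "a < b" and "0 < e"
  obtains \<phi> where "test_function \<phi>" "\<And>x. x \<notin> {a<..<b} \<Longrightarrow> \<phi> x = 0" "norm (abs_L2 f - abs_L2 \<phi>) < e"
proof -
  have [measurable]: "f \<in> borel_measurable borel" using f by (simp add: square_integrable_def)
  obtain p where p: "\<And>k. real_polynomial_function (p k)" and lim: "AE x in lborel. (\<lambda>k. p k x) \<longlonglongrightarrow> f x"
    by (rule borel_measurable_polynomial_approximation[of f]) auto
  define \<beta> where "\<beta> n t = t / (1 + t\<^sup>2 / (real n + 1))" for n t
  define s where "s x = (max 0 ((x - a) * (b - x)))\<^sup>2" for x
  define \<eta> where "\<eta> n x = real n * s x / (1 + real n * s x)" for n x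
  define \<phi> where "\<phi> n k x = \<beta> n (p k x) * \<eta> n x" for n k x
  define F where "F n x = \<beta> n (f x) * \<eta> n x" for n x
  have spos: "s x > 0" if "x \<in> {a<..<b}" for x using that by (simp add: s_def)
  have s0: "s x = 0" if "x \<notin> {a<..<b}" for x
  proof -
    have "(x - a) * (b - x) \<le> 0"
      using that \<open>a < b\<close> by (cases "x \<le> a") (auto simp: mult_le_0_iff)
    then show ?thesis by (simp add: s_def)
  qed
  have s_nonneg: "s x \<ge> 0" for x by (simp add: s_def)
  have \<eta>01: "0 \<le> \<eta> n x" "\<eta> n x \<le> 1" for n x
    using s_nonneg[of x] by (auto simp: \<eta>_def divide_le_eq add_pos_nonneg)
  have \<beta>1: "\<bar>\<beta> n t\<bar> \<le> \<bar>t\<bar>" for n t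
  proof -
    have "1 \<le> 1 + t\<^sup>2 / (real n + 1)" by simp
    then have "\<bar>t\<bar> / \<bar>1 + t\<^sup>2 / (real n + 1)\<bar> \<le> \<bar>t\<bar> / 1" by (intro frac_le) auto
    then show ?thesis by (simp add: \<beta>_def)
  qed
  have \<beta>2: "\<bar>\<beta> n t\<bar> \<le> real n + 1" for n t
  proof -
    have "\<bar>t\<bar> \<le> 1 + t\<^sup>2"
      using sum_squares_bound[of 1 "\<bar>t\<bar>"] by simp
    moreover have "(real n + 1) * (1 + t\<^sup>2 / (real n + 1)) = real n + 1 + t\<^sup>2"
      by (simp add: distrib_left)
    ultimately have "\<bar>t\<bar> \<le> (real n + 1) * (1 + t\<^sup>2 / (real n + 1))" by simp
    moreover have "1 + t\<^sup>2 / (real n + 1) > 0" by (simp add: add_pos_nonneg)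
    ultimately show ?thesis unfolding \<beta>_def abs_divide by (subst divide_le_eq) auto
  qed
  have [measurable]: "s \<in> borel_measurable borel" "\<eta> n \<in> borel_measurable borel"
    "\<beta> n \<in> borel_measurable borel" for n
    unfolding \<eta>_def \<beta>_def s_def by measurable
  have test: "test_function (\<phi> n k)" for n k
    unfolding \<phi>_def \<beta>_def \<eta>_def s_def
    using test_function_approximation_step[OF p[of k] \<open>a < b\<close>, of "real n"] by simp
  have \<phi>0: "\<phi> n k x = 0" if "x \<notin> {a<..<b}" for n k x
    using s0[OF that] by (simp add: \<phi>_def \<eta>_def)
  have FB: "\<bar>F n x\<bar> \<le> (real n + 1) * indicator {a..b} x" and pB: "\<bar>\<phi> n k x\<bar> \<le> (real n + 1) * indicator {a..b} x" for n k x
  proof -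
    have "\<bar>\<beta> n t * \<eta> n x\<bar> \<le> (real n + 1) * indicator {a..b} x" for t
    proof (cases "x \<in> {a<..<b}")
      case True
      then show ?thesis using mult_mono[OF \<beta>2[of n t] \<eta>01(2)[of n x]] \<eta>01(1)[of n x] by (auto simp: abs_mult)
    next
      case False
      then show ?thesis using s0[of x] by (simp add: \<eta>_def)
    qed
    then show "\<bar>F n x\<bar> \<le> (real n + 1) * indicator {a..b} x" "\<bar>\<phi> n k x\<bar> \<le> (real n + 1) * indicator {a..b} x"
      unfolding F_def \<phi>_def by auto
  qed
  have Ff: "\<bar>F n x\<bar> \<le> \<bar>f x\<bar>" for n x
    using mult_mono[OF \<beta>1[of n "f x"] \<eta>01(2)[of n x]] \<eta>01(1)[of n x] by (simp add: F_def abs_mult)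
  have siF: "square_integrable (F n)" for n
  proof (rule square_integrable_bounded_zero_outside[of _ a b "real n + 1"])
    show "F n \<in> borel_measurable lborel" unfolding F_def by measurable
    show "F n x = 0" if "x \<notin> {a..b}" for x using FB[of n x] that by simp
    show "\<bar>F n x\<bar> \<le> real n + 1" for x
      by (rule order_trans[OF FB]) (cases "x \<in> {a..b}"; simp)
  qed
  have "(\<lambda>n. abs_L2 (F n)) \<longlonglongrightarrow> abs_L2 f"
  proof (rule L2_dominated_convergence[where w = "\<lambda>x. 2 * \<bar>f x\<bar>"])
    show "square_integrable (\<lambda>x. 2 * \<bar>f x\<bar>)"
      using f by (intro square_integrable_scale) (simp add: square_integrable_def)
    show "AE x in lborel. \<bar>F n x - f x\<bar> \<le> 2 * \<bar>f x\<bar>" for n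
    proof (intro always_eventually allI)
      show "\<bar>F n x - f x\<bar> \<le> 2 * \<bar>f x\<bar>" for x using Ff[of n x] by linarith
    qed
    show "AE x in lborel. (\<lambda>n. F n x) \<longlonglongrightarrow> f x"
    proof (intro always_eventually allI)
      fix x
      show "(\<lambda>n. F n x) \<longlonglongrightarrow> f x"
      proof (cases "x \<in> {a<..<b}")
        case True
        have "(\<lambda>n. (f x)\<^sup>2 * inverse (real (Suc n))) \<longlonglongrightarrow> (f x)\<^sup>2 * 0"
          by (intro tendsto_intros LIMSEQ_inverse_real_of_nat)
        then have "(\<lambda>n. \<beta> n (f x)) \<longlonglongrightarrow> f x / (1 + 0)"
          unfolding \<beta>_def by (intro tendsto_intros) (simp_all add: divide_inverse add.commute)
        moreover have "(\<lambda>n. \<eta> n x) \<longlonglongrightarrow> 1"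
        proof -
          have "(\<lambda>n. inverse (1 + s x * real n)) \<longlonglongrightarrow> 0"
            by (intro tendsto_inverse_0_at_top filterlim_tendsto_add_at_top[OF tendsto_const]
                filterlim_tendsto_pos_mult_at_top[OF tendsto_const spos[OF True]] filterlim_real_sequentially)
          from tendsto_diff[OF tendsto_const[of 1] this]
          have "(\<lambda>n. 1 - inverse (1 + s x * real n)) \<longlonglongrightarrow> 1" by simp
          moreover have "1 - inverse (1 + s x * real n) = \<eta> n x" for n
          proof -
            have "1 + s x * real n > 0" using s_nonneg[of x] by (simp add: add_pos_nonneg)
            then show ?thesis by (simp add: \<eta>_def field_simps)
          qed
          ultimately show ?thesis by simp
        qed
        ultimately have "(\<lambda>n. \<beta> n (f x) * \<eta> n x) \<longlonglongrightarrow> f x / (1 + 0) * 1" by (rule tendsto_mult)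
        then show ?thesis by (simp add: F_def)
      next
        case False
        then show ?thesis using s0[of x] f0[of x] by (simp add: F_def \<eta>_def)
      qed
    qed
  qed (use siF f in auto)
  then have "\<forall>\<^sub>F n in sequentially. dist (abs_L2 (F n)) (abs_L2 f) < e / 2"
    using \<open>0 < e\<close> by (intro tendstoD) auto
  then obtain n where n: "norm (abs_L2 (F n) - abs_L2 f) < e / 2"
    unfolding eventually_sequentially dist_norm by blast
  have "(\<lambda>k. abs_L2 (\<phi> n k)) \<longlonglongrightarrow> abs_L2 (F n)"
  proof (rule L2_dominated_convergence[where w = "\<lambda>x. 2 * ((real n + 1) * indicator {a..b} x)"])
    show "square_integrable (\<phi> n k)" for k using test by (rule test_function_regularity)
    show "square_integrable (\<lambda>x. 2 * ((real n + 1) * indicator {a..b} x))"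
      by (rule square_integrable_bounded_zero_outside[of _ a b "2 * (real n + 1)"])
        (auto split: split_indicator)
    show "AE x in lborel. \<bar>\<phi> n k x - F n x\<bar> \<le> 2 * ((real n + 1) * indicator {a..b} x)" for k
    proof (intro always_eventually allI)
      fix x
      show "\<bar>\<phi> n k x - F n x\<bar> \<le> 2 * ((real n + 1) * indicator {a..b} x)"
        using FB[of n x] pB[of n k x] by linarith
    qed
    show "AE x in lborel. (\<lambda>k. \<phi> n k x) \<longlonglongrightarrow> F n x"
      using lim
    proof eventually_elim
      case (elim x)
      have "1 + (f x)\<^sup>2 / (real n + 1) \<noteq> 0"
        by (intro add_pos_nonneg[THEN less_imp_neq[THEN not_sym]]) auto
      then show ?case unfolding \<phi>_def F_def \<beta>_def
        by (intro tendsto_intros elim) auto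
    qed
  qed (rule siF)
  then have "\<forall>\<^sub>F k in sequentially. dist (abs_L2 (\<phi> n k)) (abs_L2 (F n)) < e / 2"
    using \<open>0 < e\<close> by (intro tendstoD) auto
  then obtain k where k: "norm (abs_L2 (\<phi> n k) - abs_L2 (F n)) < e / 2"
    unfolding eventually_sequentially dist_norm by blast
  have "norm (abs_L2 f - abs_L2 (\<phi> n k)) < e"
    using norm_triangle_ineq[of "abs_L2 (\<phi> n k) - abs_L2 (F n)" "abs_L2 (F n) - abs_L2 f"] n k
    by (simp add: norm_minus_commute)
  with test[of n k] \<phi>0[of _ n k] show ?thesis by (rule that)
qed

lemma test_functions_dense:
  assumes "0 < e"
  obtains \<phi> where "test_function \<phi>" "norm (u - abs_L2 \<phi>) < e"
proof -
  define f where "f n x = indicator {-real (Suc n)<..<real (Suc n)} x * rep_L2 u x" for n x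
  have si: "square_integrable (f n)" for n
    unfolding f_def
    by (rule square_integrable_bounded_mult[OF _ _ rep_L2_square_integrable, where B = 1])
      (auto simp: indicator_def)
  have "(\<lambda>n. abs_L2 (f n)) \<longlonglongrightarrow> abs_L2 (rep_L2 u)"
  proof (rule L2_dominated_convergence[where w = "\<lambda>x. \<bar>rep_L2 u x\<bar>"])
    show "square_integrable (\<lambda>x. \<bar>rep_L2 u x\<bar>)"
      using rep_L2_square_integrable[of u] by (simp add: square_integrable_def)
    show "AE x in lborel. \<bar>f n x - rep_L2 u x\<bar> \<le> \<bar>rep_L2 u x\<bar>" for n
      by (auto simp: f_def indicator_def)
    show "AE x in lborel. (\<lambda>n. f n x) \<longlonglongrightarrow> rep_L2 u x"
    proof (intro always_eventually allI)
      fix x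
      obtain k where "\<bar>x\<bar> < real k" using reals_Archimedean2 by blast
      have "f n x = rep_L2 u x" if "k \<le> n" for n
      proof -
        have "x \<in> {-real (Suc n)<..<real (Suc n)}" using \<open>\<bar>x\<bar> < real k\<close> that by auto
        then show ?thesis by (simp add: f_def)
      qed
      then have "\<forall>\<^sub>F n in sequentially. f n x = rep_L2 u x"
        unfolding eventually_sequentially by blast
      then show "(\<lambda>n. f n x) \<longlonglongrightarrow> rep_L2 u x" by (rule tendsto_eventually)
    qed
  qed (rule si rep_L2_square_integrable)+
  then have "\<forall>\<^sub>F n in sequentially. dist (abs_L2 (f n)) u < e / 2"
    using assms by (intro tendstoD) auto
  then obtain n where n: "norm (abs_L2 (f n) - u) < e / 2"
    unfolding eventually_sequentially dist_norm by blast
  have "\<exists>\<phi>. test_function \<phi> \<and> norm (abs_L2 (f n) - abs_L2 \<phi>) < e / 2"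
    by (rule test_functions_dense_interval[OF si, of "-real (Suc n)" "real (Suc n)" n "e / 2"])
      (use assms in \<open>auto simp: f_def\<close>)
  then obtain \<phi> where \<phi>: "test_function \<phi>" "norm (abs_L2 (f n) - abs_L2 \<phi>) < e / 2" by blast
  have "norm (u - abs_L2 \<phi>) < e"
    using norm_triangle_ineq[of "u - abs_L2 (f n)" "abs_L2 (f n) - abs_L2 \<phi>"] n \<phi>(2)
    by (simp add: norm_minus_commute)
  with \<phi>(1) show ?thesis by (rule that)
qed

section \<open>Multiplication operators\<close>

text \<open>The multiplier may be unbounded, like the square root of a potential; the value is then
  meaningful on those \<open>u\<close> for which the product is square integrable.\<close>

definition mult_L2 :: "(real \<Rightarrow> real) \<Rightarrow> L2 \<Rightarrow> L2" where
  "mult_L2 b u = abs_L2 (\<lambda>x. b x * rep_L2 u x)"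

lemma rep_mult_L2:
  assumes "square_integrable (\<lambda>x. b x * rep_L2 u x)"
  shows "AE x in lborel. rep_L2 (mult_L2 b u) x = b x * rep_L2 u x"
  unfolding mult_L2_def by (rule rep_abs_L2[OF assms])

lemma inner_abs_L2_right:
  assumes "square_integrable f"
  shows "inner u (abs_L2 f) = (\<integral>x. rep_L2 u x * f x \<partial>lborel)"
  using inner_abs_L2[OF rep_L2_square_integrable assms, of u] by simp

lemma inner_mult_L2:
  assumes "square_integrable (\<lambda>x. b x * rep_L2 u x)"
  shows "inner v (mult_L2 b u) = (\<integral>x. rep_L2 v x * (b x * rep_L2 u x) \<partial>lborel)"
  unfolding mult_L2_def by (rule inner_abs_L2_right[OF assms])

lemma norm_mult_L2:
  assumes "square_integrable (\<lambda>x. b x * rep_L2 u x)"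
  shows "(norm (mult_L2 b u))\<^sup>2 = (\<integral>x. (b x * rep_L2 u x)\<^sup>2 \<partial>lborel)"
  unfolding mult_L2_def by (rule norm_abs_L2[OF assms])

lemma square_integrable_bounded_mult_rep:
  assumes "b \<in> borel_measurable borel" "\<And>x. \<bar>b x\<bar> \<le> B"
  shows "square_integrable (\<lambda>x. b x * rep_L2 u x)"
  using assms by (intro square_integrable_bounded_mult rep_L2_square_integrable) auto

lemma mult_L2_add:
  assumes "square_integrable (\<lambda>x. b x * rep_L2 u x)" "square_integrable (\<lambda>x. b x * rep_L2 v x)"
    and [measurable]: "b \<in> borel_measurable borel"
  shows "square_integrable (\<lambda>x. b x * rep_L2 (u + v) x)" "mult_L2 b (u + v) = mult_L2 b u + mult_L2 b v"
proof -
  have ae: "AE x in lborel. b x * rep_L2 (u + v) x = b x * rep_L2 u x + b x * rep_L2 v x"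
    using rep_L2_add[of u v] by eventually_elim (simp add: distrib_left)
  have s: "square_integrable (\<lambda>x. b x * rep_L2 u x + b x * rep_L2 v x)"
    by (rule square_integrable_add[OF assms(1,2)])
  show s': "square_integrable (\<lambda>x. b x * rep_L2 (u + v) x)"
    by (rule square_integrable_cong_AE[OF _ s]) (measurable, use ae in \<open>eventually_elim, simp only:\<close>)
  show "mult_L2 b (u + v) = mult_L2 b u + mult_L2 b v"
    unfolding mult_L2_def
    using abs_L2_cong[OF s' s ae] plus_L2.abs_eq[of "\<lambda>x. b x * rep_L2 u x" "\<lambda>x. b x * rep_L2 v x"] assms by simp
qed

lemma mult_L2_scaleR:
  assumes "square_integrable (\<lambda>x. b x * rep_L2 u x)"
    and [measurable]: "b \<in> borel_measurable borel"
  shows "square_integrable (\<lambda>x. b x * rep_L2 (c *\<^sub>R u) x)" "mult_L2 b (c *\<^sub>R u) = c *\<^sub>R mult_L2 b u"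
proof -
  have ae: "AE x in lborel. b x * rep_L2 (c *\<^sub>R u) x = c * (b x * rep_L2 u x)"
    using rep_L2_scaleR[of c u] by eventually_elim simp
  have s: "square_integrable (\<lambda>x. c * (b x * rep_L2 u x))"
    by (rule square_integrable_scale[OF assms(1)])
  show s': "square_integrable (\<lambda>x. b x * rep_L2 (c *\<^sub>R u) x)"
    by (rule square_integrable_cong_AE[OF _ s]) (measurable, use ae in \<open>eventually_elim, simp only:\<close>)
  show "mult_L2 b (c *\<^sub>R u) = c *\<^sub>R mult_L2 b u"
    unfolding mult_L2_def
    using abs_L2_cong[OF s' s ae] scaleR_L2.abs_eq[of "\<lambda>x. b x * rep_L2 u x" c] assms by simp
qed

text \<open>Along a common subsequence both \<open>X n\<close> and \<open>b \<cdot> X n\<close> converge almost everywhere, so the limit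
  of the products is the product of the limits. This is closedness of a possibly unbounded
  multiplication operator.\<close>

lemma mult_L2_closed:
  fixes X :: "nat \<Rightarrow> L2"
  assumes [measurable]: "b \<in> borel_measurable borel"
    and s: "\<And>n. square_integrable (\<lambda>x. b x * rep_L2 (X n) x)"
    and X: "X \<longlonglongrightarrow> u" and Y: "(\<lambda>n. mult_L2 b (X n)) \<longlonglongrightarrow> y"
  shows "square_integrable (\<lambda>x. b x * rep_L2 u x)" "mult_L2 b u = y"
proof -
  obtain r where r: "strict_mono (r :: nat \<Rightarrow> nat)" and rX: "AE x in lborel. (\<lambda>n. rep_L2 (X (r n)) x) \<longlonglongrightarrow> rep_L2 u x"
    using L2_convergent_AE_subseq[OF X] by blast
  have "(\<lambda>n. mult_L2 b (X (r n))) \<longlonglongrightarrow> y"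
    using LIMSEQ_subseq_LIMSEQ[OF Y r] by (simp add: o_def)
  then obtain r' where r': "strict_mono (r' :: nat \<Rightarrow> nat)"
    and rY: "AE x in lborel. (\<lambda>n. rep_L2 (mult_L2 b (X (r (r' n)))) x) \<longlonglongrightarrow> rep_L2 y x"
    using L2_convergent_AE_subseq[of "\<lambda>n. mult_L2 b (X (r n))"] by blast
  have "AE x in lborel. \<forall>n. rep_L2 (mult_L2 b (X n)) x = b x * rep_L2 (X n) x"
    by (simp add: AE_all_countable rep_mult_L2 s)
  with rX rY have ae: "AE x in lborel. rep_L2 y x = b x * rep_L2 u x"
  proof eventually_elim
    case (elim x)
    have "(\<lambda>n. rep_L2 (X (r (r' n))) x) \<longlonglongrightarrow> rep_L2 u x"
      using LIMSEQ_subseq_LIMSEQ[OF elim(1) r'] by (simp add: o_def)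
    then have "(\<lambda>n. b x * rep_L2 (X (r (r' n))) x) \<longlonglongrightarrow> b x * rep_L2 u x" by (rule tendsto_mult_left)
    with elim(2,3) show ?case by (simp add: LIMSEQ_unique)
  qed
  show s': "square_integrable (\<lambda>x. b x * rep_L2 u x)"
    by (rule square_integrable_cong_AE[OF _ rep_L2_square_integrable[of y] ae]) measurable
  show "mult_L2 b u = y"
    unfolding mult_L2_def using abs_L2_cong[OF rep_L2_square_integrable s' ae] by simp
qed

section \<open>Weak derivatives\<close>

text \<open>In this form a weak derivative is determined by continuous linear conditions on the pair
  \<open>(u, g)\<close>, which makes linearity and closedness immediate.\<close>

lemma has_weak_deriv_iff_inner:
  "has_weak_deriv u g \<longleftrightarrow>
     (\<forall>\<phi>. test_function \<phi> \<longrightarrow> inner u (abs_L2 (deriv \<phi>)) = - inner g (abs_L2 \<phi>))"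
  by (simp add: has_weak_deriv_def inner_abs_L2_right test_function_regularity)

lemma has_weak_deriv_unique:
  assumes "has_weak_deriv u g" "has_weak_deriv u g'"
  shows "g = g'"
proof (rule ccontr)
  define d where "d = g - g'"
  assume "g \<noteq> g'"
  then have "norm d > 0" by (simp add: d_def)
  then obtain \<phi> where \<phi>: "test_function \<phi>" "norm (d - abs_L2 \<phi>) < norm d"
    by (rule test_functions_dense)
  have "inner d (abs_L2 \<phi>) = 0"
    using assms \<phi>(1) by (simp add: has_weak_deriv_iff_inner d_def inner_diff_left)
  then have "(norm d)\<^sup>2 = inner d (d - abs_L2 \<phi>)"
    by (simp add: inner_diff_right power2_norm_eq_inner)
  also have "\<dots> \<le> norm d * norm (d - abs_L2 \<phi>)" by (rule norm_cauchy_schwarz)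
  also have "\<dots> < norm d * norm d" using \<phi>(2) \<open>norm d > 0\<close> by simp
  finally show False by (simp add: power2_eq_square)
qed

lemma weak_deriv_eqI: "has_weak_deriv u g \<Longrightarrow> weak_deriv u = g"
  unfolding weak_deriv_def using has_weak_deriv_unique by blast

lemma H1_iff: "u \<in> H1 \<longleftrightarrow> has_weak_deriv u (weak_deriv u)"
  unfolding H1_def using weak_deriv_eqI by auto

lemma has_weak_deriv_add:
  "has_weak_deriv u g \<Longrightarrow> has_weak_deriv v k \<Longrightarrow> has_weak_deriv (u + v) (g + k)"
  by (simp add: has_weak_deriv_iff_inner inner_add_left)

lemma has_weak_deriv_scaleR:
  "has_weak_deriv u g \<Longrightarrow> has_weak_deriv (c *\<^sub>R u) (c *\<^sub>R g)"
  by (simp add: has_weak_deriv_iff_inner)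

lemma has_weak_deriv_closed:
  fixes u :: "nat \<Rightarrow> L2"
  assumes "\<And>n. has_weak_deriv (u n) (g n)" "u \<longlonglongrightarrow> u'" "g \<longlonglongrightarrow> g'"
  shows "has_weak_deriv u' g'"
  unfolding has_weak_deriv_iff_inner
proof (intro allI impI)
  fix \<phi> assume \<phi>: "test_function \<phi>"
  have "(\<lambda>n. inner (u n) (abs_L2 (deriv \<phi>))) \<longlonglongrightarrow> inner u' (abs_L2 (deriv \<phi>))"
    by (intro tendsto_intros assms)
  moreover have "(\<lambda>n. - inner (g n) (abs_L2 \<phi>)) \<longlonglongrightarrow> - inner g' (abs_L2 \<phi>)"
    by (intro tendsto_intros assms)
  moreover have "inner (u n) (abs_L2 (deriv \<phi>)) = - inner (g n) (abs_L2 \<phi>)" for n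
    using assms(1) \<phi> by (simp add: has_weak_deriv_iff_inner)
  ultimately show "inner u' (abs_L2 (deriv \<phi>)) = - inner g' (abs_L2 \<phi>)"
    by (simp add: LIMSEQ_unique)
qed

lemma test_function_mult:
  assumes "test_function \<psi>" "test_function \<phi>"
  shows "test_function (\<lambda>x. \<psi> x * \<phi> x)" "deriv (\<lambda>x. \<psi> x * \<phi> x) = (\<lambda>x. deriv \<psi> x * \<phi> x + \<psi> x * deriv \<phi> x)"
proof -
  obtain R where R: "\<And>x. x \<notin> {-R..R} \<Longrightarrow> \<psi> x = 0"
    using test_function_support[OF assms(1)] by blast
  have d: "((\<lambda>x. \<psi> x * \<phi> x) has_real_derivative deriv \<psi> x * \<phi> x + \<psi> x * deriv \<phi> x) (at x)" for x
    using DERIV_mult[OF test_function_deriv(1)[OF assms(1)] test_function_deriv(1)[OF assms(2)]]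
    by (simp add: mult.commute)
  have c: "continuous_on UNIV (\<lambda>x. deriv \<psi> x * \<phi> x + \<psi> x * deriv \<phi> x)"
    by (intro continuous_intros test_function_continuous test_function_deriv assms)
  show "test_function (\<lambda>x. \<psi> x * \<phi> x)" "deriv (\<lambda>x. \<psi> x * \<phi> x) = (\<lambda>x. deriv \<psi> x * \<phi> x + \<psi> x * deriv \<phi> x)"
    using test_functionI[OF d c, of "-R" R] R by auto
qed

text \<open>The product rule for test functions does the work: the weak derivative of \<open>u\<close> is tested
  against \<open>\<psi> \<phi>\<close>.\<close>

lemma has_weak_deriv_mult:
  assumes u: "has_weak_deriv u g" and \<psi>: "test_function \<psi>"
  shows "has_weak_deriv (mult_L2 \<psi> u) (mult_L2 (deriv \<psi>) u + mult_L2 \<psi> g)"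
  unfolding has_weak_deriv_iff_inner
proof (intro allI impI)
  fix \<phi> assume \<phi>: "test_function \<phi>"
  note m = test_function_regularity(5,6)
  obtain B B' where B: "\<And>x. \<bar>\<psi> x\<bar> \<le> B" "\<And>x. \<bar>deriv \<psi> x\<bar> \<le> B'"
    using test_function_regularity(3,4)[OF \<psi>] by blast
  have s: "square_integrable (\<lambda>x. \<psi> x * rep_L2 w x)" "square_integrable (\<lambda>x. deriv \<psi> x * rep_L2 w x)" for w
    by (rule square_integrable_bounded_mult_rep[OF m(1)[OF \<psi>] B(1)],
        rule square_integrable_bounded_mult_rep[OF m(2)[OF \<psi>] B(2)])
  have s': "square_integrable (\<lambda>x. \<psi> x * \<phi> x)" "square_integrable (\<lambda>x. deriv \<psi> x * \<phi> x)" "square_integrable (\<lambda>x. \<psi> x * deriv \<phi> x)"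
    using square_integrable_bounded_mult[OF _ B(1) test_function_regularity(1)[OF \<phi>]]
      square_integrable_bounded_mult[OF _ B(2) test_function_regularity(1)[OF \<phi>]]
      square_integrable_bounded_mult[OF _ B(1) test_function_regularity(2)[OF \<phi>]] m[OF \<psi>]
    by simp_all
  have swap: "inner (mult_L2 b w) (abs_L2 f) = inner w (abs_L2 (\<lambda>x. b x * f x))"
    if "square_integrable (\<lambda>x. b x * rep_L2 w x)" "square_integrable f" "square_integrable (\<lambda>x. b x * f x)" for b w f
    unfolding mult_L2_def inner_abs_L2[OF that(1,2)] inner_abs_L2_right[OF that(3)]
    by (simp add: mult_ac)
  have add: "inner u (abs_L2 f) + inner u (abs_L2 k) = inner u (abs_L2 (\<lambda>x. f x + k x))"
    if "square_integrable f" "square_integrable k" for f k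
    using that plus_L2.abs_eq[of f k] by (simp add: inner_add_right[symmetric])
  have "inner (mult_L2 \<psi> u) (abs_L2 (deriv \<phi>)) + inner (mult_L2 (deriv \<psi>) u) (abs_L2 \<phi>)
      = inner u (abs_L2 (deriv (\<lambda>x. \<psi> x * \<phi> x)))"
    unfolding test_function_mult(2)[OF \<psi> \<phi>]
    using test_function_regularity(1,2)[OF \<phi>] s s' by (simp add: swap add add.commute)
  also have "\<dots> = - inner g (abs_L2 (\<lambda>x. \<psi> x * \<phi> x))"
    using u test_function_mult(1)[OF \<psi> \<phi>] by (simp add: has_weak_deriv_iff_inner)
  also have "\<dots> = - inner (mult_L2 \<psi> g) (abs_L2 \<phi>)"
    using test_function_regularity(1)[OF \<phi>] s s' by (simp add: swap)
  finally show "inner (mult_L2 \<psi> u) (abs_L2 (deriv \<phi>)) = - inner (mult_L2 (deriv \<psi>) u + mult_L2 \<psi> g) (abs_L2 \<phi>)"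
    by (simp add: inner_add_left)
qed

section \<open>A Poincare inequality with an exterior term\<close>

lemma increment_le_sqrt_length:
  fixes P p :: "real \<Rightarrow> real"
  assumes P: "\<And>x. (P has_real_derivative p x) (at x)" and p: "continuous_on UNIV p"
    and si: "square_integrable p" and "a \<le> b"
  shows "(P b - P a)\<^sup>2 \<le> (b - a) * (norm (abs_L2 p))\<^sup>2"
proof -
  have "(\<integral>x. p x * indicator {a..b} x \<partial>lborel) = P b - P a"
    by (rule integral_FTC_Icc_real)
      (use assms continuous_on_eq_continuous_at[of UNIV p] in
        \<open>auto simp: isCont_def intro: DERIV_subset\<close>)
  moreover have ind: "square_integrable (indicat_real {a..b})"
    by (rule square_integrable_bounded_zero_outside[of _ a b 1]) auto
  moreover have "(\<integral>x. (indicat_real {a..b} x)\<^sup>2 \<partial>lborel) = b - a"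
  proof -
    have "(indicat_real {a..b} x)\<^sup>2 = indicat_real {a..b} x" for x by (simp add: indicator_def)
    then show ?thesis using \<open>a \<le> b\<close> by simp
  qed
  ultimately have "\<bar>P b - P a\<bar> \<le> sqrt (\<integral>x. (p x)\<^sup>2 \<partial>lborel) * sqrt (b - a)"
    using Cauchy_Schwarz_square_integrable[OF si ind] by simp
  then have "\<bar>P b - P a\<bar>\<^sup>2 \<le> (sqrt (\<integral>x. (p x)\<^sup>2 \<partial>lborel) * sqrt (b - a))\<^sup>2"
    by (intro power_mono) auto
  then show ?thesis
    using \<open>a \<le> b\<close> norm_abs_L2[OF si] by (simp add: power_mult_distrib mult.commute)
qed

text \<open>Let \<open>P\<close> be an antiderivative of \<open>p\<close>. Since \<open>p\<close> is supported in an interval of length \<open>2 r\<close>, the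
  function \<open>\<phi> x = P x - P (x - 2 r)\<close> has compact support, and its derivative is \<open>p\<close> minus the
  translate of \<open>p\<close> into the adjacent interval. Testing the weak derivative of \<open>u\<close> with \<open>\<phi>\<close> therefore
  replaces \<open>p\<close> by a translate that only sees \<open>u\<close> outside \<open>{-r<..<r}\<close>, at the price of \<open>\<langle>g, \<phi>\<rangle>\<close>,
  where \<open>\<phi>\<close> is small of order \<open>r\<close>.\<close>

lemma inner_test_function_le:
  assumes u: "has_weak_deriv u g" and "r > 0" and p: "test_function p" "\<And>x. x \<notin> {-r<..<r} \<Longrightarrow> p x = 0"
  shows "inner u (abs_L2 p) \<le> (norm (mult_L2 (indicator (-{-r<..<r})) u) + 3 * r * norm g) * norm (abs_L2 p)"
proof -
  note sip = test_function_regularity(1)[OF p(1)]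
  note pc = test_function_continuous[OF p(1)]
  have "\<exists>P. \<forall>x. (P has_real_derivative p x) (at x)"
    using einterval_antiderivative[of "-\<infinity>" \<infinity> p] pc continuous_on_eq_continuous_at[of UNIV p]
    by (auto simp: has_real_derivative_iff_has_vector_derivative)
  then obtain P where P: "\<And>x. (P has_real_derivative p x) (at x)" by blast
  note incr = increment_le_sqrt_length[OF P pc sip]
  define \<phi> where "\<phi> x = P x - P (x - 2 * r)" for x
  have d: "(\<phi> has_real_derivative p x - p (x - 2 * r)) (at x)" for x
    unfolding \<phi>_def using DERIV_shift[of P "p (x - 2 * r)" x "- (2 * r)"] P[of "x - 2 * r"]
    by (intro DERIV_diff P) simp
  have shift_c: "continuous_on UNIV (\<lambda>x. p (x - 2 * r))"
    by (rule continuous_on_compose2[OF pc]) (auto intro: continuous_intros)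
  have flat: "P x = P y" if "\<And>z. z \<in> {x..y} \<Longrightarrow> p z = 0" "x \<le> y" for x y
  proof (cases "x = y")
    case False
    then have "x < y" using that by simp
    have "P y = P x"
    proof (rule DERIV_isconst2[OF \<open>x < y\<close>])
      show "continuous_on {x..y} P" by (meson DERIV_isCont P continuous_at_imp_continuous_on)
      show "(P has_real_derivative 0) (at z)" if "x < z" "z < y" for z
        using P[of z] \<open>\<And>z. z \<in> {x..y} \<Longrightarrow> p z = 0\<close>[of z] that by simp
    qed (use that in auto)
    then show ?thesis ..
  qed simp
  have \<phi>0: "\<phi> x = 0" if "x \<notin> {-r..3 * r}" for x
  proof -
    have "P (x - 2 * r) = P x"
      using that \<open>r > 0\<close> by (intro flat p(2)) auto
    then show ?thesis by (simp add: \<phi>_def)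
  qed
  have t: "test_function \<phi>" "deriv \<phi> = (\<lambda>x. p x - p (x - 2 * r))"
    using test_functionI[OF d continuous_on_diff[OF pc shift_c] \<phi>0] by auto
  have shift_integral: "(\<integral>x. (p (x - 2 * r))\<^sup>2 \<partial>lborel) = (\<integral>x. (p x)\<^sup>2 \<partial>lborel)"
    using lborel_integral_real_affine[of 1 "\<lambda>x. (p x)\<^sup>2" "- 2 * r"] by (simp add: add.commute)
  have sis: "square_integrable (\<lambda>x. p (x - 2 * r))"
    by (rule square_integrable_continuous_zero_outside[of _ r "3 * r"]) (auto intro: shift_c p(2))
  have norm_shift: "norm (abs_L2 (\<lambda>x. p (x - 2 * r))) = norm (abs_L2 p)"
    using norm_abs_L2[OF sis] norm_abs_L2[OF sip] shift_integral
    by (metis norm_ge_zero power2_eq_iff_nonneg)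
  have norm_\<phi>: "norm (abs_L2 \<phi>) \<le> 3 * r * norm (abs_L2 p)"
  proof -
    have "(\<phi> x)\<^sup>2 \<le> 2 * r * (norm (abs_L2 p))\<^sup>2 * indicator {-r..3 * r} x" for x
      using incr[of "x - 2 * r" x] \<open>r > 0\<close> \<phi>0[of x] by (cases "x \<in> {-r..3 * r}") (auto simp: \<phi>_def)
    then have "(\<integral>x. (\<phi> x)\<^sup>2 \<partial>lborel) \<le> (\<integral>x. 2 * r * (norm (abs_L2 p))\<^sup>2 * indicator {-r..3 * r} x \<partial>lborel)"
      using test_function_regularity(1)[OF t(1)]
      by (intro integral_mono) (auto simp: square_integrable_def emeasure_lborel_Icc_eq intro!: integrable_mult_right integrable_real_indicator)
    also have "\<dots> = 8 * r\<^sup>2 * (norm (abs_L2 p))\<^sup>2" using \<open>r > 0\<close> by (simp add: power2_eq_square)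
    also have "\<dots> \<le> (3 * r * norm (abs_L2 p))\<^sup>2" by (simp add: power_mult_distrib mult_right_mono)
    finally have "(norm (abs_L2 \<phi>))\<^sup>2 \<le> (3 * r * norm (abs_L2 p))\<^sup>2"
      using norm_abs_L2[OF test_function_regularity(1)[OF t(1)]] by simp
    then show ?thesis by (rule power2_le_imp_le) (use \<open>r > 0\<close> in simp)
  qed
  have "inner u (abs_L2 p) - inner u (abs_L2 (\<lambda>x. p (x - 2 * r))) = - inner g (abs_L2 \<phi>)"
  proof -
    have "inner u (abs_L2 (deriv \<phi>)) = - inner g (abs_L2 \<phi>)"
      using u t(1) by (simp add: has_weak_deriv_iff_inner)
    then show ?thesis
      unfolding t(2) abs_L2_diff[OF sip sis, symmetric] by (simp add: inner_diff_right)
  qed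
  moreover have "inner u (abs_L2 (\<lambda>x. p (x - 2 * r))) = inner (mult_L2 (indicator (-{-r<..<r})) u) (abs_L2 (\<lambda>x. p (x - 2 * r)))"
  proof -
    have so: "square_integrable (\<lambda>x. indicator (-{-r<..<r}) x * rep_L2 u x)"
      by (rule square_integrable_bounded_mult_rep[where B = 1]) (auto simp: indicator_def)
    have "rep_L2 u x * p (x - 2 * r) = indicator (-{-r<..<r}) x * rep_L2 u x * p (x - 2 * r)" for x
      using p(2)[of "x - 2 * r"] by (cases "x \<in> {-r<..<r}") auto
    then show ?thesis
      unfolding mult_L2_def inner_abs_L2[OF so sis] using inner_abs_L2_right[OF sis, of u] by presburger
  qed
  moreover have "inner (mult_L2 (indicator (-{-r<..<r})) u) (abs_L2 (\<lambda>x. p (x - 2 * r)))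
      \<le> norm (mult_L2 (indicator (-{-r<..<r})) u) * norm (abs_L2 p)"
    using norm_cauchy_schwarz[of "mult_L2 (indicator (-{-r<..<r})) u" "abs_L2 (\<lambda>x. p (x - 2 * r))"] norm_shift by simp
  moreover have "- inner g (abs_L2 \<phi>) \<le> norm g * (3 * r * norm (abs_L2 p))"
    using norm_cauchy_schwarz[of g "- abs_L2 \<phi>"] mult_left_mono[OF norm_\<phi>, of "norm g"] by simp
  ultimately show ?thesis by (simp add: algebra_simps)
qed

text \<open>Test functions \<open>p\<close> that approximate the restriction of \<open>u\<close> to \<open>{-r<..<r}\<close> are inserted in the
  preceding inequality.\<close>

lemma norm_interior_le:
  assumes u: "has_weak_deriv u g" and "r > 0"
  shows "norm (mult_L2 (indicator {-r<..<r}) u) \<le> norm (mult_L2 (indicator (-{-r<..<r})) u) + 3 * r * norm g"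
    (is "norm ?w \<le> ?A")
proof -
  have A: "?A \<ge> 0" using \<open>r > 0\<close> by simp
  have si: "square_integrable (\<lambda>x. indicator {-r<..<r} x * rep_L2 u x)"
    by (rule square_integrable_bounded_mult_rep[where B = 1]) (auto simp: indicator_def)
  have "inner u ?w \<le> ?A * norm ?w + e" if "e > 0" for e
  proof -
    define d where "d = e / (norm u + ?A + 1)"
    have pos: "norm u + ?A + 1 > 0" using A by (simp add: add_nonneg_pos)
    then have "d > 0" using that by (simp add: d_def)
    have "\<exists>p. test_function p \<and> (\<forall>x. x \<notin> {-r<..<r} \<longrightarrow> p x = 0) \<and> norm (?w - abs_L2 p) < d"
      unfolding mult_L2_def
      by (rule test_functions_dense_interval[OF si, of "-r" r d]) (use \<open>r > 0\<close> \<open>d > 0\<close> in auto)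
    then obtain p where p: "test_function p" "\<And>x. x \<notin> {-r<..<r} \<Longrightarrow> p x = 0" "norm (?w - abs_L2 p) < d" by blast
    have "inner u ?w = inner u (abs_L2 p) + inner u (?w - abs_L2 p)" by (simp add: inner_diff_right)
    also have "\<dots> \<le> ?A * norm (abs_L2 p) + norm u * norm (?w - abs_L2 p)"
      by (intro add_mono inner_test_function_le[OF u \<open>r > 0\<close> p(1,2)] norm_cauchy_schwarz)
    also have "\<dots> \<le> ?A * (norm ?w + d) + norm u * d"
    proof (intro add_mono mult_left_mono)
      show "norm (abs_L2 p) \<le> norm ?w + d"
        using norm_triangle_ineq2[of "abs_L2 p" ?w] p(3) by (simp add: norm_minus_commute)
    qed (use A p(3) in auto)
    also have "\<dots> = ?A * norm ?w + d * (norm u + ?A)" by (simp add: algebra_simps)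
    also have "d * (norm u + ?A) \<le> d * (norm u + ?A + 1)" using \<open>d > 0\<close> by (intro mult_left_mono) auto
    also have "d * (norm u + ?A + 1) = e" using pos by (simp add: d_def)
    finally show ?thesis by simp
  qed
  then have "inner u ?w \<le> ?A * norm ?w" by (rule field_le_epsilon)
  moreover have "inner u ?w = (norm ?w)\<^sup>2"
    unfolding inner_mult_L2[OF si] norm_mult_L2[OF si]
    by (rule Bochner_Integration.integral_cong) (auto simp: power2_eq_square indicator_def)
  ultimately have "norm ?w * norm ?w \<le> ?A * norm ?w" by (simp add: power2_eq_square)
  then show ?thesis using A by (cases "norm ?w = 0") (auto simp: mult_le_cancel_right)
qed

section \<open>Operators generated by closed coercive forms\<close>

text \<open>The solution is the minimiser of \<open>J u = \<parallel>S u\<parallel>\<^sup>2 - 2 \<langle>f, u\<rangle>\<close>. By the parallelogram law a minimising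
  sequence has convergent images under \<open>S\<close>, by coercivity it converges itself, and closedness
  of \<open>S\<close> puts the limit into \<open>D\<close>.\<close>

lemma closed_form_representation:
  fixes S :: "'a::{real_inner,complete_space} \<Rightarrow> 'b::{real_inner,complete_space}"
  assumes D: "subspace D"
    and add: "\<And>u v. u \<in> D \<Longrightarrow> v \<in> D \<Longrightarrow> S (u + v) = S u + S v"
    and scale: "\<And>c u. u \<in> D \<Longrightarrow> S (c *\<^sub>R u) = c *\<^sub>R S u"
    and closed: "\<And>X u y. (\<And>n::nat. X n \<in> D) \<Longrightarrow> X \<longlonglongrightarrow> u \<Longrightarrow> (\<lambda>n. S (X n)) \<longlonglongrightarrow> y \<Longrightarrow> u \<in> D \<and> S u = y"
    and coercive: "\<And>u. u \<in> D \<Longrightarrow> (norm u)\<^sup>2 \<le> K * (norm (S u))\<^sup>2" and "K > 0"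
  shows "\<exists>u\<in>D. \<forall>v\<in>D. inner (S u) (S v) = inner f v"
proof -
  define J where "J u = (norm (S u))\<^sup>2 - 2 * inner f u" for u
  define J0 where "J0 = Inf (J ` D)"
  have lower: "- (K * (norm f)\<^sup>2) \<le> J u" if "u \<in> D" for u
  proof -
    have "0 \<le> (sqrt K * norm f - norm u / sqrt K)\<^sup>2" by simp
    also have "\<dots> = K * (norm f)\<^sup>2 - 2 * (norm f * norm u) + (norm u)\<^sup>2 / K"
      using \<open>K > 0\<close> by (simp add: power2_diff power_mult_distrib power_divide)
    also have "(norm u)\<^sup>2 / K \<le> (norm (S u))\<^sup>2"
      using coercive[OF that] \<open>K > 0\<close> by (simp add: divide_le_eq mult.commute)
    finally show ?thesis using norm_cauchy_schwarz[of f u] by (simp add: J_def)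
  qed
  have bdd: "bdd_below (J ` D)" by (rule bdd_belowI2[of D _ J]) (rule lower)
  have J0: "J0 \<le> J u" if "u \<in> D" for u
    unfolding J0_def using bdd that by (intro cInf_lower) auto
  have "\<exists>u\<in>D. J u < J0 + inverse (real (Suc n))" for n
  proof -
    have "J ` D \<noteq> {}" using subspace_0[OF D] by blast
    then show ?thesis
      using cInf_lessD[of "J ` D" "J0 + inverse (real (Suc n))"] by (auto simp: J0_def)
  qed
  then obtain X where X: "\<And>n. X n \<in> D" and JX: "\<And>n. J (X n) < J0 + inverse (real (Suc n))"
    by metis
  have S_diff: "S (u - v) = S u - S v" if "u \<in> D" "v \<in> D" for u v
    using add[OF that(1) subspace_scale[OF D that(2), of "-1"]] scale[OF that(2), of "-1"] by simp
  \<comment> \<open>parallelogram law at the midpoint of \<open>u\<close> and \<open>v\<close>, where \<open>J\<close> is at least its infimum\<close>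
  have par: "(norm (S u - S v))\<^sup>2 \<le> 2 * (J u - J0) + 2 * (J v - J0)" if "u \<in> D" "v \<in> D" for u v
  proof -
    have m: "(1/2) *\<^sub>R (u + v) \<in> D" using that D by (intro subspace_scale subspace_add)
    have "4 * J ((1/2) *\<^sub>R (u + v)) = (norm (S u + S v))\<^sup>2 - 4 * inner f (u + v)"
      using that D by (simp add: J_def scale add subspace_add power_divide)
    moreover have "(norm (S u + S v))\<^sup>2 + (norm (S u - S v))\<^sup>2 = 2 * (norm (S u))\<^sup>2 + 2 * (norm (S v))\<^sup>2"
      by (simp add: power2_norm_eq_inner inner_add_left inner_add_right inner_diff_left inner_diff_right inner_commute)
    moreover have "inner f (u + v) = inner f u + inner f v" by (rule inner_add_right)
    ultimately show ?thesis using J0[OF m] J_def[of u] J_def[of v] by argo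
  qed
  have near: "(norm (S (X n) - S (X k)))\<^sup>2 \<le> 2 * inverse (real (Suc n)) + 2 * inverse (real (Suc k))" for n k
    using par[OF X X, of n k] JX[of n] JX[of k] by simp
  have close: "\<exists>N. \<forall>n\<ge>N. \<forall>k\<ge>N. (norm (S (X n) - S (X k)))\<^sup>2 < e" if "e > 0" for e
  proof -
    obtain N where N: "inverse (real (Suc N)) < e / 4"
      using reals_Archimedean[of "e / 4"] \<open>e > 0\<close> by auto
    have "(norm (S (X n) - S (X k)))\<^sup>2 < e" if "n \<ge> N" "k \<ge> N" for n k
    proof -
      have "inverse (real (Suc n)) \<le> inverse (real (Suc N))" "inverse (real (Suc k)) \<le> inverse (real (Suc N))"
        using that by (auto intro!: le_imp_inverse_le)
      then show ?thesis using near[of n k] N by linarith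
    qed
    then show ?thesis by blast
  qed
  have "Cauchy (\<lambda>n. S (X n))"
  proof (rule metric_CauchyI)
    fix e :: real assume "e > 0"
    then obtain N where N: "\<forall>n\<ge>N. \<forall>k\<ge>N. (norm (S (X n) - S (X k)))\<^sup>2 < e\<^sup>2" using close[of "e\<^sup>2"] by auto
    then show "\<exists>M. \<forall>m\<ge>M. \<forall>n\<ge>M. dist (S (X m)) (S (X n)) < e"
      using power2_less_imp_less[of _ e] \<open>e > 0\<close> unfolding dist_norm by (meson less_imp_le)
  qed
  then obtain y where y: "(\<lambda>n. S (X n)) \<longlonglongrightarrow> y"
    by (meson Cauchy_convergent_iff convergent_def)
  have "Cauchy X"
  proof (rule metric_CauchyI)
    fix e :: real assume "e > 0"
    then obtain N where N: "\<And>n k. n \<ge> N \<Longrightarrow> k \<ge> N \<Longrightarrow> (norm (S (X n) - S (X k)))\<^sup>2 < e\<^sup>2 / K"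
      using close[of "e\<^sup>2 / K"] \<open>K > 0\<close> by auto
    have "dist (X n) (X k) < e" if "n \<ge> N" "k \<ge> N" for n k
    proof -
      have "(norm (X n - X k))\<^sup>2 \<le> K * (norm (S (X n) - S (X k)))\<^sup>2"
        using coercive[OF subspace_diff[OF D X X], of n k] S_diff[OF X X] by simp
      also have "\<dots> < e\<^sup>2" using N[OF that] \<open>K > 0\<close> by (simp add: less_divide_eq mult.commute)
      finally have "norm (X n - X k) < e" by (rule power2_less_imp_less) (use \<open>e > 0\<close> in simp)
      then show ?thesis by (simp only: dist_norm)
    qed
    then show "\<exists>M. \<forall>m\<ge>M. \<forall>n\<ge>M. dist (X m) (X n) < e" by blast
  qed
  then obtain u where u: "X \<longlonglongrightarrow> u" by (meson Cauchy_convergent_iff convergent_def)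
  have uD: "u \<in> D" and Su: "S u = y" using closed[OF X u y] by auto
  have "(\<lambda>n. J (X n)) \<longlonglongrightarrow> J u"
    unfolding J_def Su by (intro tendsto_intros u y)
  moreover have "(\<lambda>n. J0 + inverse (real (Suc n))) \<longlonglongrightarrow> J0 + 0"
    by (intro tendsto_intros LIMSEQ_inverse_real_of_nat)
  ultimately have "J u \<le> J0 + 0" by (rule LIMSEQ_le) (use JX less_imp_le in blast)
  then have min: "J u \<le> J v" if "v \<in> D" for v using J0[OF that] by simp
  have "inner (S u) (S v) = inner f v" if "v \<in> D" for v
  proof (rule ccontr)
    define b where "b = inner (S u) (S v) - inner f v"
    define a where "a = (norm (S v))\<^sup>2"
    assume "inner (S u) (S v) \<noteq> inner f v"
    then have "b \<noteq> 0" by (simp add: b_def)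
    \<comment> \<open>a step against the slope \<open>2 b\<close> of \<open>J\<close> along \<open>v\<close>; adding 1 to \<open>a\<close> covers \<open>S v = 0\<close>\<close>
    define t where "t = - b / (a + 1)"
    have a: "a \<ge> 0" by (simp add: a_def)
    have tv: "t *\<^sub>R v \<in> D" using D that by (rule subspace_scale)
    have "J (u + t *\<^sub>R v) = J u + (t\<^sup>2 * a + 2 * t * b)"
      unfolding J_def add[OF uD tv] scale[OF that] a_def b_def power2_norm_eq_inner
      by (simp add: inner_add_left inner_add_right inner_commute algebra_simps power2_eq_square)
    then have "t\<^sup>2 * a + 2 * t * b \<ge> 0" using min[OF subspace_add[OF D uD tv]] by simp
    moreover have "t\<^sup>2 * a + 2 * t * b < 0"
    proof -
      have tb: "t * (a + 1) = - b" using a by (simp add: t_def)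
      have "t\<^sup>2 * a + 2 * t * b = - (t\<^sup>2 * (a + 2))"
        using tb by (simp add: power2_eq_square) algebra
      moreover have "t \<noteq> 0" using \<open>b \<noteq> 0\<close> a by (simp add: t_def)
      ultimately show ?thesis using a by (simp add: mult_pos_pos)
    qed
    ultimately show False by simp
  qed
  with uD show ?thesis by blast
qed

text \<open>The weak equation has exactly one solution \<open>u\<close> for every \<open>f\<close>, and this is what the converse graph
  of the form operator records; coercivity also bounds \<open>u\<close> by \<open>K \<parallel>f\<parallel>\<close>.\<close>

lemma form_operator_has_inverse:
  fixes S :: "L2 \<Rightarrow> 'b::{real_inner,complete_space}"
  assumes D: "subspace D"
    and add: "\<And>u v. u \<in> D \<Longrightarrow> v \<in> D \<Longrightarrow> S (u + v) = S u + S v"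
    and scale: "\<And>c u. u \<in> D \<Longrightarrow> S (c *\<^sub>R u) = c *\<^sub>R S u"
    and closed: "\<And>X u y. (\<And>n::nat. X n \<in> D) \<Longrightarrow> X \<longlonglongrightarrow> u \<Longrightarrow> (\<lambda>n. S (X n)) \<longlonglongrightarrow> y \<Longrightarrow> u \<in> D \<and> S u = y"
    and coercive: "\<And>u. u \<in> D \<Longrightarrow> (norm u)\<^sup>2 \<le> K * (norm (S u))\<^sup>2" and "K > 0"
    and form: "\<And>u v. u \<in> D \<Longrightarrow> v \<in> D \<Longrightarrow> a u v = inner (S u) (S v)"
  shows "boundedly_invertible (form_operator D a)"
proof -
  have unique: "u = w" if u: "u \<in> D" "\<forall>v\<in>D. inner (S u) (S v) = inner f v"
    and w: "w \<in> D" "\<forall>v\<in>D. inner (S w) (S v) = inner f v" for u w f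
  proof -
    have d: "u - w \<in> D" using D u(1) w(1) by (rule subspace_diff)
    have "S (u - w) = S u - S w"
      using add[OF u(1) subspace_scale[OF D w(1), of "-1"]] scale[OF w(1), of "-1"] by simp
    then have "(norm (S (u - w)))\<^sup>2 = inner (S u) (S (u - w)) - inner (S w) (S (u - w))"
      by (simp add: power2_norm_eq_inner inner_diff_left)
    also have "\<dots> = 0" using u w d by simp
    finally show ?thesis using coercive[OF d] by simp
  qed
  have "\<exists>u\<in>D. \<forall>v\<in>D. inner (S u) (S v) = inner f v" for f
    by (rule closed_form_representation[where K = K]; fact)
  then obtain T where TD: "\<And>f. T f \<in> D" and T: "\<And>f v. v \<in> D \<Longrightarrow> inner (S (T f)) (S v) = inner f v"
    by metis
  have "bounded_linear T"
  proof (rule bounded_linear_intro[where K = K])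
    show "T (f + g) = T f + T g" for f g
      by (rule unique[of _ "f + g"])
        (use D TD T in \<open>auto intro: subspace_add simp: add inner_add_left\<close>)
    show "T (c *\<^sub>R f) = c *\<^sub>R T f" for c f
      by (rule unique[of _ "c *\<^sub>R f"])
        (use D TD T in \<open>auto intro: subspace_scale simp: scale\<close>)
    show "norm (T f) \<le> norm f * K" for f
    proof (cases "T f = 0")
      case False
      have "norm (T f) * norm (T f) \<le> K * (norm (S (T f)))\<^sup>2"
        using coercive[OF TD] by (simp add: power2_eq_square)
      also have "\<dots> = K * inner f (T f)" using T[OF TD, of f f] by (simp add: power2_norm_eq_inner)
      also have "\<dots> \<le> K * (norm f * norm (T f))"
        using \<open>K > 0\<close> norm_cauchy_schwarz by (intro mult_left_mono) auto
      finally have "norm (T f) * norm (T f) \<le> (norm f * K) * norm (T f)" by (simp add: mult_ac)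
      then show ?thesis using False by simp
    qed (use \<open>K > 0\<close> in simp)
  qed
  then have app: "blinfun_apply (Blinfun T) = T" by (rule bounded_linear_Blinfun_apply)
  have "is_op_inverse (Blinfun T) (form_operator D a)"
    unfolding is_op_inverse_def form_operator_def app
  proof (intro set_eqI iffI; clarsimp)
    fix f u assume u: "u \<in> D" "\<forall>v\<in>D. a u v = inner f v"
    show "u = T f" by (rule unique[of _ f]) (use u TD T form in auto)
  next
    fix f
    show "T f \<in> D \<and> (\<forall>v\<in>D. a (T f) v = inner f v)" using TD T form by simp
  qed
  then show ?thesis unfolding boundedly_invertible_def ..
qed

lemma is_op_inverse_iff:
  "is_op_inverse T A \<longleftrightarrow> (\<forall>u f. (u, f) \<in> A \<longleftrightarrow> u = blinfun_apply T f)"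
  unfolding is_op_inverse_def by (auto simp: set_eq_iff)

lemma op_inverse_eqI:
  assumes "is_op_inverse T A"
  shows "op_inverse A = T"
  unfolding op_inverse_def
proof (rule the_equality)
  show "is_op_inverse T A" by (rule assms)
next
  fix T' assume "is_op_inverse T' A"
  then show "T' = T" using assms unfolding is_op_inverse_iff by (intro blinfun_eqI) metis
qed

lemma is_op_inverse_op_scale:
  assumes T: "is_op_inverse T A" and "c \<noteq> 0"
  shows "is_op_inverse ((1 / c) *\<^sub>R T) (op_scale c A)"
  unfolding is_op_inverse_iff
proof (intro allI)
  fix u f
  have "(u, f) \<in> op_scale c A \<longleftrightarrow> (u, (1 / c) *\<^sub>R f) \<in> A"
    unfolding op_scale_def using \<open>c \<noteq> 0\<close> by (auto intro!: exI[of _ "(1 / c) *\<^sub>R f"])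
  then show "(u, f) \<in> op_scale c A \<longleftrightarrow> u = blinfun_apply ((1 / c) *\<^sub>R T) f"
    using T by (simp add: is_op_inverse_iff scaleR_blinfun.rep_eq blinfun.scaleR_right)
qed

section \<open>Schroedinger forms\<close>

text \<open>The Schroedinger form is the pull-back of the inner product of \<open>L\<^sup>2 \<times> L\<^sup>2\<close> under this map, so
  the form is closed when the map is closed as an unbounded operator.\<close>

definition form_map :: "(real \<Rightarrow> real) \<Rightarrow> L2 \<Rightarrow> L2 \<times> L2" where
  "form_map V u = (weak_deriv u, mult_L2 (\<lambda>x. sqrt (V x)) u)"

lemma form_domain_iff:
  assumes [measurable]: "V \<in> borel_measurable borel" and V: "\<And>x. V x \<ge> 0"
  shows "u \<in> form_domain V \<longleftrightarrow> has_weak_deriv u (weak_deriv u) \<and> square_integrable (\<lambda>x. sqrt (V x) * rep_L2 u x)"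
proof -
  have "integrable lborel (\<lambda>x. (rep_L2 (weak_deriv u) x)\<^sup>2 + V x * (rep_L2 u x)\<^sup>2) \<longleftrightarrow>
      integrable lborel (\<lambda>x. V x * (rep_L2 u x)\<^sup>2)"
    using Bochner_Integration.integrable_diff[of lborel "\<lambda>x. (rep_L2 (weak_deriv u) x)\<^sup>2 + V x * (rep_L2 u x)\<^sup>2"
        "\<lambda>x. (rep_L2 (weak_deriv u) x)\<^sup>2"]
      square_integrable_integrable[OF rep_L2_square_integrable[of "weak_deriv u"]]
    by auto
  moreover have "(sqrt (V x) * rep_L2 u x)\<^sup>2 = V x * (rep_L2 u x)\<^sup>2" for x
    using V[of x] by (simp add: power_mult_distrib)
  ultimately show ?thesis
    unfolding form_domain_def square_integrable_def by (auto simp: H1_iff)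
qed

lemma schroedinger_form_eq_inner:
  assumes [measurable]: "V \<in> borel_measurable borel" and V: "\<And>x. V x \<ge> 0"
    and u: "u \<in> form_domain V" and v: "v \<in> form_domain V"
  shows "schroedinger_form V u v = inner (form_map V u) (form_map V v)"
proof -
  have su: "square_integrable (\<lambda>x. sqrt (V x) * rep_L2 u x)" and sv: "square_integrable (\<lambda>x. sqrt (V x) * rep_L2 v x)"
    using u v form_domain_iff[OF assms(1) V] by auto
  have eq: "(sqrt (V x) * rep_L2 u x) * (sqrt (V x) * rep_L2 v x) = V x * (rep_L2 u x * rep_L2 v x)" for x
  proof -
    have "(sqrt (V x) * rep_L2 u x) * (sqrt (V x) * rep_L2 v x) = (sqrt (V x) * sqrt (V x)) * (rep_L2 u x * rep_L2 v x)"
      by (simp only: mult_ac)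
    then show ?thesis using V[of x] by simp
  qed
  have "schroedinger_form V u v = (\<integral>x. rep_L2 (weak_deriv u) x * rep_L2 (weak_deriv v) x \<partial>lborel)
      + (\<integral>x. V x * (rep_L2 u x * rep_L2 v x) \<partial>lborel)"
    unfolding schroedinger_form_def
    using square_integrable_mult[OF rep_L2_square_integrable rep_L2_square_integrable] square_integrable_mult[OF su sv]
    by (intro Bochner_Integration.integral_add) (simp_all add: eq)
  also have "(\<integral>x. V x * (rep_L2 u x * rep_L2 v x) \<partial>lborel) = inner (mult_L2 (\<lambda>x. sqrt (V x)) u) (mult_L2 (\<lambda>x. sqrt (V x)) v)"
    unfolding mult_L2_def inner_abs_L2[OF su sv] eq ..
  finally show ?thesis by (simp add: form_map_def inner_L2_eq_integral)
qed

text \<open>The constant \<open>K\<close> then bounds the norm of the inverse of the operator, and energies by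
  \<open>K \<parallel>f\<parallel>\<^sup>2\<close>.\<close>

definition coercive :: "(real \<Rightarrow> real) \<Rightarrow> real \<Rightarrow> bool" where
  "coercive V K \<longleftrightarrow> (\<forall>u\<in>form_domain V. (norm u)\<^sup>2 \<le> K * (norm (form_map V u))\<^sup>2)"

lemma schroedinger_operator_boundedly_invertible:
  assumes [measurable]: "V \<in> borel_measurable borel" and V: "\<And>x. V x \<ge> 0"
    and "coercive V K" "K > 0"
  shows "boundedly_invertible (schroedinger_operator V)"
  unfolding schroedinger_operator_def
proof (rule form_operator_has_inverse[where S = "form_map V" and K = K])
  note iff = form_domain_iff[OF assms(1) V]
  have sq[measurable]: "(\<lambda>x. sqrt (V x)) \<in> borel_measurable borel" by measurable
  have add: "u + v \<in> form_domain V" "form_map V (u + v) = form_map V u + form_map V v"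
    if "u \<in> form_domain V" "v \<in> form_domain V" for u v
  proof -
    have d: "has_weak_deriv (u + v) (weak_deriv u + weak_deriv v)"
      using that by (intro has_weak_deriv_add) (simp_all add: iff)
    show "u + v \<in> form_domain V" "form_map V (u + v) = form_map V u + form_map V v"
      using d weak_deriv_eqI[OF d] that mult_L2_add[OF _ _ sq, of u v] by (simp_all add: iff form_map_def)
  qed
  have scale: "c *\<^sub>R u \<in> form_domain V" "form_map V (c *\<^sub>R u) = c *\<^sub>R form_map V u"
    if "u \<in> form_domain V" for c u
  proof -
    have d: "has_weak_deriv (c *\<^sub>R u) (c *\<^sub>R weak_deriv u)"
      using that by (intro has_weak_deriv_scaleR) (simp add: iff)
    show "c *\<^sub>R u \<in> form_domain V" "form_map V (c *\<^sub>R u) = c *\<^sub>R form_map V u"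
      using d weak_deriv_eqI[OF d] that mult_L2_scaleR[OF _ sq, of u] by (simp_all add: iff form_map_def)
  qed
  show "form_map V (u + v) = form_map V u + form_map V v" if "u \<in> form_domain V" "v \<in> form_domain V" for u v
    using that by (rule add)
  show "form_map V (c *\<^sub>R u) = c *\<^sub>R form_map V u" if "u \<in> form_domain V" for c u
    using that by (rule scale)
  show "subspace (form_domain V)"
  proof (rule subspaceI)
    have "has_weak_deriv 0 0" by (simp add: has_weak_deriv_iff_inner)
    moreover have "square_integrable (\<lambda>x. sqrt (V x) * rep_L2 0 x)"
    proof -
      have "AE x in lborel. rep_L2 0 x = 0"
        using rep_L2_scaleR[of 0 0] by simp
      then have ae: "AE x in lborel. 0 = sqrt (V x) * rep_L2 0 x" by eventually_elim simp
      show ?thesis by (rule square_integrable_cong_AE[OF _ square_integrable_zero ae]) measurable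
    qed
    ultimately show "0 \<in> form_domain V" by (simp add: iff weak_deriv_eqI)
  qed (fact add scale)+
  show "u \<in> form_domain V \<and> form_map V u = y"
    if X: "\<And>n. X n \<in> form_domain V" and u: "X \<longlonglongrightarrow> u" and y: "(\<lambda>n. form_map V (X n)) \<longlonglongrightarrow> y" for X :: "nat \<Rightarrow> L2" and u y
  proof -
    have y1: "(\<lambda>n. weak_deriv (X n)) \<longlonglongrightarrow> fst y" and y2: "(\<lambda>n. mult_L2 (\<lambda>x. sqrt (V x)) (X n)) \<longlonglongrightarrow> snd y"
      using tendsto_fst[OF y] tendsto_snd[OF y] by (simp_all add: form_map_def)
    have d: "has_weak_deriv u (fst y)"
      by (rule has_weak_deriv_closed[OF _ u y1]) (use X iff in blast)
    have "square_integrable (\<lambda>x. sqrt (V x) * rep_L2 u x)" "mult_L2 (\<lambda>x. sqrt (V x)) u = snd y"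
      using mult_L2_closed[OF sq _ u y2] X iff by blast+
    with d show ?thesis by (simp add: iff form_map_def weak_deriv_eqI)
  qed
  show "(norm u)\<^sup>2 \<le> K * (norm (form_map V u))\<^sup>2" if "u \<in> form_domain V" for u
    using \<open>coercive V K\<close> that by (simp add: coercive_def)
  show "schroedinger_form V u v = inner (form_map V u) (form_map V v)"
    if "u \<in> form_domain V" "v \<in> form_domain V" for u v
    using that by (rule schroedinger_form_eq_inner[OF assms(1) V])
qed fact

lemma norm_form_map: "(norm (form_map V u))\<^sup>2 = (norm (weak_deriv u))\<^sup>2 + (norm (mult_L2 (\<lambda>x. sqrt (V x)) u))\<^sup>2"
  by (simp only: power2_norm_eq_inner form_map_def inner_Pair)

text \<open>Where the potential is at least \<open>L\<close>, the energy controls the mass with a gain of \<open>1 / L\<close>.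
  The multiplier \<open>b\<close> selects that region: it will be an indicator, \<open>1 - \<psi>\<close> or \<open>\<psi>'\<close>.\<close>

lemma norm_exterior_le:
  assumes [measurable]: "V \<in> borel_measurable borel" "b \<in> borel_measurable borel" and V: "\<And>x. V x \<ge> 0"
    and "L > 0" and b: "\<And>x. L * (b x)\<^sup>2 \<le> V x" and u: "u \<in> form_domain V"
  shows "square_integrable (\<lambda>x. b x * rep_L2 u x)"
    "(norm (mult_L2 b u))\<^sup>2 \<le> (norm (mult_L2 (\<lambda>x. sqrt (V x)) u))\<^sup>2 / L"
proof -
  have s: "square_integrable (\<lambda>x. sqrt (V x) * rep_L2 u x)"
    using u form_domain_iff[OF assms(1) V] by simp
  have "(b x * rep_L2 u x)\<^sup>2 \<le> (1 / L) * (sqrt (V x) * rep_L2 u x)\<^sup>2" for x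
  proof -
    have "(b x)\<^sup>2 \<le> V x / L" using b[of x] \<open>L > 0\<close> by (simp add: le_divide_eq mult.commute)
    then have "(b x)\<^sup>2 * (rep_L2 u x)\<^sup>2 \<le> V x / L * (rep_L2 u x)\<^sup>2" by (rule mult_right_mono) simp
    then show ?thesis using V[of x] by (simp add: power_mult_distrib)
  qed
  note * = square_integrable_mono[OF _ s this]
  show i: "square_integrable (\<lambda>x. b x * rep_L2 u x)" by (rule *(1)) measurable
  show "(norm (mult_L2 b u))\<^sup>2 \<le> (norm (mult_L2 (\<lambda>x. sqrt (V x)) u))\<^sup>2 / L"
    unfolding norm_mult_L2[OF s] norm_mult_L2[OF i] using *(2) by simp
qed

text \<open>Outside \<open>{-r<..<r}\<close> the norm is paid for by the potential, inside by the kinetic energy and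
  the exterior part (\<open>norm_interior_le\<close>). The numbers come from
  \<open>(a + 3 r g)\<^sup>2 \<le> 2 a\<^sup>2 + 18 r\<^sup>2 g\<^sup>2\<close>.\<close>

lemma coerciveI:
  assumes [measurable]: "V \<in> borel_measurable borel" and V: "\<And>x. V x \<ge> 0"
    and "r > 0" "L > 0" and L: "\<And>x. \<bar>x\<bar> \<ge> r \<Longrightarrow> V x \<ge> L"
    and K: "18 * r\<^sup>2 \<le> K" "3 / L \<le> K"
  shows "coercive V K"
  unfolding coercive_def
proof
  fix u assume u: "u \<in> form_domain V"
  define in' where "in' = norm (mult_L2 (indicator {-r<..<r}) u)"
  define out where "out = norm (mult_L2 (indicator (-{-r<..<r})) u)"
  define g where "g = norm (weak_deriv u)"
  define w where "w = norm (mult_L2 (\<lambda>x. sqrt (V x)) u)"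
  have d: "has_weak_deriv u (weak_deriv u)" using u form_domain_iff[OF assms(1) V] by simp
  have si: "square_integrable (\<lambda>x. indicator A x * rep_L2 u x)" if "A \<in> sets borel" for A
    by (rule square_integrable_bounded_mult_rep[where B = 1]) (use that in \<open>auto simp: indicator_def\<close>)
  have "(norm u)\<^sup>2 = in'\<^sup>2 + out\<^sup>2"
  proof -
    have "in'\<^sup>2 + out\<^sup>2 = (\<integral>x. (indicator {-r<..<r} x * rep_L2 u x)\<^sup>2 + (indicator (-{-r<..<r}) x * rep_L2 u x)\<^sup>2 \<partial>lborel)"
      unfolding in'_def out_def by (simp add: norm_mult_L2 si square_integrable_integrable)
    also have "\<dots> = (norm u)\<^sup>2"
      unfolding norm_L2_eq_integral by (rule Bochner_Integration.integral_cong) (auto split: split_indicator)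
    finally show ?thesis ..
  qed
  also have "in'\<^sup>2 \<le> (out + 3 * r * g)\<^sup>2"
    unfolding in'_def out_def g_def by (rule power_mono[OF norm_interior_le[OF d \<open>r > 0\<close>]]) simp
  also have "\<dots> \<le> 2 * out\<^sup>2 + 18 * r\<^sup>2 * g\<^sup>2"
    using sum_squares_bound[of out "3 * r * g"] by (simp add: power2_sum power_mult_distrib mult_ac)
  also have "2 * out\<^sup>2 + 18 * r\<^sup>2 * g\<^sup>2 + out\<^sup>2 = 18 * r\<^sup>2 * g\<^sup>2 + 3 * out\<^sup>2" by simp
  also have "\<dots> \<le> K * g\<^sup>2 + K * w\<^sup>2"
  proof (rule add_mono)
    show "18 * r\<^sup>2 * g\<^sup>2 \<le> K * g\<^sup>2" by (intro mult_right_mono K) simp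
    have "out\<^sup>2 \<le> w\<^sup>2 / L"
      unfolding out_def w_def
      by (rule norm_exterior_le(2)[OF assms(1) _ V \<open>L > 0\<close> _ u])
        (use V L in \<open>auto simp: indicator_def abs_le_iff not_less abs_if\<close>)
    then have "3 * out\<^sup>2 \<le> 3 / L * w\<^sup>2" by simp
    also have "\<dots> \<le> K * w\<^sup>2" by (intro mult_right_mono K) simp
    finally show "3 * out\<^sup>2 \<le> K * w\<^sup>2" .
  qed
  finally show "(norm u)\<^sup>2 \<le> K * (norm (form_map V u))\<^sup>2"
    by (simp add: norm_form_map g_def w_def distrib_left)
qed

section \<open>Comparison of two Schroedinger operators\<close>

text \<open>Testing the equation with \<open>u\<close> itself gives \<open>\<parallel>S u\<parallel>\<^sup>2 = \<langle>f, u\<rangle> \<le> \<parallel>f\<parallel> \<parallel>u\<parallel>\<close> for the form map \<open>S\<close>, and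
  coercivity bounds \<open>\<parallel>u\<parallel>\<close> by \<open>\<parallel>S u\<parallel>\<close>.\<close>

lemma schroedinger_solution_bounds:
  assumes V: "V \<in> borel_measurable borel" "\<And>x. V x \<ge> 0"
    and "coercive V K" "K > 0" and sol: "(u, f) \<in> schroedinger_operator V"
  shows "norm (form_map V u) \<le> sqrt K * norm f" "norm u \<le> K * norm f"
proof -
  define w where "w = norm (form_map V u)"
  have uD: "u \<in> form_domain V" and form: "schroedinger_form V u u = inner f u"
    using sol by (auto simp: schroedinger_operator_def form_operator_def)
  have "(norm u)\<^sup>2 \<le> K * w\<^sup>2"
    using \<open>coercive V K\<close> uD by (simp add: coercive_def w_def)
  also have "\<dots> = (sqrt K * w)\<^sup>2" using \<open>K > 0\<close> by (simp add: power_mult_distrib)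
  finally have u: "norm u \<le> sqrt K * w"
    by (rule power2_le_imp_le) (use \<open>K > 0\<close> in \<open>simp add: w_def\<close>)
  have "w * w = inner f u"
    using form schroedinger_form_eq_inner[OF V uD uD] by (simp add: w_def flip: power2_eq_square power2_norm_eq_inner)
  also have "\<dots> \<le> norm f * norm u" by (rule norm_cauchy_schwarz)
  also have "\<dots> \<le> norm f * (sqrt K * w)" by (rule mult_left_mono[OF u]) simp
  finally have "w * w \<le> (sqrt K * norm f) * w" by (simp add: mult_ac)
  then show w: "norm (form_map V u) \<le> sqrt K * norm f"
    using \<open>K > 0\<close> by (cases "w = 0") (auto simp: w_def)
  have "sqrt K * w \<le> sqrt K * (sqrt K * norm f)"
    using w \<open>K > 0\<close> by (intro mult_left_mono) (auto simp: w_def)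
  with u show "norm u \<le> K * norm f"
    using \<open>K > 0\<close> by (simp add: mult.assoc[symmetric])
qed

text \<open>The potential is bounded on the support of \<open>\<psi>\<close>, so a cut off function lies in its form domain
  no matter from which Schroedinger operator \<open>u\<close> came. This is what allows the equation of one
  operator to be tested with solutions of the other.\<close>

lemma cutoff_in_form_domain:
  assumes [measurable]: "V \<in> borel_measurable borel" and V: "\<And>x. V x \<ge> 0"
    and \<psi>: "test_function \<psi>" and N: "\<forall>x. \<psi> x \<noteq> 0 \<longrightarrow> V x \<le> N"
    and u: "has_weak_deriv u (weak_deriv u)"
  shows "mult_L2 \<psi> u \<in> form_domain V"
    "weak_deriv (mult_L2 \<psi> u) = mult_L2 (deriv \<psi>) u + mult_L2 \<psi> (weak_deriv u)"
    "AE x in lborel. rep_L2 (mult_L2 (\<lambda>x. sqrt (V x)) (mult_L2 \<psi> u)) x = sqrt (V x) * (\<psi> x * rep_L2 u x)"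
proof -
  have d: "has_weak_deriv (mult_L2 \<psi> u) (mult_L2 (deriv \<psi>) u + mult_L2 \<psi> (weak_deriv u))"
    by (rule has_weak_deriv_mult[OF u \<psi>])
  show w: "weak_deriv (mult_L2 \<psi> u) = mult_L2 (deriv \<psi>) u + mult_L2 \<psi> (weak_deriv u)"
    by (rule weak_deriv_eqI[OF d])
  obtain B where "B \<ge> 0" and B: "\<And>x. \<bar>\<psi> x\<bar> \<le> B" using test_function_regularity(3)[OF \<psi>] by blast
  have [measurable]: "\<psi> \<in> borel_measurable borel" by (rule test_function_regularity(5)[OF \<psi>])
  have ae: "AE x in lborel. rep_L2 (mult_L2 \<psi> u) x = \<psi> x * rep_L2 u x"
    by (rule rep_mult_L2[OF square_integrable_bounded_mult_rep[OF _ B]]) measurable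
  have ae': "AE x in lborel. sqrt (V x) * \<psi> x * rep_L2 u x = sqrt (V x) * rep_L2 (mult_L2 \<psi> u) x"
    using ae by eventually_elim simp
  have bd: "\<bar>sqrt (V x) * \<psi> x\<bar> \<le> sqrt \<bar>N\<bar> * B" for x
  proof (cases "\<psi> x = 0")
    case False
    then have "sqrt (V x) \<le> sqrt \<bar>N\<bar>" using N by (simp add: order_trans[OF _ abs_ge_self])
    then show ?thesis using B[of x] V[of x] unfolding abs_mult by (intro mult_mono) auto
  qed (use \<open>B \<ge> 0\<close> in simp)
  have "square_integrable (\<lambda>x. sqrt (V x) * \<psi> x * rep_L2 u x)"
    by (rule square_integrable_bounded_mult_rep[OF _ bd]) measurable
  then have s: "square_integrable (\<lambda>x. sqrt (V x) * rep_L2 (mult_L2 \<psi> u) x)"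
    by (rule square_integrable_cong_AE[rotated, OF _ ae']) measurable
  then show "mult_L2 \<psi> u \<in> form_domain V"
    using d w by (simp add: form_domain_iff[OF assms(1) V])
  show "AE x in lborel. rep_L2 (mult_L2 (\<lambda>x. sqrt (V x)) (mult_L2 \<psi> u)) x = sqrt (V x) * (\<psi> x * rep_L2 u x)"
    using rep_mult_L2[OF s] ae by eventually_elim simp
qed

lemma schroedinger_form_cutoff:
  assumes [measurable]: "V \<in> borel_measurable borel" and V: "\<And>x. V x \<ge> 0"
    and \<psi>: "test_function \<psi>" and N: "\<forall>x. \<psi> x \<noteq> 0 \<longrightarrow> V x \<le> N"
    and v: "has_weak_deriv v (weak_deriv v)" and sol: "(u, f) \<in> schroedinger_operator V"
  shows "inner f (mult_L2 \<psi> v) = inner (weak_deriv u) (mult_L2 (deriv \<psi>) v)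
      + inner (weak_deriv u) (mult_L2 \<psi> (weak_deriv v)) + (\<integral>x. V x * \<psi> x * (rep_L2 u x * rep_L2 v x) \<partial>lborel)"
proof -
  note c = cutoff_in_form_domain[OF assms(1) V \<psi> N v]
  have uD: "u \<in> form_domain V" and form: "schroedinger_form V u w = inner f w" if "w \<in> form_domain V" for w
    using sol that by (auto simp: schroedinger_operator_def form_operator_def)
  note uD = uD[OF c(1)]
  have s: "square_integrable (\<lambda>x. sqrt (V x) * rep_L2 u x)"
    using uD by (simp add: form_domain_iff[OF assms(1) V])
  have m[measurable]: "\<psi> \<in> borel_measurable borel" by (rule test_function_regularity(5)[OF \<psi>])
  have "inner f (mult_L2 \<psi> v) = inner (weak_deriv u) (mult_L2 (deriv \<psi>) v + mult_L2 \<psi> (weak_deriv v))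
     + inner (mult_L2 (\<lambda>x. sqrt (V x)) u) (mult_L2 (\<lambda>x. sqrt (V x)) (mult_L2 \<psi> v))"
    using form[OF c(1)] schroedinger_form_eq_inner[OF assms(1) V uD c(1)] c(2) by (simp add: form_map_def)
  also have "inner (mult_L2 (\<lambda>x. sqrt (V x)) u) (mult_L2 (\<lambda>x. sqrt (V x)) (mult_L2 \<psi> v))
      = (\<integral>x. V x * \<psi> x * (rep_L2 u x * rep_L2 v x) \<partial>lborel)"
    unfolding inner_L2_eq_integral
  proof (rule integral_cong_AE)
    show "AE x in lborel. rep_L2 (mult_L2 (\<lambda>x. sqrt (V x)) u) x * rep_L2 (mult_L2 (\<lambda>x. sqrt (V x)) (mult_L2 \<psi> v)) x
       = V x * \<psi> x * (rep_L2 u x * rep_L2 v x)"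
      using rep_mult_L2[OF s] c(3)
    proof eventually_elim
      case (elim x)
      have "sqrt (V x) * rep_L2 u x * (sqrt (V x) * (\<psi> x * rep_L2 v x))
          = (sqrt (V x) * sqrt (V x)) * \<psi> x * (rep_L2 u x * rep_L2 v x)" by (simp only: mult_ac)
      then show ?case unfolding elim using V[of x] by simp
    qed
  qed measurable
  finally show ?thesis by (simp add: inner_add_right)
qed

text \<open>The weight \<open>(W V)\<^sup>1\<^sup>/\<^sup>2\<close> lets the Cauchy-Schwarz inequality distribute the two potentials to the
  function whose energy controls them.\<close>

lemma integral_cross_term_le:
  assumes [measurable]: "V \<in> borel_measurable borel" "W \<in> borel_measurable borel" "b \<in> borel_measurable borel"
    and V: "\<And>x. V x \<ge> 0" and W: "\<And>x. W x \<ge> 0" and "\<theta> \<ge> 0" "\<kappa> \<ge> 0"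
    and b: "\<And>x. \<bar>b x\<bar> \<le> \<theta> * (sqrt (W x) * sqrt (V x)) + \<kappa>"
    and u: "square_integrable (\<lambda>x. sqrt (W x) * rep_L2 u x)" and v: "square_integrable (\<lambda>x. sqrt (V x) * rep_L2 v x)"
  shows "\<bar>\<integral>x. b x * (rep_L2 u x * rep_L2 v x) \<partial>lborel\<bar>
    \<le> \<theta> * (norm (mult_L2 (\<lambda>x. sqrt (W x)) u) * norm (mult_L2 (\<lambda>x. sqrt (V x)) v)) + \<kappa> * (norm u * norm v)"
proof -
  have abs_si: "square_integrable (\<lambda>x. \<bar>f x\<bar>)" if "square_integrable f" for f
    using that by (auto simp: square_integrable_def)
  have cs: "(\<integral>x. \<bar>f x\<bar> * \<bar>g x\<bar> \<partial>lborel) \<le> norm (abs_L2 f) * norm (abs_L2 g)"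
    "integrable lborel (\<lambda>x. \<bar>f x\<bar> * \<bar>g x\<bar>)" if "square_integrable f" "square_integrable g" for f g
  proof -
    have nrm: "sqrt (\<integral>x. \<bar>f x\<bar>\<^sup>2 \<partial>lborel) = norm (abs_L2 f)" if "square_integrable f" for f
      using norm_abs_L2[OF that] by (simp flip: norm_abs_L2[OF that])
    show "(\<integral>x. \<bar>f x\<bar> * \<bar>g x\<bar> \<partial>lborel) \<le> norm (abs_L2 f) * norm (abs_L2 g)"
      using Cauchy_Schwarz_square_integrable[OF abs_si abs_si, OF that] unfolding nrm[OF that(1)] nrm[OF that(2)] by linarith
    show "integrable lborel (\<lambda>x. \<bar>f x\<bar> * \<bar>g x\<bar>)"
      by (rule square_integrable_mult[OF abs_si abs_si, OF that])
  qed
  define k1 where "k1 x = \<bar>sqrt (W x) * rep_L2 u x\<bar> * \<bar>sqrt (V x) * rep_L2 v x\<bar>" for x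
  define k2 where "k2 x = \<bar>rep_L2 u x\<bar> * \<bar>rep_L2 v x\<bar>" for x
  have k: "integrable lborel k1" "integrable lborel k2"
    unfolding k1_def k2_def using cs(2)[OF u v] cs(2)[OF rep_L2_square_integrable rep_L2_square_integrable] by auto
  have "\<bar>\<integral>x. b x * (rep_L2 u x * rep_L2 v x) \<partial>lborel\<bar> \<le> (\<integral>x. \<theta> * k1 x + \<kappa> * k2 x \<partial>lborel)"
  proof (rule integral_abs_bound_integral)
    have pointwise: "\<bar>b x * (rep_L2 u x * rep_L2 v x)\<bar> \<le> \<theta> * k1 x + \<kappa> * k2 x" for x
    proof -
      have "\<bar>b x * (rep_L2 u x * rep_L2 v x)\<bar> = \<bar>b x\<bar> * k2 x" by (simp add: abs_mult k2_def)
      also have "\<dots> \<le> (\<theta> * (sqrt (W x) * sqrt (V x)) + \<kappa>) * k2 x"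
        by (rule mult_right_mono[OF b]) (simp add: k2_def)
      also have "\<dots> = \<theta> * k1 x + \<kappa> * k2 x"
        using V[of x] W[of x] by (simp add: k1_def k2_def abs_mult algebra_simps)
      finally show ?thesis .
    qed
    show i: "integrable lborel (\<lambda>x. \<theta> * k1 x + \<kappa> * k2 x)" using k by simp
    show "integrable lborel (\<lambda>x. b x * (rep_L2 u x * rep_L2 v x))"
    proof (rule Bochner_Integration.integrable_bound[OF i])
      show "AE x in lborel. norm (b x * (rep_L2 u x * rep_L2 v x)) \<le> norm (\<theta> * k1 x + \<kappa> * k2 x)"
        using order_trans[OF pointwise abs_ge_self] by (intro always_eventually allI) (simp only: real_norm_def)
    qed measurable
    show "\<bar>b x * (rep_L2 u x * rep_L2 v x)\<bar> \<le> \<theta> * k1 x + \<kappa> * k2 x" if "x \<in> space lborel" for x by (rule pointwise)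
  qed
  also have "\<dots> = \<theta> * (\<integral>x. k1 x \<partial>lborel) + \<kappa> * (\<integral>x. k2 x \<partial>lborel)" using k by simp
  also have "\<dots> \<le> \<theta> * (norm (mult_L2 (\<lambda>x. sqrt (W x)) u) * norm (mult_L2 (\<lambda>x. sqrt (V x)) v)) + \<kappa> * (norm u * norm v)"
    unfolding k1_def k2_def mult_L2_def
    using cs(1)[OF u v] cs(1)[OF rep_L2_square_integrable[of u] rep_L2_square_integrable[of v]] \<open>\<theta> \<ge> 0\<close> \<open>\<kappa> \<ge> 0\<close>
    by (intro add_mono mult_left_mono) (simp_all only: abs_L2_rep)
  finally show ?thesis .
qed

lemma schroedinger_inverse_symmetric:
  assumes V: "V \<in> borel_measurable borel" "\<And>x. V x \<ge> 0" and T: "is_op_inverse T (schroedinger_operator V)"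
  shows "inner (blinfun_apply T f) g = inner f (blinfun_apply T g)"
proof -
  have sol: "blinfun_apply T f \<in> form_domain V"
    "v \<in> form_domain V \<Longrightarrow> schroedinger_form V (blinfun_apply T f) v = inner f v" for f v
    using T by (auto simp: is_op_inverse_iff schroedinger_operator_def form_operator_def)
  show ?thesis
    using sol(2)[OF sol(1), of f g] sol(2)[OF sol(1), of g f] schroedinger_form_eq_inner[OF V sol(1) sol(1)]
    by (metis inner_commute)
qed

text \<open>Writing \<open>u = T\<^sub>W f\<close> and \<open>v = T\<^sub>V g\<close>, symmetry of \<open>T\<^sub>V\<close> makes \<open>\<langle>(T\<^sub>W - T\<^sub>V) f, g\<rangle>\<close> equal to
  \<open>\<langle>u, g\<rangle> - \<langle>f, v\<rangle>\<close>. The first term of the bound comes from \<open>(1 - \<psi>) u\<close> and \<open>(1 - \<psi>) v\<close>, the second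
  from the commutators with \<open>\<psi>\<close>, the other two from \<open>V - W\<close> on the support of \<open>\<psi>\<close>. The
  products \<open>\<langle>u', \<psi> v'\<rangle>\<close> of the derivatives occur in both tested equations and cancel.\<close>

theorem schroedinger_inverse_diff_le:
  assumes V: "V \<in> borel_measurable borel" "\<And>x. V x \<ge> 0" and W: "W \<in> borel_measurable borel" "\<And>x. W x \<ge> 0"
    and coercive: "coercive V K" "coercive W K" and "K > 0"
    and TV: "is_op_inverse TV (schroedinger_operator V)" and TW: "is_op_inverse TW (schroedinger_operator W)"
    and \<psi>: "test_function \<psi>" "\<And>x. 0 \<le> \<psi> x" "\<And>x. \<psi> x \<le> 1"
    and B: "\<And>x. \<bar>deriv \<psi> x\<bar> \<le> B" "B > 0"
    and ext: "\<And>x. \<psi> x \<noteq> 1 \<Longrightarrow> L \<le> V x" "\<And>x. \<psi> x \<noteq> 1 \<Longrightarrow> L \<le> W x" "L > 0"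
    and bounded: "\<And>x. \<psi> x \<noteq> 0 \<Longrightarrow> V x \<le> N" "\<And>x. \<psi> x \<noteq> 0 \<Longrightarrow> W x \<le> N"
    and close: "\<And>x. \<psi> x \<noteq> 0 \<Longrightarrow> \<bar>V x - W x\<bar> \<le> \<theta> * (sqrt (W x) * sqrt (V x)) + \<kappa>" "\<theta> \<ge> 0" "\<kappa> \<ge> 0"
  shows "norm (TW - TV) \<le> 2 * sqrt (K / L) + 2 * B * sqrt (K / L) * sqrt K + \<theta> * K + \<kappa> * K\<^sup>2"
    (is "_ \<le> ?E")
proof -
  \<comment> \<open>\<open>\<psi>\<close> is maximal there, so \<open>\<psi>'\<close> lives where the potentials are at least \<open>L\<close>\<close>
  have deriv0: "deriv \<psi> x = 0" if "\<psi> x = 1" for x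
    by (rule DERIV_local_max[OF test_function_deriv(1)[OF \<psi>(1)], of 1]) (use \<psi>(3) that in auto)
  have m[measurable]: "\<psi> \<in> borel_measurable borel" "deriv \<psi> \<in> borel_measurable borel"
    by (rule test_function_regularity(5,6)[OF \<psi>(1)])+
  note [measurable] = V(1) W(1)
  have ext': "\<forall>x. \<psi> x \<noteq> 1 \<longrightarrow> L \<le> V x" "\<forall>x. \<psi> x \<noteq> 1 \<longrightarrow> L \<le> W x"
    and bounded': "\<forall>x. \<psi> x \<noteq> 0 \<longrightarrow> V x \<le> N" "\<forall>x. \<psi> x \<noteq> 0 \<longrightarrow> W x \<le> N"
    using ext bounded by auto
  have K0: "sqrt K \<ge> 0" "K \<ge> 0" using \<open>K > 0\<close> by auto
  \<comment> \<open>\<open>U\<close> stands for either potential; the last two bounds concern the region where it is at least \<open>L\<close>\<close>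
  have est: "has_weak_deriv u (weak_deriv u)" "square_integrable (\<lambda>x. sqrt (U x) * rep_L2 u x)"
      "norm (weak_deriv u) \<le> sqrt K * norm f" "norm (mult_L2 (\<lambda>x. sqrt (U x)) u) \<le> sqrt K * norm f"
      "norm u \<le> K * norm f"
      "norm (mult_L2 (\<lambda>x. 1 - \<psi> x) u) \<le> sqrt (K / L) * norm f"
      "norm (mult_L2 (deriv \<psi>) u) \<le> B * sqrt (K / L) * norm f"
    if U: "U \<in> borel_measurable borel" "\<And>x. U x \<ge> 0" and c: "coercive U K"
      and e: "\<forall>x. \<psi> x \<noteq> 1 \<longrightarrow> L \<le> U x" and sol: "(u, f) \<in> schroedinger_operator U" for U u f
  proof -
    have uD: "u \<in> form_domain U" using sol by (auto simp: schroedinger_operator_def form_operator_def)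
    then show "has_weak_deriv u (weak_deriv u)" "square_integrable (\<lambda>x. sqrt (U x) * rep_L2 u x)"
      using form_domain_iff[OF U] by auto
    note b = schroedinger_solution_bounds[OF U c \<open>K > 0\<close> sol]
    show "norm u \<le> K * norm f" by (rule b)
    have "norm (weak_deriv u) \<le> norm (form_map U u)"
      using norm_fst_le[of "weak_deriv u" "mult_L2 (\<lambda>x. sqrt (U x)) u"] by (simp add: form_map_def)
    then show "norm (weak_deriv u) \<le> sqrt K * norm f" using b(1) by linarith
    have "norm (mult_L2 (\<lambda>x. sqrt (U x)) u) \<le> norm (form_map U u)"
      using norm_snd_le[of "mult_L2 (\<lambda>x. sqrt (U x)) u" "weak_deriv u"] by (simp add: form_map_def)
    then show w: "norm (mult_L2 (\<lambda>x. sqrt (U x)) u) \<le> sqrt K * norm f" using b(1) by linarith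
    have outer: "norm (mult_L2 d u) \<le> R * sqrt (K / L) * norm f"
      if d: "d \<in> borel_measurable borel" "R > 0" "\<And>x. \<bar>d x\<bar> \<le> R" "\<And>x. \<psi> x = 1 \<Longrightarrow> d x = 0" for d R
    proof -
      have pw: "L / R\<^sup>2 * (d x)\<^sup>2 \<le> U x" for x
      proof (cases "\<psi> x = 1")
        case False
        have "(d x)\<^sup>2 \<le> R\<^sup>2" using power_mono[OF d(3)[of x], of 2] by simp
        then have "L / R\<^sup>2 * (d x)\<^sup>2 \<le> L / R\<^sup>2 * R\<^sup>2" using \<open>L > 0\<close> by (intro mult_left_mono) auto
        also have "\<dots> = L" using \<open>R > 0\<close> by simp
        finally show ?thesis using e False by fastforce
      qed (use U d in simp)
      have "(norm (mult_L2 d u))\<^sup>2 \<le> (norm (mult_L2 (\<lambda>x. sqrt (U x)) u))\<^sup>2 / (L / R\<^sup>2)"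
        by (rule norm_exterior_le(2)[OF U(1) d(1) U(2) _ pw uD]) (use \<open>L > 0\<close> \<open>R > 0\<close> in simp)
      also have "\<dots> \<le> (sqrt K * norm f)\<^sup>2 / (L / R\<^sup>2)"
        using w \<open>L > 0\<close> by (intro divide_right_mono power_mono) auto
      also have "\<dots> = (R * sqrt (K / L) * norm f)\<^sup>2"
        using \<open>K > 0\<close> \<open>L > 0\<close> by (simp add: power_mult_distrib)
      finally show ?thesis
        by (rule power2_le_imp_le) (use \<open>K > 0\<close> \<open>L > 0\<close> \<open>R > 0\<close> in simp)
    qed
    show "norm (mult_L2 (\<lambda>x. 1 - \<psi> x) u) \<le> sqrt (K / L) * norm f"
      using outer[of "\<lambda>x. 1 - \<psi> x" 1] \<psi>(2,3) by simp
    show "norm (mult_L2 (deriv \<psi>) u) \<le> B * sqrt (K / L) * norm f"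
      by (rule outer) (use B deriv0 in auto)
  qed
  have main: "\<bar>inner (blinfun_apply (TW - TV) f) g\<bar> \<le> ?E * norm f * norm g" for f g
  proof -
    define u v where "u = blinfun_apply TW f" and "v = blinfun_apply TV g"
    have solu: "(u, f) \<in> schroedinger_operator W" and solv: "(v, g) \<in> schroedinger_operator V"
      using TV TW by (simp_all add: is_op_inverse_iff u_def v_def)
    note eu = est[OF W coercive(2) ext'(2) solu] and ev = est[OF V coercive(1) ext'(1) solv]
    have split: "mult_L2 (\<lambda>x. 1 - \<psi> x) w + mult_L2 \<psi> w = w" for w
    proof (rule L2_eqI)
      have "AE x in lborel. rep_L2 (mult_L2 (\<lambda>x. 1 - \<psi> x) w) x = (1 - \<psi> x) * rep_L2 w x"
        by (rule rep_mult_L2[OF square_integrable_bounded_mult_rep[where B = 1]]) (use \<psi> in auto)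
      moreover have "AE x in lborel. rep_L2 (mult_L2 \<psi> w) x = \<psi> x * rep_L2 w x"
        by (rule rep_mult_L2[OF square_integrable_bounded_mult_rep[where B = 1]]) (use \<psi> in auto)
      ultimately show "AE x in lborel. rep_L2 (mult_L2 (\<lambda>x. 1 - \<psi> x) w + mult_L2 \<psi> w) x = rep_L2 w x"
        using rep_L2_add[of "mult_L2 (\<lambda>x. 1 - \<psi> x) w" "mult_L2 \<psi> w"]
        by eventually_elim (simp add: algebra_simps)
    qed
    have sym: "inner a (mult_L2 \<psi> b) = inner b (mult_L2 \<psi> a)" for a b
    proof -
      have s: "square_integrable (\<lambda>x. \<psi> x * rep_L2 w x)" for w
        by (rule square_integrable_bounded_mult_rep[where B = 1]) (use \<psi> in auto)
      show ?thesis unfolding inner_mult_L2[OF s] by (simp only: mult_ac)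
    qed
    define I where "I U = (\<integral>x. U x * \<psi> x * (rep_L2 u x * rep_L2 v x) \<partial>lborel)" for U
    have A: "inner f (mult_L2 \<psi> v) = inner (weak_deriv u) (mult_L2 (deriv \<psi>) v)
        + inner (weak_deriv u) (mult_L2 \<psi> (weak_deriv v)) + I W"
      unfolding I_def by (rule schroedinger_form_cutoff[OF W \<psi>(1) bounded'(2) ev(1) solu])
    have B': "inner g (mult_L2 \<psi> u) = inner (weak_deriv v) (mult_L2 (deriv \<psi>) u)
        + inner (weak_deriv v) (mult_L2 \<psi> (weak_deriv u)) + I V"
      unfolding I_def using schroedinger_form_cutoff[OF V \<psi>(1) bounded'(1) eu(1) solv] by (simp only: mult_ac)
    have int: "integrable lborel (\<lambda>x. U x * \<psi> x * (rep_L2 u x * rep_L2 v x))"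
      if U[measurable]: "U \<in> borel_measurable borel" and "\<And>x. U x \<ge> 0" "\<forall>x. \<psi> x \<noteq> 0 \<longrightarrow> U x \<le> N" for U
    proof -
      have "square_integrable (\<lambda>x. (U x * \<psi> x) * rep_L2 u x)"
      proof (rule square_integrable_bounded_mult_rep[where B = "\<bar>N\<bar>"])
        show "\<bar>U x * \<psi> x\<bar> \<le> \<bar>N\<bar>" for x
        proof (cases "\<psi> x = 0")
          case False
          then have "U x * \<psi> x \<le> \<bar>N\<bar> * 1" using that(2)[of x] spec[OF that(3), of x] \<psi>(2,3)[of x] by (intro mult_mono) auto
          then show ?thesis using that(2)[of x] \<psi>(2)[of x] by simp
        qed simp
      qed measurable
      from square_integrable_mult[OF this rep_L2_square_integrable[of v]] show ?thesis by (simp only: mult.assoc)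
    qed
    have "I V - I W = (\<integral>x. (V x - W x) * \<psi> x * (rep_L2 u x * rep_L2 v x) \<partial>lborel)"
      unfolding I_def using int[OF V bounded'(1)] int[OF W bounded'(2)]
      by (simp add: left_diff_distrib)
    also have "\<bar>\<dots>\<bar> \<le> \<theta> * (norm (mult_L2 (\<lambda>x. sqrt (W x)) u) * norm (mult_L2 (\<lambda>x. sqrt (V x)) v)) + \<kappa> * (norm u * norm v)"
    proof (rule integral_cross_term_le[OF V(1) W(1) _ V(2) W(2) close(2,3) _ eu(2) ev(2)])
      show "\<bar>(V x - W x) * \<psi> x\<bar> \<le> \<theta> * (sqrt (W x) * sqrt (V x)) + \<kappa>" for x
      proof (cases "\<psi> x = 0")
        case True
        then show ?thesis using close(2,3) V(2)[of x] W(2)[of x] by simp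
      next
        case False
        have "\<bar>(V x - W x) * \<psi> x\<bar> \<le> \<bar>V x - W x\<bar> * 1"
          unfolding abs_mult using \<psi>(2,3)[of x] by (intro mult_left_mono) auto
        also have "\<dots> \<le> \<theta> * (sqrt (W x) * sqrt (V x)) + \<kappa>" using close(1)[OF False] by simp
        finally show ?thesis .
      qed
    qed measurable
    also have "\<dots> \<le> \<theta> * ((sqrt K * norm f) * (sqrt K * norm g)) + \<kappa> * ((K * norm f) * (K * norm g))"
      using close(2,3) eu(4,5) ev(4,5) K0 by (intro add_mono mult_left_mono mult_mono) auto
    also have "\<dots> = (\<theta> * K + \<kappa> * K\<^sup>2) * norm f * norm g"
      using \<open>K > 0\<close> by (simp add: algebra_simps power2_eq_square)
    finally have t3: "\<bar>I V - I W\<bar> \<le> (\<theta> * K + \<kappa> * K\<^sup>2) * norm f * norm g" .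
    have t1: "\<bar>inner g (mult_L2 (\<lambda>x. 1 - \<psi> x) u)\<bar> \<le> sqrt (K / L) * norm f * norm g"
      "\<bar>inner f (mult_L2 (\<lambda>x. 1 - \<psi> x) v)\<bar> \<le> sqrt (K / L) * norm f * norm g"
      using order_trans[OF Cauchy_Schwarz_ineq2 mult_left_mono[OF eu(6)], of g]
        order_trans[OF Cauchy_Schwarz_ineq2 mult_left_mono[OF ev(6)], of f] by (simp_all add: mult_ac)
    have t2: "\<bar>inner (weak_deriv v) (mult_L2 (deriv \<psi>) u)\<bar> \<le> (sqrt K * norm g) * (B * sqrt (K / L) * norm f)"
      "\<bar>inner (weak_deriv u) (mult_L2 (deriv \<psi>) v)\<bar> \<le> (sqrt K * norm f) * (B * sqrt (K / L) * norm g)"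
      by (rule order_trans[OF Cauchy_Schwarz_ineq2], rule mult_mono, rule ev(3), rule eu(7), use K0 in simp, simp,
          rule order_trans[OF Cauchy_Schwarz_ineq2], rule mult_mono, rule eu(3), rule ev(7), use K0 in simp, simp)
    have "inner (blinfun_apply (TW - TV) f) g = inner g u - inner f v"
      using schroedinger_inverse_symmetric[OF V TV, of f g]
      by (simp add: minus_blinfun.rep_eq inner_diff_left inner_diff_right u_def v_def inner_commute)
    also have "\<dots> = inner g (mult_L2 (\<lambda>x. 1 - \<psi> x) u) - inner f (mult_L2 (\<lambda>x. 1 - \<psi> x) v)
       + (inner g (mult_L2 \<psi> u) - inner f (mult_L2 \<psi> v))"
      using arg_cong[OF split[of u], of "inner g"] arg_cong[OF split[of v], of "inner f"]
      by (simp add: inner_add_right)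
    also have "inner g (mult_L2 \<psi> u) - inner f (mult_L2 \<psi> v)
        = inner (weak_deriv v) (mult_L2 (deriv \<psi>) u) - inner (weak_deriv u) (mult_L2 (deriv \<psi>) v) + (I V - I W)"
      unfolding A B' using sym[of "weak_deriv u" "weak_deriv v"] by simp
    finally have "\<bar>inner (blinfun_apply (TW - TV) f) g\<bar> \<le> 2 * (sqrt (K / L) * norm f * norm g)
       + (sqrt K * norm g) * (B * sqrt (K / L) * norm f) + (sqrt K * norm f) * (B * sqrt (K / L) * norm g)
       + (\<theta> * K + \<kappa> * K\<^sup>2) * norm f * norm g"
      using t1 t2 t3 by linarith
    also have "\<dots> = ?E * norm f * norm g" by (simp add: algebra_simps)
    finally show ?thesis .
  qed
  have E0: "?E \<ge> 0" using \<open>K > 0\<close> \<open>L > 0\<close> \<open>B > 0\<close> close(2,3) by simp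
  show ?thesis
  proof (rule norm_blinfun_bound[OF E0])
    fix f
    define y where "y = blinfun_apply (TW - TV) f"
    have "norm y * norm y \<le> (?E * norm f) * norm y"
      using main[of f y] by (simp add: y_def flip: power2_norm_eq_inner power2_eq_square)
    then show "norm (blinfun_apply (TW - TV) f) \<le> ?E * norm f"
      using E0 by (cases "norm y = 0") (auto simp: y_def)
  qed
qed

section \<open>Potentials with the same leading behaviour at their minimum\<close>

text \<open>The quotient \<open>p / (p + q)\<close> is used, where \<open>p\<close> and \<open>q\<close> are squared positive parts that vanish
  exactly for \<open>\<bar>x\<bar> \<ge> \<delta>\<close> and exactly for \<open>\<bar>x\<bar> \<le> \<delta> / 2\<close>, hence never both.\<close>

lemma cutoff_exists:
  assumes "\<delta> > 0"
  obtains \<psi> B where "test_function \<psi>" "\<And>x. 0 \<le> \<psi> x" "\<And>x. \<psi> x \<le> 1"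
    "\<And>x. \<bar>x\<bar> \<le> \<delta> / 2 \<Longrightarrow> \<psi> x = 1" "\<And>x. \<bar>x\<bar> \<ge> \<delta> \<Longrightarrow> \<psi> x = 0" "\<And>x. \<bar>deriv \<psi> x\<bar> \<le> B" "B > 0"
proof -
  define p where "p x = (max 0 (\<delta>\<^sup>2 - x\<^sup>2))\<^sup>2" for x :: real
  define p' where "p' x = 2 * max 0 (\<delta>\<^sup>2 - x\<^sup>2) * (- 2 * x)" for x :: real
  define q where "q x = (max 0 (x\<^sup>2 - (\<delta> / 2)\<^sup>2))\<^sup>2" for x :: real
  define q' where "q' x = 2 * max 0 (x\<^sup>2 - (\<delta> / 2)\<^sup>2) * (2 * x)" for x :: real
  have dp: "(p has_real_derivative p' x) (at x)" for x
    unfolding p_def p'_def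
    by (rule has_real_derivative_pos_part_squared_compose[where g = "\<lambda>x. \<delta>\<^sup>2 - x\<^sup>2"])
      (auto intro!: derivative_eq_intros)
  have dq: "(q has_real_derivative q' x) (at x)" for x
    unfolding q_def q'_def
    by (rule has_real_derivative_pos_part_squared_compose[where g = "\<lambda>x. x\<^sup>2 - (\<delta> / 2)\<^sup>2"])
      (auto intro!: derivative_eq_intros)
  have c: "continuous_on UNIV p" "continuous_on UNIV p'" "continuous_on UNIV q" "continuous_on UNIV q'"
    unfolding p_def p'_def q_def q'_def by (intro continuous_intros)+
  have p0: "p x \<ge> 0" and q0: "q x \<ge> 0" for x by (simp_all add: p_def q_def)
  have pos: "p x + q x > 0" for x
  proof (cases "\<bar>x\<bar> < \<delta>")
    case True
    then have "x\<^sup>2 < \<delta>\<^sup>2" using abs_le_square_iff[of \<delta> x] assms by simp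
    then have "p x > 0" by (simp add: p_def)
    then show ?thesis using q0[of x] by simp
  next
    case False
    then have "(\<delta> / 2)\<^sup>2 < x\<^sup>2" using abs_le_square_iff[of x "\<delta> / 2"] assms by linarith
    then have "q x > 0" by (simp add: q_def)
    then show ?thesis using p0[of x] by simp
  qed
  define \<psi> where "\<psi> x = p x / (p x + q x)" for x
  have d\<psi>: "(\<psi> has_real_derivative (p' x * (p x + q x) - p x * (p' x + q' x)) / ((p x + q x) * (p x + q x))) (at x)" for x
    unfolding \<psi>_def using pos[of x] by (intro DERIV_divide DERIV_add dp dq) simp
  have cp: "continuous_on UNIV (\<lambda>x. (p' x * (p x + q x) - p x * (p' x + q' x)) / ((p x + q x) * (p x + q x)))"
    using pos by (intro continuous_intros c ballI) (simp add: less_imp_neq[THEN not_sym])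
  have z: "\<psi> x = 0" if "\<bar>x\<bar> \<ge> \<delta>" for x
  proof -
    have "\<delta>\<^sup>2 \<le> x\<^sup>2" using that assms abs_le_square_iff[of \<delta> x] by simp
    then show ?thesis by (simp add: \<psi>_def p_def)
  qed
  have t: "test_function \<psi>"
    by (rule test_functionI(1)[OF d\<psi> cp, of "-\<delta>" \<delta>]) (use z in auto)
  obtain B where "B \<ge> 0" and B: "\<And>x. \<bar>deriv \<psi> x\<bar> \<le> B" using test_function_regularity(4)[OF t] by blast
  show thesis
  proof (rule that[of \<psi> "B + 1"])
    show "0 \<le> \<psi> x" "\<psi> x \<le> 1" for x
      using p0[of x] q0[of x] pos[of x] by (simp_all add: \<psi>_def divide_le_eq)
    show "\<psi> x = 1" if "\<bar>x\<bar> \<le> \<delta> / 2" for x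
    proof -
      have "x\<^sup>2 \<le> (\<delta> / 2)\<^sup>2" using that abs_le_square_iff[of x "\<delta> / 2"] by simp
      then have "q x = 0" by (simp add: q_def)
      then show ?thesis using pos[of x] by (simp add: \<psi>_def)
    qed
    show "\<bar>deriv \<psi> x\<bar> \<le> B + 1" for x using B[of x] by simp
  qed (use t z \<open>B \<ge> 0\<close> in auto)
qed

text \<open>With \<open>r = \<epsilon>\<^sup>\<alpha>\<close> the lower bounds give coercivity with constant \<open>K = \<kappa>\<^sub>0 \<epsilon>\<^sup>2\<^sup>\<alpha>\<close>, because
  \<open>\<alpha> m - 2 = - 2 \<alpha>\<close>. Outside a fixed distance \<open>\<delta> / 2\<close> the potentials exceed \<open>l / \<epsilon>\<^sup>2\<close>. After
  division by \<open>\<epsilon>\<^sup>2\<^sup>\<alpha>\<close> the four terms of \<open>schroedinger_inverse_diff_le\<close> are of order \<open>\<epsilon>\<^sup>1\<^sup>-\<^sup>\<alpha>\<close>, \<open>\<epsilon>\<close>,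
  \<open>\<delta>\<close> and \<open>\<epsilon>\<^sup>2\<^sup>\<alpha>\<close>.\<close>

theorem scaled_inverses_converge:
  fixes A Q R :: "real \<Rightarrow> real" and m \<alpha> c0 c1 k1 k2 \<delta>0 :: real
  assumes meas: "A \<in> borel_measurable borel" "Q \<in> borel_measurable borel" "R \<in> borel_measurable borel"
    and nonneg: "\<And>x. A x \<ge> 0" "\<And>x. Q x \<ge> 0" "\<And>x. R x \<ge> 0"
    and "m > 0" and \<alpha>: "\<alpha> = 2 / (m + 2)" and "\<delta>0 > 0" "c0 > 0" "k1 \<ge> 0" "k2 \<ge> 0"
    and AQ: "\<And>x. \<bar>x\<bar> < \<delta>0 \<Longrightarrow> \<bar>A x - Q x\<bar> \<le> k1 * \<bar>x\<bar> powr (m + 1)"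
    and R: "\<And>x. \<bar>x\<bar> < \<delta>0 \<Longrightarrow> R x \<le> k2"
    and A_low: "\<And>r x. 0 < r \<Longrightarrow> r < \<delta>0 \<Longrightarrow> r \<le> \<bar>x\<bar> \<Longrightarrow> c0 * r powr m \<le> A x"
    and Q_low: "\<And>x. c0 * \<bar>x\<bar> powr m \<le> Q x" and Q_up: "\<And>x. Q x \<le> c1 * \<bar>x\<bar> powr m"
  defines "V \<equiv> \<lambda>\<epsilon> x. Q x / \<epsilon>\<^sup>2" and "W \<equiv> \<lambda>\<epsilon> x. A x / \<epsilon>\<^sup>2 + R x"
  shows "\<And>\<epsilon>. \<epsilon> > 0 \<Longrightarrow> boundedly_invertible (op_scale (\<epsilon> powr (2 * \<alpha>)) (schroedinger_operator (V \<epsilon>)))"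
    and "\<And>\<epsilon>. \<epsilon> > 0 \<Longrightarrow> boundedly_invertible (op_scale (\<epsilon> powr (2 * \<alpha>)) (schroedinger_operator (W \<epsilon>)))"
    and "((\<lambda>\<epsilon>. norm (op_inverse (op_scale (\<epsilon> powr (2 * \<alpha>)) (schroedinger_operator (W \<epsilon>)))
           - op_inverse (op_scale (\<epsilon> powr (2 * \<alpha>)) (schroedinger_operator (V \<epsilon>))))) \<longlongrightarrow> 0) (at_right 0)"
proof -
  have \<alpha>01: "0 < \<alpha>" "\<alpha> < 1" "\<alpha> * m - 2 = - (2 * \<alpha>)"
    using \<open>m > 0\<close> by (simp_all add: \<alpha> field_simps)
  have VW: "V \<epsilon> \<in> borel_measurable borel" "W \<epsilon> \<in> borel_measurable borel" "V \<epsilon> x \<ge> 0" "W \<epsilon> x \<ge> 0" for \<epsilon> x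
    unfolding V_def W_def using meas nonneg by (auto intro!: borel_measurable_add borel_measurable_divide)
  have low: "c0 * r powr m / \<epsilon>\<^sup>2 \<le> V \<epsilon> x" "c0 * r powr m / \<epsilon>\<^sup>2 \<le> W \<epsilon> x"
    if "0 < r" "r < \<delta>0" "r \<le> \<bar>x\<bar>" for r x \<epsilon>
  proof -
    have "c0 * r powr m \<le> c0 * \<bar>x\<bar> powr m"
      using that \<open>c0 > 0\<close> \<open>m > 0\<close> by (intro mult_left_mono powr_mono2) auto
    then have "c0 * r powr m \<le> Q x" using Q_low[of x] by (rule order_trans)
    then show "c0 * r powr m / \<epsilon>\<^sup>2 \<le> V \<epsilon> x" unfolding V_def by (rule divide_right_mono) simp
    have "c0 * r powr m / \<epsilon>\<^sup>2 \<le> A x / \<epsilon>\<^sup>2" by (rule divide_right_mono[OF A_low[OF that]]) simp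
    then show "c0 * r powr m / \<epsilon>\<^sup>2 \<le> W \<epsilon> x" unfolding W_def using nonneg(3)[of x] by simp
  qed
  have coerc: "coercive (V \<epsilon>) K" "coercive (W \<epsilon>) K"
    if "\<epsilon> > 0" "0 < r" "r < \<delta>0" "18 * r\<^sup>2 \<le> K" "3 / (c0 * r powr m / \<epsilon>\<^sup>2) \<le> K" for \<epsilon> r K
  proof -
    have L: "c0 * r powr m / \<epsilon>\<^sup>2 > 0" using that \<open>c0 > 0\<close> by simp
    show "coercive (V \<epsilon>) K"
      by (rule coerciveI[OF VW(1) VW(3) that(2) L _ that(4,5)]) (rule low(1)[OF that(2,3)])
    show "coercive (W \<epsilon>) K"
      by (rule coerciveI[OF VW(2) VW(4) that(2) L _ that(4,5)]) (rule low(2)[OF that(2,3)])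
  qed
  have inv: "\<exists>T. is_op_inverse T (schroedinger_operator (V \<epsilon>))" "\<exists>T. is_op_inverse T (schroedinger_operator (W \<epsilon>))"
    if "\<epsilon> > 0" for \<epsilon>
  proof -
    \<comment> \<open>any fixed radius below \<open>\<delta>0\<close> gives invertibility\<close>
    define K where "K = max (18 * (\<delta>0 / 2)\<^sup>2) (3 / (c0 * (\<delta>0 / 2) powr m / \<epsilon>\<^sup>2))"
    have "18 * (\<delta>0 / 2)\<^sup>2 > 0" using \<open>\<delta>0 > 0\<close> by simp
    then have "K > 0" unfolding K_def by (intro less_max_iff_disj[THEN iffD2] disjI1)
    have c: "coercive (V \<epsilon>) K" "coercive (W \<epsilon>) K"
      using coerc[OF that, of "\<delta>0 / 2" K] \<open>\<delta>0 > 0\<close> by (simp_all add: K_def)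
    show "\<exists>T. is_op_inverse T (schroedinger_operator (V \<epsilon>))"
      using schroedinger_operator_boundedly_invertible[OF VW(1,3) c(1) \<open>K > 0\<close>] by (simp add: boundedly_invertible_def)
    show "\<exists>T. is_op_inverse T (schroedinger_operator (W \<epsilon>))"
      using schroedinger_operator_boundedly_invertible[OF VW(2,4) c(2) \<open>K > 0\<close>] by (simp add: boundedly_invertible_def)
  qed
  show "boundedly_invertible (op_scale (\<epsilon> powr (2 * \<alpha>)) (schroedinger_operator (V \<epsilon>)))"
    "boundedly_invertible (op_scale (\<epsilon> powr (2 * \<alpha>)) (schroedinger_operator (W \<epsilon>)))" if "\<epsilon> > 0" for \<epsilon>
    using inv[OF that] is_op_inverse_op_scale[of _ _ "\<epsilon> powr (2 * \<alpha>)"] that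
    unfolding boundedly_invertible_def by (metis powr_gt_zero less_irrefl)+
  define \<kappa>0 where "\<kappa>0 = max 18 (3 / c0)"
  have "\<kappa>0 \<ge> 18" "\<kappa>0 \<ge> 3 / c0" by (simp_all add: \<kappa>0_def)
  then have "\<kappa>0 > 0" by simp
  define nrm where "nrm \<epsilon> = norm (op_inverse (op_scale (\<epsilon> powr (2 * \<alpha>)) (schroedinger_operator (W \<epsilon>)))
           - op_inverse (op_scale (\<epsilon> powr (2 * \<alpha>)) (schroedinger_operator (V \<epsilon>))))" for \<epsilon>
  have bound: "\<exists>a b. \<forall>\<epsilon>>0. \<epsilon> powr \<alpha> < \<delta>0 \<longrightarrow>
      nrm \<epsilon> \<le> a * \<epsilon> powr (1 - \<alpha>) + b * \<epsilon> + k1 * \<delta> / c0 * \<kappa>0 + k2 * \<kappa>0\<^sup>2 * \<epsilon> powr (2 * \<alpha>)"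
    if \<delta>: "0 < \<delta>" "\<delta> < \<delta>0" for \<delta>
  proof -
    obtain \<psi> B where \<psi>: "test_function \<psi>" "\<And>x. 0 \<le> \<psi> x" "\<And>x. \<psi> x \<le> 1"
      and \<psi>1: "\<And>x. \<bar>x\<bar> \<le> \<delta> / 2 \<Longrightarrow> \<psi> x = 1" and \<psi>0: "\<And>x. \<bar>x\<bar> \<ge> \<delta> \<Longrightarrow> \<psi> x = 0"
      and B: "\<And>x. \<bar>deriv \<psi> x\<bar> \<le> B" "B > 0"
      using cutoff_exists[OF \<delta>(1)] by metis
    define l where "l = c0 * (\<delta> / 2) powr m"
    have "l > 0" using \<open>c0 > 0\<close> \<delta> by (simp add: l_def)
    have "nrm \<epsilon> \<le> 2 * sqrt (\<kappa>0 / l) * \<epsilon> powr (1 - \<alpha>) + 2 * B * sqrt (\<kappa>0 / l) * sqrt \<kappa>0 * \<epsilon>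
        + k1 * \<delta> / c0 * \<kappa>0 + k2 * \<kappa>0\<^sup>2 * \<epsilon> powr (2 * \<alpha>)"
      if \<epsilon>: "\<epsilon> > 0" "\<epsilon> powr \<alpha> < \<delta>0" for \<epsilon>
    proof -
      define s where "s = \<epsilon> powr (2 * \<alpha>)"
      define K where "K = \<kappa>0 * s"
      have "s > 0" using \<epsilon> by (simp add: s_def)
      then have "K > 0" using \<open>\<kappa>0 > 0\<close> by (simp add: K_def)
      have rs: "(\<epsilon> powr \<alpha>)\<^sup>2 = s" using \<epsilon> by (simp add: s_def powr_power mult.commute)
      have "c0 * (\<epsilon> powr \<alpha>) powr m / \<epsilon>\<^sup>2 = c0 * \<epsilon> powr (\<alpha> * m - 2)"
        using \<epsilon> by (simp add: powr_powr powr_diff)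
      also have "\<dots> = c0 / s" unfolding \<alpha>01(3) s_def by (simp add: powr_minus_divide)
      finally have L: "c0 * (\<epsilon> powr \<alpha>) powr m / \<epsilon>\<^sup>2 = c0 / s" .
      have "18 * (\<epsilon> powr \<alpha>)\<^sup>2 \<le> K"
        unfolding rs K_def using \<open>\<kappa>0 \<ge> 18\<close> \<open>s > 0\<close> by (intro mult_right_mono) auto
      moreover have "3 / (c0 * (\<epsilon> powr \<alpha>) powr m / \<epsilon>\<^sup>2) \<le> K"
        unfolding L K_def using mult_right_mono[OF \<open>\<kappa>0 \<ge> 3 / c0\<close>, of s] \<open>s > 0\<close> by simp
      ultimately have cV: "coercive (V \<epsilon>) K" and cW: "coercive (W \<epsilon>) K"
        using coerc[OF \<epsilon>(1) _ \<epsilon>(2)] \<epsilon>(1) by simp_all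
      obtain TV TW where TV: "is_op_inverse TV (schroedinger_operator (V \<epsilon>))"
        and TW: "is_op_inverse TW (schroedinger_operator (W \<epsilon>))"
        using inv[OF \<epsilon>(1)] by blast
      have nonzero: "\<psi> x \<noteq> 0 \<Longrightarrow> \<bar>x\<bar> < \<delta>" for x using \<psi>0[of x] by linarith
      have n1: "norm (TW - TV) \<le> 2 * sqrt (K / (l / \<epsilon>\<^sup>2)) + 2 * B * sqrt (K / (l / \<epsilon>\<^sup>2)) * sqrt K
          + k1 * \<delta> / c0 * K + k2 * K\<^sup>2"
      proof (rule schroedinger_inverse_diff_le[OF VW(1,3) VW(2,4) cV cW \<open>K > 0\<close> TV TW \<psi> B,
            where N = "(\<bar>c1\<bar> * \<delta> powr m + k1 * \<delta> powr (m + 1)) / \<epsilon>\<^sup>2 + k2"])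
        show "l / \<epsilon>\<^sup>2 \<le> V \<epsilon> x" "l / \<epsilon>\<^sup>2 \<le> W \<epsilon> x" if "\<psi> x \<noteq> 1" for x
        proof -
          have "\<not> \<bar>x\<bar> \<le> \<delta> / 2" using \<psi>1[of x] that by blast
          then have "\<delta> / 2 \<le> \<bar>x\<bar>" by simp
          then show "l / \<epsilon>\<^sup>2 \<le> V \<epsilon> x" "l / \<epsilon>\<^sup>2 \<le> W \<epsilon> x"
            unfolding l_def using low[of "\<delta> / 2" x \<epsilon>] \<delta> by simp_all
        qed
        show "l / \<epsilon>\<^sup>2 > 0" using \<open>l > 0\<close> \<epsilon> by simp
        have Qb: "Q x \<le> \<bar>c1\<bar> * \<delta> powr m" and Ab: "A x \<le> \<bar>c1\<bar> * \<delta> powr m + k1 * \<delta> powr (m + 1)"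
          if "\<bar>x\<bar> < \<delta>" for x
        proof -
          have "\<bar>x\<bar> powr m \<le> \<delta> powr m" "\<bar>x\<bar> powr (m + 1) \<le> \<delta> powr (m + 1)"
            using that \<open>m > 0\<close> by (auto intro!: powr_mono2)
          then have "\<bar>c1\<bar> * \<bar>x\<bar> powr m \<le> \<bar>c1\<bar> * \<delta> powr m" "k1 * \<bar>x\<bar> powr (m + 1) \<le> k1 * \<delta> powr (m + 1)"
            using \<open>k1 \<ge> 0\<close> by (auto intro!: mult_left_mono)
          moreover have "c1 * \<bar>x\<bar> powr m \<le> \<bar>c1\<bar> * \<bar>x\<bar> powr m" by (rule mult_right_mono) auto
          ultimately show "Q x \<le> \<bar>c1\<bar> * \<delta> powr m" "A x \<le> \<bar>c1\<bar> * \<delta> powr m + k1 * \<delta> powr (m + 1)"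
            using Q_up[of x] AQ[of x] that \<delta> by linarith+
        qed
        show "V \<epsilon> x \<le> (\<bar>c1\<bar> * \<delta> powr m + k1 * \<delta> powr (m + 1)) / \<epsilon>\<^sup>2 + k2" if "\<psi> x \<noteq> 0" for x
        proof -
          have "k1 * \<delta> powr (m + 1) \<ge> 0" using \<open>k1 \<ge> 0\<close> by simp
          then have "Q x \<le> \<bar>c1\<bar> * \<delta> powr m + k1 * \<delta> powr (m + 1)" using Qb[OF nonzero[OF that]] by linarith
          then have "V \<epsilon> x \<le> (\<bar>c1\<bar> * \<delta> powr m + k1 * \<delta> powr (m + 1)) / \<epsilon>\<^sup>2"
            unfolding V_def by (rule divide_right_mono) simp
          then show ?thesis using \<open>k2 \<ge> 0\<close> by linarith
        qed
        show "W \<epsilon> x \<le> (\<bar>c1\<bar> * \<delta> powr m + k1 * \<delta> powr (m + 1)) / \<epsilon>\<^sup>2 + k2" if "\<psi> x \<noteq> 0" for x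
          unfolding W_def using Ab[OF nonzero[OF that]] R[of x] nonzero[OF that] \<delta>
          by (intro add_mono divide_right_mono) auto
        show "\<bar>V \<epsilon> x - W \<epsilon> x\<bar> \<le> k1 * \<delta> / c0 * (sqrt (W \<epsilon> x) * sqrt (V \<epsilon> x)) + k2" if "\<psi> x \<noteq> 0" for x
        proof -
          have x: "\<bar>x\<bar> < \<delta>" "\<bar>x\<bar> < \<delta>0" using nonzero[OF that] \<delta> by auto
          have cx: "c0 * \<bar>x\<bar> powr m \<le> A x"
            using A_low[of "\<bar>x\<bar>" x] x nonneg(1)[of x] by (cases "x = 0") auto
          have "c0 * \<bar>x\<bar> powr m / \<epsilon>\<^sup>2 \<le> W \<epsilon> x" "c0 * \<bar>x\<bar> powr m / \<epsilon>\<^sup>2 \<le> V \<epsilon> x"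
            using divide_right_mono[OF cx, of "\<epsilon>\<^sup>2"] divide_right_mono[OF Q_low[of x], of "\<epsilon>\<^sup>2"] nonneg(3)[of x]
            unfolding V_def W_def by auto
          then have "sqrt (c0 * \<bar>x\<bar> powr m / \<epsilon>\<^sup>2) * sqrt (c0 * \<bar>x\<bar> powr m / \<epsilon>\<^sup>2) \<le> sqrt (W \<epsilon> x) * sqrt (V \<epsilon> x)"
            using \<open>c0 > 0\<close> VW(3,4) by (intro mult_mono real_sqrt_le_mono) auto
          then have "c0 * \<bar>x\<bar> powr m / \<epsilon>\<^sup>2 \<le> sqrt (W \<epsilon> x) * sqrt (V \<epsilon> x)" using \<open>c0 > 0\<close> by simp
          then have "k1 * \<delta> / c0 * (c0 * \<bar>x\<bar> powr m / \<epsilon>\<^sup>2) \<le> k1 * \<delta> / c0 * (sqrt (W \<epsilon> x) * sqrt (V \<epsilon> x))"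
            using \<open>k1 \<ge> 0\<close> \<open>c0 > 0\<close> \<delta> by (intro mult_left_mono) auto
          moreover have "k1 * \<delta> / c0 * (c0 * \<bar>x\<bar> powr m / \<epsilon>\<^sup>2) = k1 * (\<delta> * \<bar>x\<bar> powr m) / \<epsilon>\<^sup>2"
            using \<open>c0 > 0\<close> by simp
          moreover have "\<bar>A x - Q x\<bar> / \<epsilon>\<^sup>2 \<le> k1 * (\<delta> * \<bar>x\<bar> powr m) / \<epsilon>\<^sup>2"
          proof (rule divide_right_mono)
            have "\<bar>x\<bar> powr (m + 1) = \<bar>x\<bar> * \<bar>x\<bar> powr m" by (cases "x = 0") (simp_all add: powr_add)
            also have "\<dots> \<le> \<delta> * \<bar>x\<bar> powr m" using x by (intro mult_right_mono) auto
            finally have "k1 * \<bar>x\<bar> powr (m + 1) \<le> k1 * (\<delta> * \<bar>x\<bar> powr m)" using \<open>k1 \<ge> 0\<close> by (rule mult_left_mono)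
            then show "\<bar>A x - Q x\<bar> \<le> k1 * (\<delta> * \<bar>x\<bar> powr m)" using AQ[OF x(2)] by linarith
          qed simp
          moreover have "\<bar>V \<epsilon> x - W \<epsilon> x\<bar> \<le> \<bar>A x - Q x\<bar> / \<epsilon>\<^sup>2 + R x"
          proof -
            have "V \<epsilon> x - W \<epsilon> x = (Q x - A x) / \<epsilon>\<^sup>2 - R x" by (simp add: V_def W_def diff_divide_distrib)
            then show ?thesis
              using abs_triangle_ineq4[of "(Q x - A x) / \<epsilon>\<^sup>2" "R x"] nonneg(3)[of x]
              by (simp add: abs_divide abs_minus_commute)
          qed
          ultimately show ?thesis using R[OF x(2)] by linarith
        qed
      qed (use \<open>k1 \<ge> 0\<close> \<open>k2 \<ge> 0\<close> \<open>c0 > 0\<close> \<delta> in auto)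
      have n2: "nrm \<epsilon> = norm (TW - TV) / s"
      proof -
        have "s \<noteq> 0" using \<open>s > 0\<close> by simp
        note eq = op_inverse_eqI[OF is_op_inverse_op_scale[OF TW \<open>s \<noteq> 0\<close>]]
          op_inverse_eqI[OF is_op_inverse_op_scale[OF TV \<open>s \<noteq> 0\<close>]]
        show ?thesis
          unfolding nrm_def s_def[symmetric] eq scaleR_diff_right[symmetric] norm_scaleR
          using \<open>s > 0\<close> by simp
      qed
      have e1: "sqrt (K / (l / \<epsilon>\<^sup>2)) = s * (sqrt (\<kappa>0 / l) * \<epsilon> powr (1 - \<alpha>))"
      proof -
        have "sqrt (K / (l / \<epsilon>\<^sup>2)) = sqrt (\<kappa>0 / l) * (sqrt s * \<epsilon>)"
          using \<epsilon> by (simp add: K_def real_sqrt_mult real_sqrt_divide)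
        also have "sqrt s = \<epsilon> powr \<alpha>" unfolding rs[symmetric] by simp
        also have "\<epsilon> powr \<alpha> * \<epsilon> = s * \<epsilon> powr (1 - \<alpha>)"
          using \<epsilon> by (simp add: s_def powr_mult_base mult.commute[of "\<epsilon> powr \<alpha>"] add.commute[of 1] flip: powr_add)
        finally show ?thesis by simp
      qed
      have e2: "sqrt (K / (l / \<epsilon>\<^sup>2)) * sqrt K = s * (sqrt (\<kappa>0 / l) * sqrt \<kappa>0 * \<epsilon>)"
      proof -
        have 1: "sqrt (K / (l / \<epsilon>\<^sup>2)) = sqrt (\<kappa>0 / l) * (sqrt s * \<epsilon>)"
          using \<epsilon> by (simp add: K_def real_sqrt_mult real_sqrt_divide)
        have 2: "sqrt K = sqrt \<kappa>0 * sqrt s" by (simp add: K_def real_sqrt_mult)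
        have "sqrt (K / (l / \<epsilon>\<^sup>2)) * sqrt K = sqrt (\<kappa>0 / l) * sqrt \<kappa>0 * (sqrt s * sqrt s) * \<epsilon>"
          unfolding 1 2 by (simp only: mult_ac)
        then show ?thesis using \<open>s > 0\<close> by simp
      qed
      have e3: "k1 * \<delta> / c0 * K = s * (k1 * \<delta> / c0 * \<kappa>0)" "k2 * K\<^sup>2 = s * (k2 * \<kappa>0\<^sup>2 * s)"
        by (simp_all add: K_def power2_eq_square)
      have "norm (TW - TV) \<le> 2 * sqrt (K / (l / \<epsilon>\<^sup>2)) + 2 * B * (sqrt (K / (l / \<epsilon>\<^sup>2)) * sqrt K)
          + k1 * \<delta> / c0 * K + k2 * K\<^sup>2"
        using n1 by (simp only: mult.assoc)
      also have "\<dots> = s * (2 * sqrt (\<kappa>0 / l) * \<epsilon> powr (1 - \<alpha>) + 2 * B * sqrt (\<kappa>0 / l) * sqrt \<kappa>0 * \<epsilon>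
        + k1 * \<delta> / c0 * \<kappa>0 + k2 * \<kappa>0\<^sup>2 * s)"
        unfolding e2 e3 unfolding e1 by (simp only: distrib_left mult_ac)
      finally show ?thesis
        using \<open>s > 0\<close> unfolding n2 s_def[symmetric] by (simp add: pos_divide_le_eq mult.commute[of _ s])
    qed
    then show ?thesis by blast
  qed
  have "(nrm \<longlongrightarrow> 0) (at_right 0)"
  proof (rule tendstoI)
    fix e :: real assume "e > 0"
    \<comment> \<open>makes the contribution of order \<open>\<delta>\<close> at most \<open>e / 2\<close>; adding 1 to \<open>k1\<close> covers \<open>k1 = 0\<close>\<close>
    define \<delta> where "\<delta> = min (\<delta>0 / 2) (e * c0 / (2 * (k1 + 1) * \<kappa>0))"
    have \<delta>: "0 < \<delta>" "\<delta> < \<delta>0"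
      using \<open>\<delta>0 > 0\<close> \<open>e > 0\<close> \<open>c0 > 0\<close> \<open>k1 \<ge> 0\<close> \<open>\<kappa>0 > 0\<close> by (auto simp: \<delta>_def)
    have small: "k1 * \<delta> / c0 * \<kappa>0 \<le> e / 2"
    proof -
      have "k1 * \<delta> \<le> (k1 + 1) * (e * c0 / (2 * (k1 + 1) * \<kappa>0))"
        using \<open>k1 \<ge> 0\<close> \<delta> by (intro mult_mono) (auto simp: \<delta>_def)
      also have "\<dots> = e * c0 / (2 * \<kappa>0)"
      proof -
        have cancel: "t * (e * c0 / (2 * t * \<kappa>0)) = e * c0 / (2 * \<kappa>0)" if "t > 0" for t
          using that by simp
        show ?thesis by (rule cancel) (use \<open>k1 \<ge> 0\<close> in simp)
      qed
      finally show ?thesis using \<open>c0 > 0\<close> \<open>\<kappa>0 > 0\<close> by (simp add: field_simps)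
    qed
    obtain a b where ab: "\<And>\<epsilon>. \<epsilon> > 0 \<Longrightarrow> \<epsilon> powr \<alpha> < \<delta>0 \<Longrightarrow>
        nrm \<epsilon> \<le> a * \<epsilon> powr (1 - \<alpha>) + b * \<epsilon> + k1 * \<delta> / c0 * \<kappa>0 + k2 * \<kappa>0\<^sup>2 * \<epsilon> powr (2 * \<alpha>)"
      using bound[OF \<delta>] by blast
    have powr0: "((\<lambda>\<epsilon>::real. \<epsilon> powr p) \<longlongrightarrow> 0) (at_right 0)" if "p > 0" for p
      by (rule tendsto_zero_powrI[OF _ tendsto_const]) (use that in \<open>auto simp: eventually_at_filter intro: always_eventually\<close>)
    have "((\<lambda>\<epsilon>. a * \<epsilon> powr (1 - \<alpha>) + b * \<epsilon> + k2 * \<kappa>0\<^sup>2 * \<epsilon> powr (2 * \<alpha>)) \<longlongrightarrow> a * 0 + b * 0 + k2 * \<kappa>0\<^sup>2 * 0) (at_right 0)"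
      by (intro tendsto_intros powr0) (use \<alpha>01 in auto)
    then have "\<forall>\<^sub>F \<epsilon> in at_right 0. a * \<epsilon> powr (1 - \<alpha>) + b * \<epsilon> + k2 * \<kappa>0\<^sup>2 * \<epsilon> powr (2 * \<alpha>) < e / 2"
      using \<open>e > 0\<close> by (intro order_tendstoD(2)) auto
    moreover have "\<forall>\<^sub>F \<epsilon> in at_right 0. \<epsilon> powr \<alpha> < \<delta>0"
      using order_tendstoD(2)[OF powr0[OF \<alpha>01(1)] \<open>\<delta>0 > 0\<close>] .
    moreover have "\<forall>\<^sub>F \<epsilon> in at_right 0. \<epsilon> > (0::real)" by (rule eventually_at_right_less)
    ultimately show "\<forall>\<^sub>F \<epsilon> in at_right 0. dist (nrm \<epsilon>) 0 < e"
    proof eventually_elim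
      case (elim \<epsilon>)
      have "nrm \<epsilon> < e" using ab[OF elim(3,2)] elim(1) small by linarith
      moreover have "nrm \<epsilon> \<ge> 0" by (simp add: nrm_def)
      ultimately show ?case by simp
    qed
  qed
  then show "((\<lambda>\<epsilon>. norm (op_inverse (op_scale (\<epsilon> powr (2 * \<alpha>)) (schroedinger_operator (W \<epsilon>)))
           - op_inverse (op_scale (\<epsilon> powr (2 * \<alpha>)) (schroedinger_operator (V \<epsilon>))))) \<longlongrightarrow> 0) (at_right 0)"
    by (simp only: nrm_def[abs_def])
qed

section \<open>The potential of the profile\<close>

lemma expansion_at_0_bounds:
  assumes "expansion_at_0 h M cp cm m"
  obtains d C B where "0 < d" "d \<le> 1" "C > 0"
    "\<And>x. 0 < \<bar>x\<bar> \<Longrightarrow> \<bar>x\<bar> < d \<Longrightarrow>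
      \<bar>h x - (M - (if x > 0 then cp else cm) * \<bar>x\<bar> powr m)\<bar> \<le> C * \<bar>x\<bar> powr (m + 1)"
    "\<And>x. 0 < \<bar>x\<bar> \<Longrightarrow> \<bar>x\<bar> < d \<Longrightarrow> \<bar>deriv h x\<bar> \<le> B"
proof -
  from assms have r: "(\<lambda>x. h x - (M - cp * x powr m)) \<in> O[at_right 0](\<lambda>x. x powr (m + 1))"
    and l: "(\<lambda>x. h x - (M - cm * \<bar>x\<bar> powr m)) \<in> O[at_left 0](\<lambda>x. \<bar>x\<bar> powr (m + 1))"
    and d: "deriv h \<in> O[at 0](\<lambda>_. 1)"
    unfolding expansion_at_0_def by auto
  obtain C1 where C1: "C1 > 0" "\<forall>\<^sub>F x in at_right 0. norm (h x - (M - cp * x powr m)) \<le> C1 * norm (x powr (m + 1))"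
    using r by (rule landau_o.bigE)
  obtain C2 where C2: "C2 > 0" "\<forall>\<^sub>F x in at_left 0. norm (h x - (M - cm * \<bar>x\<bar> powr m)) \<le> C2 * norm (\<bar>x\<bar> powr (m + 1))"
    using l by (rule landau_o.bigE)
  obtain B where B: "B > 0" "\<forall>\<^sub>F x in at 0. norm (deriv h x) \<le> B * norm (1::real)"
    using d by (rule landau_o.bigE)
  obtain d1 where d1: "d1 > 0" "\<And>x. 0 < x \<Longrightarrow> x < d1 \<Longrightarrow> \<bar>h x - (M - cp * x powr m)\<bar> \<le> C1 * x powr (m + 1)"
    using C1(2) unfolding eventually_at_right_field by auto
  obtain d2 where d2: "d2 < 0" "\<And>x. d2 < x \<Longrightarrow> x < 0 \<Longrightarrow> \<bar>h x - (M - cm * \<bar>x\<bar> powr m)\<bar> \<le> C2 * \<bar>x\<bar> powr (m + 1)"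
    using C2(2) unfolding eventually_at_left_field by auto
  obtain d3 where d3: "d3 > 0" "\<And>x. x \<noteq> 0 \<Longrightarrow> \<bar>x\<bar> < d3 \<Longrightarrow> \<bar>deriv h x\<bar> \<le> B"
    using B(2) unfolding eventually_at by (auto simp: dist_real_def)
  show thesis
  proof (rule that[of "Min {d1, - d2, d3, 1}" "max C1 C2" B])
    fix x :: real assume x: "0 < \<bar>x\<bar>" "\<bar>x\<bar> < Min {d1, - d2, d3, 1}"
    show "\<bar>h x - (M - (if x > 0 then cp else cm) * \<bar>x\<bar> powr m)\<bar> \<le> max C1 C2 * \<bar>x\<bar> powr (m + 1)"
    proof (cases "x > 0")
      case True
      have "\<bar>h x - (M - cp * x powr m)\<bar> \<le> C1 * x powr (m + 1)" using d1(2)[of x] x True by simp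
      also have "\<dots> \<le> max C1 C2 * x powr (m + 1)" by (intro mult_right_mono) auto
      finally show ?thesis using True by simp
    next
      case False
      then have "d2 < x" "x < 0" using x by auto
      from d2(2)[OF this] have "\<bar>h x - (M - cm * \<bar>x\<bar> powr m)\<bar> \<le> C2 * \<bar>x\<bar> powr (m + 1)" .
      also have "\<dots> \<le> max C1 C2 * \<bar>x\<bar> powr (m + 1)" by (intro mult_right_mono) auto
      finally show ?thesis using False by simp
    qed
    show "\<bar>deriv h x\<bar> \<le> B" using d3(2)[of x] x by simp
  qed (use d1(1) d2(1) d3(1) C1(1) in auto)
qed

text \<open>The remainder of the first-order expansion of \<open>1 / h\<^sup>2\<close> at \<open>M\<close> is
  \<open>(M - h)\<^sup>2 (M + 2 h) / (h\<^sup>2 M\<^sup>3)\<close>.\<close>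

lemma inverse_square_expansion:
  fixes h M :: real
  assumes "M / 2 \<le> h" "h \<le> M" "M > 0"
  shows "\<bar>1 / h\<^sup>2 - 1 / M\<^sup>2 - 2 * (M - h) / M ^ 3\<bar> \<le> 12 / M ^ 4 * (M - h)\<^sup>2"
proof -
  have h: "h > 0" using assms by linarith
  define X where "X = (M + 2 * h) / (h\<^sup>2 * M ^ 3)"
  have eq: "1 / h\<^sup>2 - 1 / M\<^sup>2 - 2 * (M - h) / M ^ 3 = X * (M - h)\<^sup>2"
    unfolding X_def using h \<open>M > 0\<close> by (simp add: divide_simps) algebra
  have "X \<le> 3 * M / ((M / 2)\<^sup>2 * M ^ 3)"
    unfolding X_def using assms h by (intro frac_le mult_right_mono power_mono) auto
  also have "\<dots> = 12 / M ^ 4"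
    using \<open>M > 0\<close> by (simp add: field_simps power2_eq_square eval_nat_numeral)
  finally have "X * (M - h)\<^sup>2 \<le> 12 / M ^ 4 * (M - h)\<^sup>2" by (rule mult_right_mono) simp
  moreover have "X * (M - h)\<^sup>2 \<ge> 0" unfolding X_def using h \<open>M > 0\<close> by simp
  ultimately show ?thesis unfolding eq by simp
qed

text \<open>Near infinity the limit superior stays below \<open>M\<close>; on the remaining compact set \<open>h\<close> attains its
  supremum, which is a value at a nonzero point.\<close>

lemma profile_bounded_away:
  fixes h :: "real \<Rightarrow> real"
  assumes c: "continuous_on UNIV h" and max: "\<And>x. x \<noteq> 0 \<Longrightarrow> h x < M"
    and lim: "Limsup at_infinity (\<lambda>x. ereal (h x)) < ereal M" and "d > 0"
  obtains s where "s < M" "\<And>x. \<bar>x\<bar> \<ge> d \<Longrightarrow> h x \<le> s"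
proof -
  obtain t where t: "Limsup at_infinity (\<lambda>x. ereal (h x)) < t" "t < ereal M"
    using dense[OF lim] by blast
  obtain t' where t': "t < ereal t'" "ereal t' < ereal M" using ereal_dense2[OF t(2)] by blast
  have "\<forall>\<^sub>F x in at_infinity. ereal (h x) < t" by (rule Limsup_lessD[OF t(1)])
  then obtain R where R: "\<And>x. R \<le> norm x \<Longrightarrow> ereal (h x) < t"
    unfolding eventually_at_infinity by blast
  have far: "h x \<le> t'" if "R \<le> \<bar>x\<bar>" for x
    using R[of x] t'(1) that less_trans[of "ereal (h x)" t "ereal t'"] by simp
  define S where "S = {x. d \<le> \<bar>x\<bar> \<and> \<bar>x\<bar> \<le> max R d}"
  have "S = {-max R d..-d} \<union> {d..max R d}" using \<open>d > 0\<close> by (auto simp: S_def)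
  then have "compact S" by (simp add: compact_Un)
  moreover have "S \<noteq> {}" using \<open>d > 0\<close> by (auto simp: S_def intro!: exI[of _ d])
  ultimately obtain y where y: "y \<in> S" "\<And>x. x \<in> S \<Longrightarrow> h x \<le> h y"
    using continuous_attains_sup[of S h] continuous_on_subset[OF c] by blast
  have "h y < M" using y(1) \<open>d > 0\<close> by (intro max) (auto simp: S_def)
  show thesis
  proof (rule that[of "max t' (h y)"])
    show "max t' (h y) < M" using t'(2) \<open>h y < M\<close> by simp
    show "h x \<le> max t' (h y)" if "d \<le> \<bar>x\<bar>" for x
    proof (cases "\<bar>x\<bar> \<le> max R d")
      case True
      then show ?thesis using y(2)[of x] that by (simp add: S_def le_max_iff_disj)
    next
      case False
      then show ?thesis using far[of x] by (simp add: le_max_iff_disj)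
    qed
  qed
qed

theorem theorem5p2:
  fixes h :: "real \<Rightarrow> real" and M cp cm m \<alpha> :: real
  assumes "continuous_on UNIV h" and "\<And>x. h x > 0"
    and i: "\<And>x. x \<noteq> 0 \<Longrightarrow> h x < h 0"
    and ii: "h C1_differentiable_on (UNIV - {0})"
      "M > 0" "cp > 0" "cm > 0" "m \<ge> 1"
      "expansion_at_0 h M cp cm m"
    and iii: "Limsup at_infinity (\<lambda>x. ereal (h x)) < ereal M"
    and "\<alpha> = 2 / (m + 2)"
  shows "(\<forall>\<epsilon>>0. boundedly_invertible (op_scale (\<epsilon> powr (2 * \<alpha>)) (Q_op h M \<epsilon>)) \<and>
                boundedly_invertible (op_scale (\<epsilon> powr (2 * \<alpha>)) (H_op M cp cm m \<epsilon>))) \<and>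
         ((\<lambda>\<epsilon>. norm (op_inverse (op_scale (\<epsilon> powr (2 * \<alpha>)) (Q_op h M \<epsilon>))
                   - op_inverse (op_scale (\<epsilon> powr (2 * \<alpha>)) (H_op M cp cm m \<epsilon>))))
            \<longlongrightarrow> 0) (at_right 0)"
proof -
  note cont = assms(1) and hpos = assms(2)
  obtain d C B where d: "0 < d" "d \<le> 1" and "C > 0"
    and hx: "\<And>x. 0 < \<bar>x\<bar> \<Longrightarrow> \<bar>x\<bar> < d \<Longrightarrow>
      \<bar>h x - (M - (if x > 0 then cp else cm) * \<bar>x\<bar> powr m)\<bar> \<le> C * \<bar>x\<bar> powr (m + 1)"
    and dh: "\<And>x. 0 < \<bar>x\<bar> \<Longrightarrow> \<bar>x\<bar> < d \<Longrightarrow> \<bar>deriv h x\<bar> \<le> B"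
    using expansion_at_0_bounds[OF ii(6)] by blast
  define c where "c x = (if x > 0 then cp else cm)" for x :: real
  define cmax where "cmax = max cp cm"
  define cmin where "cmin = min cp cm"
  have c: "cmin \<le> c x" "c x \<le> cmax" for x by (auto simp: c_def cmin_def cmax_def)
  have "cmin > 0" "cmax > 0" using ii by (auto simp: cmin_def cmax_def)
  note hx = hx[folded c_def]
  have powr_le: "\<bar>x\<bar> powr (m + 1) \<le> \<bar>x\<bar> powr m" "\<bar>x\<bar> powr m \<le> \<bar>x\<bar>"
    "(\<bar>x\<bar> powr m)\<^sup>2 \<le> \<bar>x\<bar> powr (m + 1)" if "0 < \<bar>x\<bar>" "\<bar>x\<bar> < d" for x :: real
    using that d \<open>m \<ge> 1\<close> powr_mono'[of 1 m "\<bar>x\<bar>"] powr_mono'[of m "m + 1" "\<bar>x\<bar>"] powr_mono'[of "m + 1" "2 * m" "\<bar>x\<bar>"]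
    by (simp_all add: powr_power)
  have h_dist: "\<bar>M - h x\<bar> \<le> (cmax + C) * \<bar>x\<bar> powr m" if x: "0 < \<bar>x\<bar>" "\<bar>x\<bar> < d" for x
  proof -
    have "0 \<le> c x * \<bar>x\<bar> powr m"
      using c(1)[of x] \<open>cmin > 0\<close> by (intro mult_nonneg_nonneg) auto
    then have "\<bar>M - h x\<bar> \<le> c x * \<bar>x\<bar> powr m + C * \<bar>x\<bar> powr (m + 1)"
      using hx[OF x] by linarith
    also have "\<dots> \<le> cmax * \<bar>x\<bar> powr m + C * \<bar>x\<bar> powr m"
      using c(2)[of x] powr_le(1)[OF x] \<open>C > 0\<close> by (intro add_mono mult_right_mono mult_left_mono) auto
    finally show ?thesis by (simp add: distrib_right)
  qed
  have M: "h 0 = M"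
  proof (rule LIM_unique)
    show "h \<midarrow>0\<rightarrow> h 0" using cont by (simp add: continuous_on_eq_continuous_at isCont_def)
    have "\<forall>\<^sub>F x in at 0. norm (h x - M) \<le> (cmax + C) * \<bar>x\<bar>"
      unfolding eventually_at
    proof (intro exI[of _ d] conjI ballI impI, fact)
      fix x :: real assume "x \<noteq> 0 \<and> dist x 0 < d"
      then have x: "0 < \<bar>x\<bar>" "\<bar>x\<bar> < d" by auto
      have "(cmax + C) * \<bar>x\<bar> powr m \<le> (cmax + C) * \<bar>x\<bar>"
        using powr_le(2)[OF x] \<open>cmax > 0\<close> \<open>C > 0\<close> by (intro mult_left_mono) auto
      then show "norm (h x - M) \<le> (cmax + C) * \<bar>x\<bar>" using h_dist[OF x] by (simp add: abs_minus_commute)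
    qed
    moreover have "((\<lambda>x::real. (cmax + C) * \<bar>x\<bar>) \<longlongrightarrow> 0) (at 0)" by (auto intro!: tendsto_eq_intros)
    ultimately have "((\<lambda>x. h x - M) \<longlongrightarrow> 0) (at 0)" by (rule Lim_null_comparison)
    then show "h \<midarrow>0\<rightarrow> M" by (rule LIM_zero_cancel)
  qed
  have hM: "h x \<le> M" for x using i[of x] M by (cases "x = 0") auto
  define G where "G x = 1 / (h x)\<^sup>2 - 1 / M\<^sup>2" for x
  have G_mono: "1 / s\<^sup>2 - 1 / M\<^sup>2 \<le> G x" if "h x \<le> s" for s x
  proof -
    have "(h x)\<^sup>2 \<le> s\<^sup>2" using that hpos[of x] by (intro power_mono) auto
    then show ?thesis using hpos[of x] by (simp add: G_def frac_le)
  qed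
  have G0: "G x \<ge> 0" for x using G_mono[OF hM[of x]] by simp
  define k where "k = 12 / M ^ 4 * (cmax + C)\<^sup>2 + 2 * C / M ^ 3"
  have "k > 0" using \<open>M > 0\<close> \<open>C > 0\<close> by (simp add: k_def add_nonneg_pos)
  \<comment> \<open>the second bound keeps \<open>h\<close> above \<open>M / 2\<close>, the third keeps the error of the expansion of \<open>G\<close>
    at most half of its leading term\<close>
  define d0 where "d0 = Min {d, M / (2 * (cmax + C)), cmin / (M ^ 3 * k)}"
  have d0: "0 < d0" "d0 \<le> d" "d0 \<le> M / (2 * (cmax + C))" "d0 \<le> cmin / (M ^ 3 * k)"
    using d(1) \<open>M > 0\<close> \<open>cmax > 0\<close> \<open>C > 0\<close> \<open>cmin > 0\<close> \<open>k > 0\<close> by (auto simp: d0_def)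
  have h_half: "M / 2 \<le> h x" if x: "\<bar>x\<bar> < d0" for x
  proof (cases "x = 0")
    case False
    then have x': "0 < \<bar>x\<bar>" "\<bar>x\<bar> < d" using x d0 by auto
    have "(cmax + C) * \<bar>x\<bar> powr m \<le> (cmax + C) * (M / (2 * (cmax + C)))"
      using powr_le(2)[OF x'] x d0 \<open>cmax > 0\<close> \<open>C > 0\<close> by (intro mult_left_mono) auto
    also have "\<dots> = M / 2" using \<open>cmax > 0\<close> \<open>C > 0\<close> by (simp add: field_simps)
    finally show ?thesis using h_dist[OF x'] by (simp add: abs_le_iff)
  qed (use M \<open>M > 0\<close> in simp)
  have G_near: "\<bar>G x - 2 * c x / M ^ 3 * \<bar>x\<bar> powr m\<bar> \<le> k * \<bar>x\<bar> powr (m + 1)" if x: "\<bar>x\<bar> < d0" for x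
  proof (cases "x = 0")
    case False
    then have x': "0 < \<bar>x\<bar>" "\<bar>x\<bar> < d" using x d0 by auto
    have 1: "\<bar>G x - 2 * (M - h x) / M ^ 3\<bar> \<le> 12 / M ^ 4 * (M - h x)\<^sup>2"
      unfolding G_def by (rule inverse_square_expansion[OF h_half[OF x] hM \<open>M > 0\<close>])
    have "(M - h x)\<^sup>2 \<le> ((cmax + C) * \<bar>x\<bar> powr m)\<^sup>2" using power_mono[OF h_dist[OF x'], of 2] by simp
    also have "\<dots> \<le> (cmax + C)\<^sup>2 * \<bar>x\<bar> powr (m + 1)"
      unfolding power_mult_distrib by (rule mult_left_mono[OF powr_le(3)[OF x']]) simp
    finally have "12 / M ^ 4 * (M - h x)\<^sup>2 \<le> 12 / M ^ 4 * ((cmax + C)\<^sup>2 * \<bar>x\<bar> powr (m + 1))"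
      using \<open>M > 0\<close> by (intro mult_left_mono) auto
    moreover have "\<bar>2 * (M - h x) / M ^ 3 - 2 * c x / M ^ 3 * \<bar>x\<bar> powr m\<bar> \<le> 2 / M ^ 3 * (C * \<bar>x\<bar> powr (m + 1))"
    proof -
      have "2 * (M - h x) / M ^ 3 - 2 * c x / M ^ 3 * \<bar>x\<bar> powr m = - (2 / M ^ 3 * (h x - (M - c x * \<bar>x\<bar> powr m)))"
        using \<open>M > 0\<close> by (simp add: field_simps)
      then have "\<bar>2 * (M - h x) / M ^ 3 - 2 * c x / M ^ 3 * \<bar>x\<bar> powr m\<bar> = 2 / M ^ 3 * \<bar>h x - (M - c x * \<bar>x\<bar> powr m)\<bar>"
        using \<open>M > 0\<close> by (simp only: abs_minus_cancel abs_mult) simp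
      then show ?thesis using hx[OF x'] \<open>M > 0\<close> by (simp add: divide_right_mono)
    qed
    ultimately have "\<bar>G x - 2 * c x / M ^ 3 * \<bar>x\<bar> powr m\<bar>
        \<le> 12 / M ^ 4 * ((cmax + C)\<^sup>2 * \<bar>x\<bar> powr (m + 1)) + 2 / M ^ 3 * (C * \<bar>x\<bar> powr (m + 1))"
      using 1 by linarith
    then show ?thesis by (simp add: k_def distrib_right)
  qed (use M in \<open>simp add: G_def\<close>)
  have G_low_near: "cmin / M ^ 3 * \<bar>x\<bar> powr m \<le> G x" if x: "\<bar>x\<bar> < d0" for x
  proof -
    have "k * \<bar>x\<bar> powr (m + 1) = (k * \<bar>x\<bar>) * \<bar>x\<bar> powr m"
      by (cases "x = 0") (simp_all add: powr_add)
    also have "\<dots> \<le> cmin / M ^ 3 * \<bar>x\<bar> powr m"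
    proof (rule mult_right_mono)
      have "k * \<bar>x\<bar> \<le> k * (cmin / (M ^ 3 * k))" using x d0 \<open>k > 0\<close> by (intro mult_left_mono) auto
      then show "k * \<bar>x\<bar> \<le> cmin / M ^ 3" using \<open>k > 0\<close> by simp
    qed simp
    finally have "k * \<bar>x\<bar> powr (m + 1) \<le> cmin / M ^ 3 * \<bar>x\<bar> powr m" .
    moreover have "2 * (cmin / M ^ 3 * \<bar>x\<bar> powr m) \<le> 2 * c x / M ^ 3 * \<bar>x\<bar> powr m"
    proof -
      have "2 * cmin / M ^ 3 * \<bar>x\<bar> powr m \<le> 2 * c x / M ^ 3 * \<bar>x\<bar> powr m"
        using c(1)[of x] \<open>M > 0\<close> by (intro mult_right_mono divide_right_mono) auto
      then show ?thesis by simp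
    qed
    moreover have "2 * c x / M ^ 3 * \<bar>x\<bar> powr m - G x \<le> k * \<bar>x\<bar> powr (m + 1)"
      using abs_le_D2[OF G_near[OF x]] by simp
    ultimately show ?thesis by argo
  qed
  obtain s where s: "s < M" "\<And>x. \<bar>x\<bar> \<ge> d0 \<Longrightarrow> h x \<le> s"
    using profile_bounded_away[OF cont _ iii d0(1)] i M by metis
  have "s > 0" using s(2)[of d0] hpos[of d0] d0(1) by simp
  define g where "g = 1 / s\<^sup>2 - 1 / M\<^sup>2"
  have "g > 0"
  proof -
    have "s\<^sup>2 < M\<^sup>2" using s(1) \<open>s > 0\<close> by (intro power_strict_mono) auto
    then show ?thesis using \<open>s > 0\<close> \<open>M > 0\<close> by (simp add: g_def frac_less2)
  qed
  \<comment> \<open>the first entry serves near 0, the second away from 0, where radii are at most 1\<close>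
  define c0 where "c0 = pi\<^sup>2 * min (cmin / M ^ 3) g"
  have "c0 > 0" using \<open>cmin > 0\<close> \<open>M > 0\<close> \<open>g > 0\<close> by (simp add: c0_def)
  define A where "A x = pi\<^sup>2 * G x" for x
  define R where "R x = (pi\<^sup>2 / 3 + 1 / 4) * ((deriv h x)\<^sup>2 / (h x)\<^sup>2)" for x
  have q_eq: "q_pot M cp cm m x = pi\<^sup>2 * (2 * c x / M ^ 3 * \<bar>x\<bar> powr m)" for x
    by (simp add: q_pot_def c_def)
  have hm[measurable]: "h \<in> borel_measurable borel" using cont by (rule borel_measurable_continuous_onI)
  have dm[measurable]: "deriv h \<in> borel_measurable borel"
  proof (rule borel_measurable_continuous_countable_exceptions[of "{0}"])
    obtain D where D: "\<And>x. x \<in> UNIV - {0} \<Longrightarrow> (h has_vector_derivative D x) (at x)" "continuous_on (UNIV - {0}) D"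
      using ii(1) unfolding C1_differentiable_on_def by blast
    have eq: "D x = deriv h x" if "x \<in> - {0}" for x
      using D(1)[of x] that by (intro DERIV_imp_deriv[symmetric]) (simp add: has_real_derivative_iff_has_vector_derivative)
    show "continuous_on (- {0}) (deriv h)"
      by (rule continuous_on_eq[OF D(2)[folded Compl_eq_Diff_UNIV] eq])
  qed simp
  \<comment> \<open>\<open>h\<close> may fail to be differentiable at 0; including the unspecified value \<open>deriv h 0\<close> makes the
    bound on \<open>R\<close> valid at every point\<close>
  define k2 where "k2 = (pi\<^sup>2 / 3 + 1 / 4) * ((\<bar>B\<bar> + \<bar>deriv h 0\<bar>)\<^sup>2 / (M / 2)\<^sup>2)"
  note conv = scaled_inverses_converge[where A = A and Q = "q_pot M cp cm m" and R = R and m = m and \<alpha> = \<alpha>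
      and ?\<delta>0.0 = d0 and ?c0.0 = c0 and ?k1.0 = "pi\<^sup>2 * k" and ?k2.0 = k2 and ?c1.0 = "2 * pi\<^sup>2 * cmax / M ^ 3"]
  have W_eq: "W_pot h M \<epsilon> = (\<lambda>x. A x / \<epsilon>\<^sup>2 + R x)" for \<epsilon>
    by (simp add: W_pot_def A_def G_def R_def fun_eq_iff)
  have hyps: "A \<in> borel_measurable borel" "q_pot M cp cm m \<in> borel_measurable borel" "R \<in> borel_measurable borel"
    "\<And>x. A x \<ge> 0" "\<And>x. q_pot M cp cm m x \<ge> 0" "\<And>x. R x \<ge> 0"
    "m > 0" "pi\<^sup>2 * k \<ge> 0" "k2 \<ge> 0"
  proof -
    show "A \<in> borel_measurable borel" "R \<in> borel_measurable borel"
      unfolding A_def G_def R_def by measurable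
    show "q_pot M cp cm m \<in> borel_measurable borel" unfolding q_pot_def by measurable
    show "A x \<ge> 0" for x using G0[of x] by (simp add: A_def)
    show "q_pot M cp cm m x \<ge> 0" for x using ii by (simp add: q_pot_def)
    show "R x \<ge> 0" for x by (simp add: R_def)
    show "m > 0" "pi\<^sup>2 * k \<ge> 0" "k2 \<ge> 0" using \<open>m \<ge> 1\<close> \<open>k > 0\<close> by (simp_all add: k2_def)
  qed
  have AQ: "\<bar>A x - q_pot M cp cm m x\<bar> \<le> pi\<^sup>2 * k * \<bar>x\<bar> powr (m + 1)" if "\<bar>x\<bar> < d0" for x
    unfolding A_def q_eq right_diff_distrib[symmetric] abs_mult
    using mult_left_mono[OF G_near[OF that], of "pi\<^sup>2"] by simp
  have Rk: "R x \<le> k2" if "\<bar>x\<bar> < d0" for x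
  proof -
    have "\<bar>deriv h x\<bar> \<le> \<bar>B\<bar> + \<bar>deriv h 0\<bar>" using dh[of x] that d0 by (cases "x = 0") auto
    then have "\<bar>deriv h x\<bar>\<^sup>2 \<le> (\<bar>B\<bar> + \<bar>deriv h 0\<bar>)\<^sup>2" by (intro power_mono) auto
    moreover have "(M / 2)\<^sup>2 \<le> (h x)\<^sup>2" using h_half[OF that] \<open>M > 0\<close> by (intro power_mono) auto
    ultimately show ?thesis
      unfolding R_def k2_def using \<open>M > 0\<close> by (intro mult_left_mono frac_le) auto
  qed
  have A_low: "c0 * r powr m \<le> A x" if r: "0 < r" "r < d0" "r \<le> \<bar>x\<bar>" for r x
  proof (cases "\<bar>x\<bar> < d0")
    case True
    have "r powr m \<le> \<bar>x\<bar> powr m" using r \<open>m \<ge> 1\<close> by (intro powr_mono2) auto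
    then have "min (cmin / M ^ 3) g * r powr m \<le> cmin / M ^ 3 * \<bar>x\<bar> powr m"
      using \<open>cmin > 0\<close> \<open>M > 0\<close> by (intro mult_mono) auto
    then have "min (cmin / M ^ 3) g * r powr m \<le> G x" using G_low_near[OF True] by linarith
    then show ?thesis unfolding c0_def A_def mult.assoc by (rule mult_left_mono) simp
  next
    case False
    have "r powr m \<le> 1" using r d0 d \<open>m \<ge> 1\<close> by (intro powr_le1) auto
    then have "min (cmin / M ^ 3) g * r powr m \<le> g * 1"
      using \<open>g > 0\<close> by (intro mult_mono) auto
    also have "\<dots> \<le> G x" using G_mono[OF s(2)[of x]] False by (simp add: g_def)
    finally show ?thesis unfolding c0_def A_def mult.assoc by (rule mult_left_mono) simp
  qed
  have Q_low: "c0 * \<bar>x\<bar> powr m \<le> q_pot M cp cm m x" for x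
  proof -
    have "min (cmin / M ^ 3) g \<le> cmin / M ^ 3" by simp
    also have "\<dots> \<le> 2 * c x / M ^ 3" using c(1)[of x] \<open>cmin > 0\<close> \<open>M > 0\<close> by (intro divide_right_mono) auto
    finally have "min (cmin / M ^ 3) g * \<bar>x\<bar> powr m \<le> 2 * c x / M ^ 3 * \<bar>x\<bar> powr m"
      by (rule mult_right_mono) simp
    then show ?thesis unfolding c0_def q_eq mult.assoc[of "pi\<^sup>2"] by (rule mult_left_mono) simp
  qed
  have Q_up: "q_pot M cp cm m x \<le> 2 * pi\<^sup>2 * cmax / M ^ 3 * \<bar>x\<bar> powr m" for x
  proof -
    have "pi\<^sup>2 * (2 * c x / M ^ 3) \<le> pi\<^sup>2 * (2 * cmax / M ^ 3)"
      using c(2)[of x] \<open>M > 0\<close> by (intro mult_left_mono divide_right_mono) auto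
    then have "pi\<^sup>2 * (2 * c x / M ^ 3) * \<bar>x\<bar> powr m \<le> pi\<^sup>2 * (2 * cmax / M ^ 3) * \<bar>x\<bar> powr m"
      by (rule mult_right_mono) simp
    then show ?thesis unfolding q_eq by (simp add: mult_ac)
  qed
  note final = conv[OF hyps(1-7) \<open>\<alpha> = 2 / (m + 2)\<close> d0(1) \<open>c0 > 0\<close> hyps(8,9)]
  show ?thesis
    unfolding Q_op_def H_op_def W_eq
    by (intro conjI allI impI; rule final) (rule AQ Rk A_low Q_low Q_up | assumption)+
qed

end
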